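(* Let $\mathcal{G}=(\mathcal{V},\mathcal{E})$ be a DAG with treatment $A$ and outcome $Y$, $\mathcal{M}$ a linear Gaussian causal model on it as in the context, $n$ a sample size, and $\mathcal{O}_n(\mathcal{M},\hat\tau_K)$ the set of all MSE-optimal adjustment sets. Let $L$ be a valid adjustment set for estimating $\tau$ with $L\neq O$ and $|L|\geq|O|$, where $O$ is the optimal adjustment set. Then $E\{(\hat\tau_L-\tau)^2\}\geq E\{(\hat\tau_O-\tau)^2\}$; consequently, if $L\in\mathcal{O}_n(\mathcal{M},\hat\tau_K)$ then $O\in\mathcal{O}_n(\mathcal{M},\hat\tau_K)$.
   Context: Setting: $\mathcal{G}=(\mathcal{V},\mathcal{E})$ is a DAG over random variables $\mathcal{V}$ containing treatment $A$ and outcome $Y$ with an edge $A\to Y$; the variables follow a linear Gaussian SEM $V_i=\sum_{V_j\in\mathrm{Pa}(V_i,\mathcal{G})}\beta_{ij}V_j+\epsilon_i$, $\epsilon_i\sim\mathcal{N}(0,\sigma_i^2)$ jointly independent, Markov and faithful to $\mathcal{G}$. No variable in $\mathcal{V}\setminus\{A,Y\}$ is a descendant of $A$. $\tau=\frac{\partial}{\partial a}E\{Y\mid do(A=a)\}$. For $K\subseteq\mathcal{V}\setminus\{A,Y\}$, $\hat\tau_K$ is the OLS coefficient of $A$ when regressing $Y$ on $A$ and $K$ using $n$ i.i.d. samples, with $n$ larger than the adjustment set sizes plus 3. An MSE-optimal adjustment set is any $K\subseteq\mathcal{V}\setminus\{A,Y\}$ minimizing $E\{(\hat\tau_K-\tau)^2\}$.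 A set $K$ is a valid adjustment set if $\hat\tau_K$ is unbiased for $\tau$ for every distribution Markov to $\mathcal{G}$. The optimal adjustment set is $O=\mathrm{Pa}\{M(\mathcal{G}),\mathcal{G}\}\setminus(M(\mathcal{G})\cup\{A\})$, where $M(\mathcal{G})$ is the set of mediators (variables on directed paths from $A$ to $Y$) including $Y$ itself; under the pre-treatment assumption this is $O=\mathrm{Pa}(Y,\mathcal{G})\setminus\{A\}$. *)

theory Defs
  imports "HOL-Probability.Probability"
begin

section \<open>Graphs\<close>

text \<open>A graph on node set V with edge set E; (j, i) \<in> E means the edge j \<rightarrow> i.\<close>

definition dag :: "'v set \<Rightarrow> ('v \<times> 'v) set \<Rightarrow> bool" where
  "dag V E \<longleftrightarrow> finite V \<and> E \<subseteq> V \<times> V \<and> acyclic E"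

definition parents :: "('v \<times> 'v) set \<Rightarrow> 'v \<Rightarrow> 'v set" where
  "parents E i = {j. (j, i) \<in> E}"

definition descendant :: "('v \<times> 'v) set \<Rightarrow> 'v \<Rightarrow> 'v \<Rightarrow> bool" where
  "descendant E a d \<longleftrightarrow> (a, d) \<in> E\<^sup>+"

text \<open>Mediators: nodes on directed paths from A to Y (excluding A, including Y).\<close>
definition mediators :: "'v set \<Rightarrow> ('v \<times> 'v) set \<Rightarrow> 'v \<Rightarrow> 'v \<Rightarrow> 'v set" where
  "mediators V E A Y = {m \<in> V. (A, m) \<in> E\<^sup>+ \<and> (m, Y) \<in> E\<^sup>*}"

definition optimal_set :: "'v set \<Rightarrow> ('v \<times> 'v) set \<Rightarrow> 'v \<Rightarrow> 'v \<Rightarrow> 'v set" where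
  "optimal_set V E A Y =
     (\<Union>m\<in>mediators V E A Y. parents E m) - (mediators V E A Y \<union> {A})"

definition adjacent :: "('v \<times> 'v) set \<Rightarrow> 'v \<Rightarrow> 'v \<Rightarrow> bool" where
  "adjacent E u v \<longleftrightarrow> (u, v) \<in> E \<or> (v, u) \<in> E"

text \<open>d-connection of x and y given S: some simple path in the skeleton on which every
  non-collider interior node lies outside S and every collider has a (reflexive)
  descendant in S.\<close>
definition d_connected :: "'v set \<Rightarrow> ('v \<times> 'v) set \<Rightarrow> 'v set \<Rightarrow> 'v \<Rightarrow> 'v \<Rightarrow> bool" where
  "d_connected V E S x y \<longleftrightarrow>
     (\<exists>p. p \<noteq> [] \<and> hd p = x \<and> last p = y \<and> distinct p \<and> set p \<subseteq> V \<and>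
        (\<forall>k. Suc k < length p \<longrightarrow> adjacent E (p ! k) (p ! Suc k)) \<and>
        (\<forall>k. 0 < k \<and> Suc k < length p \<longrightarrow>
           (if (p ! (k - 1), p ! k) \<in> E \<and> (p ! Suc k, p ! k) \<in> E
            then (\<exists>d\<in>S. (p ! k, d) \<in> E\<^sup>*)
            else p ! k \<notin> S)))"

section \<open>Linear Gaussian structural equation models\<close>

text \<open>Coefficient beta i j is the weight of edge j \<rightarrow> i; sigma i is the standard deviation
  of the error of node i.\<close>
definition lin_sem :: "'v set \<Rightarrow> ('v \<times> 'v) set \<Rightarrow> ('v \<Rightarrow> 'v \<Rightarrow> real) \<Rightarrow> ('v \<Rightarrow> real) \<Rightarrow> bool" where
  "lin_sem V E \<beta> \<sigma> \<longleftrightarrow> (\<forall>i j. (j, i) \<notin> E \<longrightarrow> \<beta> i j = 0) \<and> (\<forall>i\<in>V. 0 < \<sigma> i)"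

text \<open>Distribution of the jointly independent Gaussian errors.\<close>
definition noise :: "'v set \<Rightarrow> ('v \<Rightarrow> real) \<Rightarrow> ('v \<Rightarrow> real) measure" where
  "noise V \<sigma> = PiM V (\<lambda>i. density lborel (normal_density 0 (\<sigma> i)))"

text \<open>Solution of the structural equations for a given error vector.\<close>
definition sem_sol :: "'v set \<Rightarrow> ('v \<times> 'v) set \<Rightarrow> ('v \<Rightarrow> 'v \<Rightarrow> real) \<Rightarrow> ('v \<Rightarrow> real) \<Rightarrow> 'v \<Rightarrow> real" where
  "sem_sol V E \<beta> \<epsilon> = (THE x. (\<forall>i\<in>V. x i = (\<Sum>j\<in>parents E i. \<beta> i j * x j) + \<epsilon> i)
                                \<and> (\<forall>i. i \<notin> V \<longrightarrow> x i = 0))"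

text \<open>Solution of the structural equations under the intervention do(A = a).\<close>
definition sem_do :: "'v set \<Rightarrow> ('v \<times> 'v) set \<Rightarrow> ('v \<Rightarrow> 'v \<Rightarrow> real) \<Rightarrow> 'v \<Rightarrow> real \<Rightarrow> ('v \<Rightarrow> real) \<Rightarrow> 'v \<Rightarrow> real" where
  "sem_do V E \<beta> A a \<epsilon> = (THE x. x A = a \<and>
        (\<forall>i\<in>V - {A}. x i = (\<Sum>j\<in>parents E i. \<beta> i j * x j) + \<epsilon> i)
      \<and> (\<forall>i. i \<notin> V \<longrightarrow> x i = 0))"

text \<open>tau = d/da E[Y | do(A = a)] (the derivative, which does not depend on a).\<close>
definition causal_effect :: "'v set \<Rightarrow> ('v \<times> 'v) set \<Rightarrow> ('v \<Rightarrow> 'v \<Rightarrow> real) \<Rightarrow> ('v \<Rightarrow> real) \<Rightarrow> 'v \<Rightarrow> 'v \<Rightarrow> real" where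
  "causal_effect V E \<beta> \<sigma> A Y =
     (THE t. \<forall>a. ((\<lambda>a. \<integral>\<epsilon>. sem_do V E \<beta> A a \<epsilon> Y \<partial>noise V \<sigma>) has_real_derivative t) (at a))"

text \<open>Covariance of two variables, and vanishing partial covariance of i and j given S
  (the residuals of the L2 projections onto span of S are uncorrelated).\<close>
definition sem_cov :: "'v set \<Rightarrow> ('v \<times> 'v) set \<Rightarrow> ('v \<Rightarrow> 'v \<Rightarrow> real) \<Rightarrow> ('v \<Rightarrow> real) \<Rightarrow> (('v \<Rightarrow> real) \<Rightarrow> real) \<Rightarrow> (('v \<Rightarrow> real) \<Rightarrow> real) \<Rightarrow> real" where
  "sem_cov V E \<beta> \<sigma> f g = (\<integral>\<epsilon>. f (sem_sol V E \<beta> \<epsilon>) * g (sem_sol V E \<beta> \<epsilon>) \<partial>noise V \<sigma>)"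

definition partial_uncorrelated :: "'v set \<Rightarrow> ('v \<times> 'v) set \<Rightarrow> ('v \<Rightarrow> 'v \<Rightarrow> real) \<Rightarrow> ('v \<Rightarrow> real) \<Rightarrow> 'v \<Rightarrow> 'v \<Rightarrow> 'v set \<Rightarrow> bool" where
  "partial_uncorrelated V E \<beta> \<sigma> i j S \<longleftrightarrow>
     (\<exists>c d. (\<forall>s\<in>S. sem_cov V E \<beta> \<sigma> (\<lambda>x. x i - (\<Sum>t\<in>S. c t * x t)) (\<lambda>x. x s) = 0)
          \<and> (\<forall>s\<in>S. sem_cov V E \<beta> \<sigma> (\<lambda>x. x j - (\<Sum>t\<in>S. d t * x t)) (\<lambda>x. x s) = 0)
          \<and> sem_cov V E \<beta> \<sigma> (\<lambda>x. x i - (\<Sum>t\<in>S. c t * x t)) (\<lambda>x. x j - (\<Sum>t\<in>S. d t * x t)) = 0)"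

text \<open>Markov and faithful (Gaussian case: conditional independence of two variables
  given a set is vanishing partial covariance).\<close>
definition markov_faithful :: "'v set \<Rightarrow> ('v \<times> 'v) set \<Rightarrow> ('v \<Rightarrow> 'v \<Rightarrow> real) \<Rightarrow> ('v \<Rightarrow> real) \<Rightarrow> bool" where
  "markov_faithful V E \<beta> \<sigma> \<longleftrightarrow>
     (\<forall>i\<in>V. \<forall>j\<in>V. \<forall>S. i \<noteq> j \<and> S \<subseteq> V - {i, j} \<longrightarrow>
        (partial_uncorrelated V E \<beta> \<sigma> i j S \<longleftrightarrow> \<not> d_connected V E S i j))"

section \<open>Samples, OLS, MSE\<close>

text \<open>n i.i.d. samples: the errors of sample k are \<omega> k.\<close>
definition sample_measure :: "nat \<Rightarrow> 'v set \<Rightarrow> ('v \<Rightarrow> real) \<Rightarrow> (nat \<Rightarrow> 'v \<Rightarrow> real) measure" where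
  "sample_measure n V \<sigma> = PiM {..<n} (\<lambda>_. noise V \<sigma>)"

definition rss :: "nat \<Rightarrow> (nat \<Rightarrow> 'v \<Rightarrow> real) \<Rightarrow> 'v \<Rightarrow> 'v set \<Rightarrow> ('v \<Rightarrow> real) \<Rightarrow> real" where
  "rss n X Y R b = (\<Sum>k<n. (X k Y - (\<Sum>j\<in>R. b j * X k j))\<^sup>2)"

text \<open>OLS coefficient of A when regressing Y on the regressors R (no intercept, all
  variables have mean zero); 0 if the least-squares solution is not unique.\<close>
definition ols_coef :: "nat \<Rightarrow> (nat \<Rightarrow> 'v \<Rightarrow> real) \<Rightarrow> 'v \<Rightarrow> 'v \<Rightarrow> 'v set \<Rightarrow> real" where
  "ols_coef n X A Y R =
     (let P = (\<lambda>b. (\<forall>j. j \<notin> R \<longrightarrow> b j = 0) \<and>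
                   (\<forall>b'. (\<forall>j. j \<notin> R \<longrightarrow> b' j = 0) \<longrightarrow> rss n X Y R b \<le> rss n X Y R b'))
      in if (\<exists>!b. P b) then (THE b. P b) A else 0)"

definition tau_hat :: "nat \<Rightarrow> 'v set \<Rightarrow> ('v \<times> 'v) set \<Rightarrow> ('v \<Rightarrow> 'v \<Rightarrow> real) \<Rightarrow> 'v \<Rightarrow> 'v \<Rightarrow> 'v set \<Rightarrow> (nat \<Rightarrow> 'v \<Rightarrow> real) \<Rightarrow> real" where
  "tau_hat n V E \<beta> A Y K \<omega> = ols_coef n (\<lambda>k. sem_sol V E \<beta> (\<omega> k)) A Y (insert A K)"

definition mse :: "nat \<Rightarrow> 'v set \<Rightarrow> ('v \<times> 'v) set \<Rightarrow> ('v \<Rightarrow> 'v \<Rightarrow> real) \<Rightarrow> ('v \<Rightarrow> real) \<Rightarrow> 'v \<Rightarrow> 'v \<Rightarrow> 'v set \<Rightarrow> ennreal" where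
  "mse n V E \<beta> \<sigma> A Y K =
     (\<integral>\<^sup>+\<omega>. ennreal ((tau_hat n V E \<beta> A Y K \<omega> - causal_effect V E \<beta> \<sigma> A Y)\<^sup>2)
        \<partial>sample_measure n V \<sigma>)"

definition mse_optimal_sets :: "nat \<Rightarrow> 'v set \<Rightarrow> ('v \<times> 'v) set \<Rightarrow> ('v \<Rightarrow> 'v \<Rightarrow> real) \<Rightarrow> ('v \<Rightarrow> real) \<Rightarrow> 'v \<Rightarrow> 'v \<Rightarrow> 'v set set" where
  "mse_optimal_sets n V E \<beta> \<sigma> A Y =
     {K. K \<subseteq> V - {A, Y} \<and>
         (\<forall>K'. K' \<subseteq> V - {A, Y} \<longrightarrow> mse n V E \<beta> \<sigma> A Y K \<le> mse n V E \<beta> \<sigma> A Y K')}"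

text \<open>Valid adjustment set: the OLS estimator is unbiased for tau under every linear
  Gaussian SEM on the graph (every admissible sample size).\<close>
definition valid_adjustment :: "'v set \<Rightarrow> ('v \<times> 'v) set \<Rightarrow> 'v \<Rightarrow> 'v \<Rightarrow> 'v set \<Rightarrow> bool" where
  "valid_adjustment V E A Y K \<longleftrightarrow> K \<subseteq> V - {A, Y} \<and>
     (\<forall>\<beta> \<sigma> m. lin_sem V E \<beta> \<sigma> \<and> card K + 3 < m \<longrightarrow>
        integrable (sample_measure m V \<sigma>) (tau_hat m V E \<beta> A Y K) \<and>
        (\<integral>\<omega>. tau_hat m V E \<beta> A Y K \<omega> \<partial>sample_measure m V \<sigma>) = causal_effect V E \<beta> \<sigma> A Y)"

end

theory Submission
  imports Defs
begin

text \<open>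
  Under the pre-treatment assumption \<open>Y\<close> is a sink, \<open>O\<close> is the set of parents of \<open>Y\<close> other than
  \<open>A\<close>, and \<open>\<tau>\<close> is the coefficient of the edge from \<open>A\<close> to \<open>Y\<close>. Write \<open>RSS(A | K)\<close> for the residual
  sum of squares of the sample regression of \<open>A\<close> on \<open>K\<close>. Conditionally on all variables but \<open>Y\<close>, the
  error of the estimator is a Gaussian with variance \<open>\<sigma>\<^sub>Y\<^sup>2 / RSS(A | K)\<close> plus a bias which vanishes for
  \<open>K = O\<close>; so the mean squared error is at least \<open>\<sigma>\<^sub>Y\<^sup>2 E[1 / RSS(A | K)]\<close>, with equality for \<open>K = O\<close>.
  By rotation invariance \<open>RSS(A | K)\<close> is distributed as \<open>v\<^sub>K\<close> times a sum of \<open>n - |K|\<close> squared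
  independent standard Gaussians, \<open>v\<^sub>K\<close> being the population residual variance of \<open>A\<close> given \<open>K\<close>. Hence it is enough
  that \<open>v\<^sub>L \<le> v\<^sub>O\<close> and \<open>|O| \<le> |L|\<close>. For the first inequality, apply the unbiasedness of \<open>L\<close> to the
  models in which \<open>Y\<close> is a single \<open>u \<in> O\<close> plus noise: the effect is zero, so the residual of \<open>A\<close>
  given \<open>L\<close> is uncorrelated with every \<open>u \<in> O\<close>.
\<close>

section \<open>Rotation invariance of standard Gaussian vectors\<close>

text \<open>Validity is available only as unbiasedness, so it is exploited through test models, each
  yielding one vanishing covariance. The residual \<open>w\<close> of \<open>A\<close> given
  \<open>L\<close> is then orthogonal to \<open>L\<close> and to \<open>O\<close>; the residual
  given \<open>O\<close> differs from \<open>w\<close> by an element of the joint span, and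
  Pythagoras gives \<open>v_L \<le> v_O\<close>. Every variable is a linear combination of
  independent standard Gaussians, that is, a vector indexed by \<open>V\<close>, and covariances are
  inner products. Hence one Gram-Schmidt map \<open>resid\<close> serves the population regression
  and also the sample regression, where vectors are indexed by observations. Conditioning takes the
  form of Tonelli: a rotation turns a combination uncorrelated with the others into a coordinate of
  its own, which is integrated separately. The two sums of squares are realised on one Gaussian
  vector, as truncations of different lengths, and compared pointwise. All of this happens with
  nonnegative integrals that may be infinite; the only mean of a signed quantity, that of the
  estimator itself, comes with the integrability contained in validity.\<close>

abbreviation std_normal :: "real measure" where
  "std_normal \<equiv> density lborel (normal_density 0 1)"

definition gauss :: "'i set \<Rightarrow> ('i \<Rightarrow> real) measure" where
  "gauss I = PiM I (\<lambda>_. std_normal)"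

lemma prob_space_std_normal: "prob_space std_normal"
  by (rule prob_space_normal_density) simp

interpretation std: prob_space std_normal
  by (rule prob_space_std_normal)

interpretation stdp: product_prob_space "\<lambda>_::'i. std_normal" I for I
  by (intro product_prob_spaceI prob_space_std_normal)

lemma prob_space_gauss: "prob_space (gauss I)"
  unfolding gauss_def by (intro prob_space_PiM prob_space_std_normal)

lemma sets_gauss [measurable_cong]: "sets (gauss I) = sets (PiM I (\<lambda>_. borel))"
  unfolding gauss_def by (intro sets_PiM_cong) auto

lemma space_gauss: "space (gauss I) = extensional I"
  unfolding gauss_def by (auto simp: space_PiM PiE_def)

text \<open>The product density depends on \<open>x\<close> and \<open>y\<close> only through the
  sum of their squares, and the rotation factors into two one-variable affine substitutions with a
  Tonelli exchange between them. The first divides by \<open>s\<close>, so \<open>s\<close> must be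
  nonzero.\<close>

lemma std_normal_plane_rotation:
  fixes f :: "real \<Rightarrow> real \<Rightarrow> ennreal"
  assumes [measurable]: "case_prod f \<in> borel_measurable (borel \<Otimes>\<^sub>M borel)"
    and cs: "c\<^sup>2 + s\<^sup>2 = 1" and s: "s \<noteq> 0"
  shows "(\<integral>\<^sup>+x. \<integral>\<^sup>+y. f (c * x + s * y) (- s * x + c * y) \<partial>std_normal \<partial>std_normal)
       = (\<integral>\<^sup>+x. \<integral>\<^sup>+y. f x y \<partial>std_normal \<partial>std_normal)"
proof -
  define \<phi> where "\<phi> = (\<lambda>x. ennreal (normal_density 0 1 x))"
  define h where "h = (\<lambda>u v. \<phi> u * (\<phi> v * f u v))"
  have [measurable]: "\<phi> \<in> borel_measurable borel" unfolding \<phi>_def by simp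
  have [measurable]: "case_prod h \<in> borel_measurable (borel \<Otimes>\<^sub>M borel)"
    unfolding h_def by measurable
  have I: "(\<integral>\<^sup>+x. \<integral>\<^sup>+y. g x y \<partial>std_normal \<partial>std_normal)
      = (\<integral>\<^sup>+x. \<integral>\<^sup>+y. \<phi> x * (\<phi> y * g x y) \<partial>lborel \<partial>lborel)"
    if [measurable]: "case_prod g \<in> borel_measurable (borel \<Otimes>\<^sub>M borel)" for g
  proof -
    have "(\<integral>\<^sup>+x. \<integral>\<^sup>+y. g x y \<partial>std_normal \<partial>std_normal)
       = (\<integral>\<^sup>+x. \<integral>\<^sup>+y. \<phi> y * g x y \<partial>lborel \<partial>std_normal)"
      unfolding \<phi>_def by (intro nn_integral_cong nn_integral_density) auto
    also have "\<dots> = (\<integral>\<^sup>+x. \<phi> x * (\<integral>\<^sup>+y. \<phi> y * g x y \<partial>lborel) \<partial>lborel)"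
      unfolding \<phi>_def by (intro nn_integral_density) auto
    also have "\<dots> = (\<integral>\<^sup>+x. \<integral>\<^sup>+y. \<phi> x * (\<phi> y * g x y) \<partial>lborel \<partial>lborel)"
      by (intro nn_integral_cong nn_integral_cmult[symmetric]) auto
    finally show ?thesis .
  qed
  have \<phi>rot: "\<phi> (c * x + s * y) * \<phi> (- s * x + c * y) = \<phi> x * \<phi> y" for x y
  proof -
    have "(c * x + s * y)\<^sup>2 + (- s * x + c * y)\<^sup>2 = (c\<^sup>2 + s\<^sup>2) * (x\<^sup>2 + y\<^sup>2)"
      by algebra
    then have *: "- (c * x + s * y)\<^sup>2 / 2 + - (- s * x + c * y)\<^sup>2 / 2 = - x\<^sup>2 / 2 + - y\<^sup>2 / 2"
      using cs by simp
    have d: "\<phi> u * \<phi> v = ennreal ((1 / sqrt (2 * pi))\<^sup>2 * exp (- u\<^sup>2 / 2 + - v\<^sup>2 / 2))" for u v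
      unfolding \<phi>_def std_normal_density_def exp_add
      by (simp add: ennreal_mult[symmetric] power2_eq_square)
    show ?thesis unfolding d * ..
  qed
  have "(\<integral>\<^sup>+x. \<integral>\<^sup>+y. f x y \<partial>std_normal \<partial>std_normal) = (\<integral>\<^sup>+u. \<integral>\<^sup>+v. h u v \<partial>lborel \<partial>lborel)"
    unfolding h_def by (rule I) measurable
  \<comment> \<open>With \<open>u\<close> fixed, \<open>v\<close> is replaced by
    \<open>x = c * u - s * v\<close>, that is, \<open>v = (c * u - x) / s\<close>.\<close>
  also have "\<dots> = (\<integral>\<^sup>+u. \<integral>\<^sup>+x. ennreal \<bar>-1/s\<bar> * h u (c * u / s + (-1/s) * x) \<partial>lborel \<partial>lborel)"
  proof (rule nn_integral_cong)
    fix u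
    have "(\<integral>\<^sup>+v. h u v \<partial>lborel) = ennreal \<bar>-1/s\<bar> * (\<integral>\<^sup>+x. h u (c * u / s + (-1/s) * x) \<partial>lborel)"
      by (rule nn_integral_real_affine) (use s in auto)
    then show "(\<integral>\<^sup>+v. h u v \<partial>lborel) = (\<integral>\<^sup>+x. ennreal \<bar>-1/s\<bar> * h u (c * u / s + (-1/s) * x) \<partial>lborel)"
      by (simp add: nn_integral_cmult)
  qed
  also have "\<dots> = (\<integral>\<^sup>+x. \<integral>\<^sup>+u. ennreal \<bar>-1/s\<bar> * h u (c * u / s + (-1/s) * x) \<partial>lborel \<partial>lborel)"
    by (rule lborel_pair.Fubini') measurable
  \<comment> \<open>Now \<open>x\<close> is fixed and \<open>u = c * x + s * y\<close>; the
    Jacobians \<open>1 / |s|\<close> and \<open>|s|\<close> cancel.\<close>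
  also have "\<dots> = (\<integral>\<^sup>+x. ennreal \<bar>s\<bar> * (\<integral>\<^sup>+y. ennreal \<bar>-1/s\<bar> *
      h (c * x + s * y) (c * (c * x + s * y) / s + (-1/s) * x) \<partial>lborel) \<partial>lborel)"
    by (intro nn_integral_cong nn_integral_real_affine s) measurable
  also have "\<dots> = (\<integral>\<^sup>+x. \<integral>\<^sup>+y. h (c * x + s * y) (- s * x + c * y) \<partial>lborel \<partial>lborel)"
  proof (rule nn_integral_cong)
    fix x
    have eq: "c * (c * x + s * y) / s + (-1/s) * x = - s * x + c * y" for y
    proof -
      have "c * (c * x + s * y) / s + (-1/s) * x = ((c\<^sup>2 - 1) * x) / s + c * y"
        using s by (simp add: field_simps power2_eq_square)
      also have "c\<^sup>2 - 1 = - s * s" using cs by (simp add: power2_eq_square)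
      finally show ?thesis using s by simp
    qed
    have "ennreal \<bar>s\<bar> * (\<integral>\<^sup>+y. ennreal \<bar>-1/s\<bar> * h (c * x + s * y) (- s * x + c * y) \<partial>lborel)
      = ennreal \<bar>s\<bar> * ennreal \<bar>-1/s\<bar> * (\<integral>\<^sup>+y. h (c * x + s * y) (- s * x + c * y) \<partial>lborel)"
      by (subst nn_integral_cmult) (auto simp: mult.assoc)
    also have "ennreal \<bar>s\<bar> * ennreal \<bar>-1/s\<bar> = 1"
      using s by (simp add: ennreal_mult[symmetric] abs_mult[symmetric])
    finally show "ennreal \<bar>s\<bar> * (\<integral>\<^sup>+y. ennreal \<bar>-1/s\<bar> *
      h (c * x + s * y) (c * (c * x + s * y) / s + (-1/s) * x) \<partial>lborel)
      = (\<integral>\<^sup>+y. h (c * x + s * y) (- s * x + c * y) \<partial>lborel)" unfolding eq by simp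
  qed
  also have "\<dots> = (\<integral>\<^sup>+x. \<integral>\<^sup>+y. \<phi> x * (\<phi> y * f (c * x + s * y) (- s * x + c * y)) \<partial>lborel \<partial>lborel)"
    unfolding h_def mult.assoc[symmetric] \<phi>rot ..
  also have "\<dots> = (\<integral>\<^sup>+x. \<integral>\<^sup>+y. f (c * x + s * y) (- s * x + c * y) \<partial>std_normal \<partial>std_normal)"
    by (rule I[symmetric]) measurable
  finally show ?thesis by simp
qed

section \<open>Measure-preserving maps and rotations of Gaussian vectors\<close>

definition gauss_preserving :: "'i set \<Rightarrow> (('i \<Rightarrow> real) \<Rightarrow> 'i \<Rightarrow> real) \<Rightarrow> bool" where
  "gauss_preserving I T \<longleftrightarrow> T \<in> gauss I \<rightarrow>\<^sub>M gauss I \<and> distr (gauss I) (gauss I) T = gauss I"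

lemma gauss_preservingD:
  assumes "gauss_preserving I T"
  shows "T \<in> gauss I \<rightarrow>\<^sub>M gauss I" "distr (gauss I) (gauss I) T = gauss I"
  using assms by (auto simp: gauss_preserving_def)

lemma gauss_preservingI:
  assumes T: "T \<in> gauss I \<rightarrow>\<^sub>M gauss I"
    and eq: "\<And>f. f \<in> borel_measurable (gauss I) \<Longrightarrow>
      (\<integral>\<^sup>+x. f (T x) \<partial>gauss I) = (\<integral>\<^sup>+x. f x \<partial>gauss I)"
  shows "gauss_preserving I T"
  unfolding gauss_preserving_def
proof (intro conjI T measure_eqI)
  fix B assume "B \<in> sets (distr (gauss I) (gauss I) T)"
  then have B: "B \<in> sets (gauss I)" by simp
  have "emeasure (distr (gauss I) (gauss I) T) B = (\<integral>\<^sup>+x. indicator B x \<partial>distr (gauss I) (gauss I) T)"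
    using B by simp
  also have "\<dots> = (\<integral>\<^sup>+x. indicator B (T x) \<partial>gauss I)"
    using B T by (subst nn_integral_distr) auto
  also have "\<dots> = emeasure (gauss I) B"
    using B by (subst eq) auto
  finally show "emeasure (distr (gauss I) (gauss I) T) B = emeasure (gauss I) B" .
qed simp

lemma nn_integral_gauss_preserving:
  assumes "gauss_preserving I T" "f \<in> borel_measurable (gauss I)"
  shows "(\<integral>\<^sup>+x. f (T x) \<partial>gauss I) = (\<integral>\<^sup>+x. f x \<partial>gauss I)"
proof -
  note T = gauss_preservingD[OF assms(1)]
  have "(\<integral>\<^sup>+x. f x \<partial>distr (gauss I) (gauss I) T) = (\<integral>\<^sup>+x. f (T x) \<partial>gauss I)"
    by (rule nn_integral_distr[OF T(1)]) (use assms(2) in simp)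
  then show ?thesis by (simp add: T(2))
qed

lemma gauss_preserving_id: "gauss_preserving I (\<lambda>x. x)"
  by (rule gauss_preservingI) auto

lemma gauss_preserving_comp:
  assumes S: "gauss_preserving I S" and T: "gauss_preserving I T"
  shows "gauss_preserving I (\<lambda>x. S (T x))"
proof (rule gauss_preservingI)
  note [measurable] = gauss_preservingD(1)[OF S] gauss_preservingD(1)[OF T]
  show "(\<lambda>x. S (T x)) \<in> gauss I \<rightarrow>\<^sub>M gauss I" by measurable
  fix f :: "('a \<Rightarrow> real) \<Rightarrow> ennreal" assume [measurable]: "f \<in> borel_measurable (gauss I)"
  show "(\<integral>\<^sup>+x. f (S (T x)) \<partial>gauss I) = (\<integral>\<^sup>+x. f x \<partial>gauss I)"
    by (subst nn_integral_gauss_preserving[OF T, where f = "\<lambda>x. f (S x)"])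
       (auto intro!: nn_integral_gauss_preserving[OF S])
qed

definition givens :: "'i \<Rightarrow> 'i \<Rightarrow> real \<Rightarrow> real \<Rightarrow> ('i \<Rightarrow> real) \<Rightarrow> 'i \<Rightarrow> real" where
  "givens p q c s x = x(p := c * x p + s * x q, q := - s * x p + c * x q)"

lemma nn_integral_gauss_insert:
  assumes "finite I" "i \<notin> I" "f \<in> borel_measurable (gauss (insert i I))"
  shows "(\<integral>\<^sup>+x. f x \<partial>gauss (insert i I)) = (\<integral>\<^sup>+x. \<integral>\<^sup>+y. f (x(i := y)) \<partial>std_normal \<partial>gauss I)"
  using stdp.product_nn_integral_insert[OF assms(1,2)] assms(3) unfolding gauss_def by blast

text \<open>Tonelli moves the coordinates \<open>p\<close> and \<open>q\<close> into the two
  innermost integrals, where the planar statement applies with all other coordinates held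
  fixed.\<close>

lemma gauss_preserving_givens:
  fixes p q :: 'i
  assumes I: "finite I" "p \<in> I" "q \<in> I" "p \<noteq> q" and cs: "c\<^sup>2 + s\<^sup>2 = 1" "s \<noteq> 0"
  shows "gauss_preserving I (givens p q c s)"
proof -
  define J where "J = I - {p, q}"
  have IJ: "I = insert q (insert p J)" and J: "finite J" "p \<notin> J" "q \<notin> insert p J"
    using I by (auto simp: J_def)
  show ?thesis
  proof (rule gauss_preservingI)
    have "(\<lambda>x. x(p := c * x p + s * x q, q := - s * x p + c * x q)) \<in>
        PiM I (\<lambda>_. borel) \<rightarrow>\<^sub>M PiM I (\<lambda>_. borel :: real measure)"
      using I by (intro measurable_fun_upd[where J = I]) (auto simp: insert_absorb)
    then show [measurable]: "givens p q c s \<in> gauss I \<rightarrow>\<^sub>M gauss I"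
      unfolding givens_def by (simp cong: measurable_cong_sets add: sets_gauss)
    fix f :: "('i \<Rightarrow> real) \<Rightarrow> ennreal" assume f[measurable]: "f \<in> borel_measurable (gauss I)"
    have f': "f \<in> borel_measurable (gauss (insert q (insert p J)))" using f by (simp add: IJ)
    have split: "(\<integral>\<^sup>+x. g x \<partial>gauss I)
        = (\<integral>\<^sup>+x. \<integral>\<^sup>+y. \<integral>\<^sup>+z. g (x(p := y, q := z)) \<partial>std_normal \<partial>std_normal \<partial>gauss J)"
      if g: "g \<in> borel_measurable (gauss I)" for g
    proof -
      have gm: "g \<in> borel_measurable (PiM (insert q (insert p J)) (\<lambda>_. borel))"
        using g unfolding IJ by (simp cong: measurable_cong_sets add: sets_gauss)
      have "(\<integral>\<^sup>+x. g x \<partial>gauss I) = (\<integral>\<^sup>+x. \<integral>\<^sup>+z. g (x(q := z)) \<partial>std_normal \<partial>gauss (insert p J))"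
        using g unfolding IJ by (intro nn_integral_gauss_insert) (use J in auto)
      also have "\<dots> = (\<integral>\<^sup>+x. \<integral>\<^sup>+y. \<integral>\<^sup>+z. g (x(p := y, q := z)) \<partial>std_normal \<partial>std_normal \<partial>gauss J)"
      proof (intro nn_integral_gauss_insert J)
        have "(\<lambda>(x, z). g (x(q := z))) \<in> borel_measurable (PiM (insert p J) (\<lambda>_. borel) \<Otimes>\<^sub>M borel)"
          using gm by measurable
        then have "(\<lambda>(x, z). g (x(q := z))) \<in> borel_measurable (gauss (insert p J) \<Otimes>\<^sub>M std_normal)"
          by (simp cong: measurable_cong_sets sets_pair_measure_cong add: sets_gauss)
        then show "(\<lambda>x. \<integral>\<^sup>+z. g (x(q := z)) \<partial>std_normal) \<in> borel_measurable (gauss (insert p J))"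
          by (rule std.borel_measurable_nn_integral)
      qed
      finally show ?thesis .
    qed
    have gf: "(\<lambda>x. f (givens p q c s x)) \<in> borel_measurable (gauss I)" by measurable
    show "(\<integral>\<^sup>+x. f (givens p q c s x) \<partial>gauss I) = (\<integral>\<^sup>+x. f x \<partial>gauss I)"
      unfolding split[OF f] split[OF gf]
    proof (rule nn_integral_cong)
      fix x assume x: "x \<in> space (gauss J)"
      have fm: "f \<in> borel_measurable (PiM (insert q (insert p J)) (\<lambda>_. borel))"
        using f' by (simp cong: measurable_cong_sets add: sets_gauss)
      have xm: "x \<in> space (PiM J (\<lambda>_. borel))" using x by (simp add: space_gauss space_PiM PiE_def)
      have m: "case_prod (\<lambda>y z. f (x(p := y, q := z))) \<in> borel_measurable (borel \<Otimes>\<^sub>M borel)"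
        using fm xm by measurable
      have "(\<integral>\<^sup>+y. \<integral>\<^sup>+z. f (givens p q c s (x(p := y, q := z))) \<partial>std_normal \<partial>std_normal)
         = (\<integral>\<^sup>+y. \<integral>\<^sup>+z. f (x(p := c * y + s * z, q := - s * y + c * z)) \<partial>std_normal \<partial>std_normal)"
        using I(4) by (intro nn_integral_cong arg_cong[where f = f]) (auto simp: givens_def fun_eq_iff)
      also have "\<dots> = (\<integral>\<^sup>+y. \<integral>\<^sup>+z. f (x(p := y, q := z)) \<partial>std_normal \<partial>std_normal)"
        using std_normal_plane_rotation[OF m cs] .
      finally show "(\<integral>\<^sup>+y. \<integral>\<^sup>+z. f (givens p q c s (x(p := y, q := z))) \<partial>std_normal \<partial>std_normal) = \<dots>" .
    qed
  qed
qed

definition ip :: "'i set \<Rightarrow> ('i \<Rightarrow> real) \<Rightarrow> ('i \<Rightarrow> real) \<Rightarrow> real" where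
  "ip I x y = (\<Sum>i\<in>I. x i * y i)"

lemma ip_givens:
  assumes "finite I" "p \<in> I" "q \<in> I" "p \<noteq> q" and cs: "c\<^sup>2 + s\<^sup>2 = 1"
  shows "ip I (givens p q c s x) (givens p q c s y) = ip I x y"
proof -
  define J where "J = I - {p, q}"
  have IJ: "I = insert q (insert p J)" and J: "finite J" "p \<notin> J" "q \<notin> J" "p \<noteq> q"
    using assms by (auto simp: J_def)
  have "(\<Sum>i\<in>J. givens p q c s x i * givens p q c s y i) = (\<Sum>i\<in>J. x i * y i)"
    using J by (intro sum.cong) (auto simp: givens_def)
  moreover have "(c * x p + s * x q) * (c * y p + s * y q) + (- s * x p + c * x q) * (- s * y p + c * y q)
      = (c\<^sup>2 + s\<^sup>2) * (x p * y p + x q * y q)"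
    by algebra
  ultimately show ?thesis
    using J cs unfolding ip_def IJ by (simp add: givens_def algebra_simps)
qed

text \<open>A chain of plane rotations through \<open>p\<close>: each clears one more coordinate of
  the image of \<open>a\<close> and moves its mass to \<open>p\<close>. The set \<open>J\<close> may
  be smaller than \<open>I\<close> because later some coordinates are dropped from the inner product
  while the Gaussian vector still lives on all of \<open>I\<close>.\<close>

lemma gauss_rotation:
  fixes a :: "'i \<Rightarrow> real"
  assumes I: "finite I" "J \<subseteq> I" "p \<in> J"
  obtains T where "gauss_preserving I T" "\<And>x y. ip J (T x) (T y) = ip J x y"
    "\<And>i. i \<in> J - {p} \<Longrightarrow> T a i = 0"
proof -
  have fJ: "finite J" using I finite_subset by blast
  \<comment> \<open>\<open>W\<close> collects the coordinates already cleared; a further rotation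
    touches only \<open>p\<close> and a new \<open>q\<close>, so they stay zero.\<close>
  have "\<exists>T. gauss_preserving I T \<and> (\<forall>x y. ip J (T x) (T y) = ip J x y) \<and> (\<forall>i\<in>W. T a i = 0)"
    if "W \<subseteq> J - {p}" for W
  proof -
    have "finite W" using that fJ finite_subset by blast
    then show ?thesis using that
    proof (induction W)
      case empty
      show ?case by (rule exI[of _ "\<lambda>x. x"]) (simp add: gauss_preserving_id)
    next
      case (insert q W)
      then obtain T where T: "gauss_preserving I T" "\<And>x y. ip J (T x) (T y) = ip J x y"
        "\<forall>i\<in>W. T a i = 0" by auto
      show ?case
      \<comment> \<open>A coordinate that is already zero would lead to \<open>s = 0\<close>, which
        the planar substitution excludes.\<close>
      proof (cases "T a q = 0")
        case True
        then show ?thesis using T by auto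
      next
        case False
        define \<rho> where "\<rho> = sqrt ((T a p)\<^sup>2 + (T a q)\<^sup>2)"
        have pos: "(T a p)\<^sup>2 + (T a q)\<^sup>2 > 0" using False by (simp add: sum_power2_gt_zero_iff)
        then have \<rho>: "\<rho> > 0" "\<rho>\<^sup>2 = (T a p)\<^sup>2 + (T a q)\<^sup>2" by (auto simp: \<rho>_def)
        \<comment> \<open>The angle for which the new entry at \<open>q\<close>, namely
          \<open>- s * T a p + c * T a q\<close>, vanishes.\<close>
        define c s where "c = T a p / \<rho>" and "s = T a q / \<rho>"
        have cs: "c\<^sup>2 + s\<^sup>2 = 1" "s \<noteq> 0"
          using \<rho> False pos by (auto simp: c_def s_def power_divide add_divide_distrib[symmetric])
        have pq: "p \<in> J" "q \<in> J" "p \<noteq> q" using I insert.prems by auto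
        let ?G = "\<lambda>x. givens p q c s (T x)"
        have "gauss_preserving I ?G"
          by (rule gauss_preserving_comp[OF gauss_preserving_givens T(1)]) (use pq I cs in auto)
        moreover have "ip J (?G x) (?G y) = ip J x y" for x y
          by (subst ip_givens) (use pq fJ cs T in auto)
        moreover have "?G a i = 0" if "i \<in> insert q W" for i
        proof (cases "i = q")
          case True
          then show ?thesis using pq \<rho> by (simp add: givens_def c_def s_def)
        next
          case False
          then show ?thesis using that T insert.prems by (auto simp: givens_def)
        qed
        ultimately show ?thesis by blast
      qed
    qed
  qed
  from this[OF order_refl] that show ?thesis by blast
qed

section \<open>Gram--Schmidt residuals and least squares\<close>

lemma ip_commute: "ip I x y = ip I y x"
  by (simp add: ip_def mult.commute)

lemma ip_add_left: "ip I (\<lambda>i. x i + y i) z = ip I x z + ip I y z"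
  by (simp add: ip_def distrib_right sum.distrib)

lemma ip_diff_left: "ip I (\<lambda>i. x i - y i) z = ip I x z - ip I y z"
  by (simp add: ip_def left_diff_distrib sum_subtractf)

lemma ip_scale_left: "ip I (\<lambda>i. c * x i) z = c * ip I x z"
  by (simp add: ip_def sum_distrib_left mult.assoc)

lemma ip_add_right: "ip I z (\<lambda>i. x i + y i) = ip I z x + ip I z y"
  by (simp add: ip_def distrib_left sum.distrib)

lemma ip_diff_right: "ip I z (\<lambda>i. x i - y i) = ip I z x - ip I z y"
  by (simp add: ip_def right_diff_distrib sum_subtractf)

lemma ip_scale_right: "ip I z (\<lambda>i. c * x i) = c * ip I z x"
  by (simp add: ip_def sum_distrib_left mult.left_commute)

lemma ip_sum_right: "ip I z (\<lambda>i. \<Sum>s\<in>S. f s i) = (\<Sum>s\<in>S. ip I z (f s))"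
  unfolding ip_def sum_distrib_left by (rule sum.swap)

lemma ip_sum_left: "ip I (\<lambda>i. \<Sum>s\<in>S. f s i) z = (\<Sum>s\<in>S. ip I (f s) z)"
  by (simp add: ip_commute[of I _ z] ip_sum_right)

lemmas ip_linear = ip_add_left ip_diff_left ip_scale_left ip_add_right ip_diff_right ip_scale_right

lemma ip_cong: "(\<And>i. i \<in> I \<Longrightarrow> x i = x' i) \<Longrightarrow> (\<And>i. i \<in> I \<Longrightarrow> y i = y' i) \<Longrightarrow> ip I x y = ip I x' y'"
  by (auto simp: ip_def intro: sum.cong)

lemma ip_self_nonneg: "ip I x x \<ge> 0"
  by (simp add: ip_def sum_nonneg)

lemma ip_self_eq_0_iff: "finite I \<Longrightarrow> ip I x x = 0 \<longleftrightarrow> (\<forall>i\<in>I. x i = 0)"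
  by (simp add: ip_def sum_nonneg_eq_0_iff)

text \<open>Equality is demanded at every index, also outside the index set of the inner product, so
  that a member of the span can be replaced by its combination as a function.\<close>

definition lspan :: "('s \<Rightarrow> 'i \<Rightarrow> real) \<Rightarrow> 's set \<Rightarrow> ('i \<Rightarrow> real) \<Rightarrow> bool" where
  "lspan x S h \<longleftrightarrow> (\<exists>c. \<forall>i. h i = (\<Sum>s\<in>S. c s * x s i))"

lemma lspan_zero: "lspan x S (\<lambda>i. 0)"
  unfolding lspan_def by (rule exI[of _ "\<lambda>_. 0"]) simp

lemma lspan_base: "finite S \<Longrightarrow> s \<in> S \<Longrightarrow> lspan x S (x s)"
  unfolding lspan_def
  by (rule exI[of _ "\<lambda>t. if t = s then 1 else 0"]) (simp add: if_distrib[of "\<lambda>c. c * _"] cong: if_cong)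

lemma lspan_diff: "lspan x S g \<Longrightarrow> lspan x S h \<Longrightarrow> lspan x S (\<lambda>i. g i - h i)"
  unfolding lspan_def
  by (elim exE, rule_tac x = "\<lambda>s. c s - ca s" in exI) (simp add: left_diff_distrib sum_subtractf)

lemma lspan_scale: "lspan x S g \<Longrightarrow> lspan x S (\<lambda>i. a * g i)"
  unfolding lspan_def
  by (elim exE, rule_tac x = "\<lambda>s. a * c s" in exI) (simp add: sum_distrib_left mult.assoc)

lemma lspan_add: "lspan x S g \<Longrightarrow> lspan x S h \<Longrightarrow> lspan x S (\<lambda>i. g i + h i)"
  using lspan_diff[of x S g "\<lambda>i. (-1) * h i"] lspan_scale[of x S h "-1"] by simp

lemma lspan_mono:
  assumes "finite S'" "S \<subseteq> S'" "lspan x S g"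
  shows "lspan x S' g"
proof -
  obtain c where c: "\<And>i. g i = (\<Sum>s\<in>S. c s * x s i)" using assms(3) by (auto simp: lspan_def)
  have "g i = (\<Sum>s\<in>S'. (if s \<in> S then c s else 0) * x s i)" for i
    unfolding c using assms by (intro sum.mono_neutral_cong_left) auto
  then show ?thesis unfolding lspan_def by (intro exI[of _ "\<lambda>s. if s \<in> S then c s else 0"]) blast
qed

lemma ip_lspan_eq_0: "lspan x S g \<Longrightarrow> (\<And>s. s \<in> S \<Longrightarrow> ip I h (x s) = 0) \<Longrightarrow> ip I h g = 0"
proof -
  assume "lspan x S g" and orth: "\<And>s. s \<in> S \<Longrightarrow> ip I h (x s) = 0"
  then obtain c where "\<And>i. g i = (\<Sum>s\<in>S. c s * x s i)" by (auto simp: lspan_def)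
  then have "g = (\<lambda>i. \<Sum>s\<in>S. c s * x s i)" by blast
  then show "ip I h g = 0" by (simp add: ip_sum_right ip_scale_right orth)
qed

text \<open>Division by zero makes a redundant regressor drop out.\<close>

fun resid :: "'i set \<Rightarrow> ('s \<Rightarrow> 'i \<Rightarrow> real) \<Rightarrow> 's list \<Rightarrow> ('i \<Rightarrow> real) \<Rightarrow> 'i \<Rightarrow> real" where
  "resid I x [] g = g"
| "resid I x (s # ss) g = (\<lambda>i. resid I x ss g i -
     ip I (resid I x ss g) (resid I x ss (x s)) / ip I (resid I x ss (x s)) (resid I x ss (x s))
       * resid I x ss (x s) i)"

text \<open>Each head is tested against the residual on its tail, so
  \<open>indep I x (A # ss)\<close> contains exactly the nonzero denominator in the formula for the
  coefficient of \<open>A\<close> given \<open>ss\<close>.\<close>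

fun indep :: "'i set \<Rightarrow> ('s \<Rightarrow> 'i \<Rightarrow> real) \<Rightarrow> 's list \<Rightarrow> bool" where
  "indep I x [] \<longleftrightarrow> True"
| "indep I x (s # ss) \<longleftrightarrow> indep I x ss \<and> ip I (resid I x ss (x s)) (resid I x ss (x s)) \<noteq> 0"

lemma lspan_diff_resid: "lspan x (set ss) (\<lambda>i. g i - resid I x ss g i)"
proof (induction ss arbitrary: g)
  case (Cons s ss)
  let ?w = "resid I x ss (x s)"
  define t where "t = ip I (resid I x ss g) ?w / ip I ?w ?w"
  have m: "lspan x (set (s # ss)) (\<lambda>i. h i - resid I x ss h i)" for h
    by (rule lspan_mono[OF _ _ Cons.IH]) auto
  have "lspan x (set (s # ss)) (\<lambda>i. (g i - resid I x ss g i) + t * (x s i - (x s i - ?w i)))"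
    by (intro lspan_add lspan_scale lspan_diff lspan_base m) auto
  then show ?case by (simp add: t_def algebra_simps)
qed (simp add: lspan_zero)

text \<open>Holds for dependent regressors as well: if the new direction \<open>?w\<close> has norm
  zero, it vanishes on \<open>I\<close> and there is nothing to remove.\<close>

lemma ip_resid_regressor:
  assumes I: "finite I" and t: "t \<in> set ss"
  shows "ip I (resid I x ss g) (x t) = 0"
  using t
proof (induction ss arbitrary: g t)
  case (Cons s ss)
  let ?w = "resid I x ss (x s)" and ?r = "resid I x ss g"
  define r' where "r' = resid I x (s # ss) g"
  have r': "r' = (\<lambda>i. ?r i - ip I ?r ?w / ip I ?w ?w * ?w i)" by (simp add: r'_def)
  have old: "ip I r' (x u) = 0" if "u \<in> set ss" for u
    unfolding r' ip_linear using Cons.IH[OF that] by simp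
  have "ip I r' (x s) = 0"
  proof -
    \<comment> \<open>\<open>x s\<close> differs from \<open>?w\<close> by a combination of
      \<open>ss\<close>, so only the pairing with \<open>?w\<close> is left.\<close>
    have "ip I r' (\<lambda>i. x s i - ?w i) = 0"
      by (rule ip_lspan_eq_0[OF lspan_diff_resid old])
    moreover have "ip I r' ?w = 0"
    proof (cases "ip I ?w ?w = 0")
      case True
      then have "\<forall>i\<in>I. ?w i = 0" using I by (simp add: ip_self_eq_0_iff)
      then show ?thesis by (simp add: ip_def)
    next
      case False
      then show ?thesis unfolding r' ip_diff_left ip_scale_left by simp
    qed
    ultimately show ?thesis by (simp add: ip_linear)
  qed
  then show ?case using Cons.prems old by (auto simp: r'_def)
qed simp

lemma ip_resid_lspan:
  assumes "finite I" "lspan x (set ss) h"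
  shows "ip I (resid I x ss g) h = 0"
  by (rule ip_lspan_eq_0[OF assms(2)]) (rule ip_resid_regressor[OF assms(1)])

lemma ip_resid_right:
  assumes "finite I"
  shows "ip I (resid I x ss g) (resid I x ss h) = ip I (resid I x ss g) h"
  using ip_resid_lspan[OF assms lspan_diff_resid, of x ss g h I] by (simp add: ip_linear)

text \<open>The difference of two such decompositions lies in the span and is orthogonal to it, so
  its norm is zero; hence the conclusion is limited to indices in \<open>I\<close>.\<close>

lemma resid_unique:
  assumes I: "finite I" and h: "lspan x (set ss) h"
    and g: "\<And>i. i \<in> I \<Longrightarrow> g i = h i + r i"
    and orth: "\<And>s. s \<in> set ss \<Longrightarrow> ip I r (x s) = 0"
    and i: "i \<in> I"
  shows "resid I x ss g i = r i"
proof -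
  define d where "d = (\<lambda>i. h i - (g i - resid I x ss g i))"
  have d: "lspan x (set ss) d"
    unfolding d_def by (intro lspan_diff h lspan_diff_resid)
  have "ip I d d = ip I (\<lambda>i. resid I x ss g i - r i) d"
    by (rule ip_cong) (auto simp: d_def g)
  also have "\<dots> = 0"
    using ip_resid_lspan[OF I d] ip_lspan_eq_0[OF d orth] by (simp add: ip_linear)
  finally have "\<forall>i\<in>I. d i = 0" using I by (simp add: ip_self_eq_0_iff)
  then show ?thesis using i g by (force simp: d_def)
qed

lemma resid_add_lspan:
  assumes I: "finite I" and h: "lspan x (set ss) h"
    and g: "\<And>i. i \<in> I \<Longrightarrow> g i = h i + g' i" and i: "i \<in> I"
  shows "resid I x ss g i = resid I x ss g' i"
proof (rule resid_unique[OF I _ _ _ i])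
  show "lspan x (set ss) (\<lambda>i. h i + (g' i - resid I x ss g' i))"
    by (intro lspan_add h lspan_diff_resid)
qed (use g ip_resid_regressor[OF I] in auto)

text \<open>The residual on \<open>ls\<close> is orthogonal to both families, and the residual on
  \<open>us\<close> is obtained from it by adding a vector \<open>d\<close> of their joint span.
  Pythagoras does the rest.\<close>

lemma resid_norm_le_of_orthogonal:
  assumes I: "finite I" and orth: "\<And>u. u \<in> set us \<Longrightarrow> ip I (resid I b ls g) (b u) = 0"
  shows "ip I (resid I b ls g) (resid I b ls g) \<le> ip I (resid I b us g) (resid I b us g)"
proof -
  define d where "d = (\<lambda>i. (g i - resid I b ls g i) - (g i - resid I b us g i))"
  have "ip I (resid I b ls g) (\<lambda>i. g i - resid I b ls g i) = 0"
    by (rule ip_resid_lspan[OF I lspan_diff_resid])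
  moreover have "ip I (resid I b ls g) (\<lambda>i. g i - resid I b us g i) = 0"
    by (rule ip_lspan_eq_0[OF lspan_diff_resid]) (rule orth)
  ultimately have d: "ip I (resid I b ls g) d = 0"
    unfolding d_def by (subst ip_diff_right) simp
  have "ip I (resid I b us g) (resid I b us g)
      = ip I (\<lambda>i. resid I b ls g i + d i) (\<lambda>i. resid I b ls g i + d i)"
    by (simp add: d_def)
  also have "\<dots> = ip I (resid I b ls g) (resid I b ls g) + ip I d d"
    using d ip_commute[of I d "resid I b ls g"] unfolding ip_add_left ip_add_right by simp
  finally show ?thesis using ip_self_nonneg[of I d] by simp
qed

lemma resid_scale: "resid I x ss (\<lambda>i. a * g i) = (\<lambda>i. a * resid I x ss g i)"
proof (induction ss arbitrary: g)
  case (Cons s ss)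
  show ?case unfolding resid.simps Cons ip_linear by (auto simp: algebra_simps)
qed simp

lemma resid_cong:
  "(\<And>s i. s \<in> set ss \<Longrightarrow> i \<in> I \<Longrightarrow> x s i = y s i) \<Longrightarrow> (\<And>i. i \<in> I \<Longrightarrow> g i = h i) \<Longrightarrow> i \<in> I
    \<Longrightarrow> resid I x ss g i = resid I y ss h i"
proof (induction ss arbitrary: g h i)
  case (Cons s ss)
  have *: "resid I x ss g j = resid I y ss h j" "resid I x ss (x s) j = resid I y ss (y s) j"
    if "j \<in> I" for j
    using Cons.prems that by (auto intro!: Cons.IH)
  have "ip I (resid I x ss g) (resid I x ss (x s)) = ip I (resid I y ss h) (resid I y ss (y s))"
    "ip I (resid I x ss (x s)) (resid I x ss (x s)) = ip I (resid I y ss (y s)) (resid I y ss (y s))"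
    using * by (auto intro!: ip_cong)
  then show ?case using * Cons.prems(3) by simp
qed simp

lemma indep_cong:
  "(\<And>s i. s \<in> set ss \<Longrightarrow> i \<in> I \<Longrightarrow> x s i = y s i) \<Longrightarrow> indep I x ss \<longleftrightarrow> indep I y ss"
proof (induction ss)
  case (Cons s ss)
  have "resid I x ss (x s) i = resid I y ss (y s) i" if "i \<in> I" for i
    using Cons.prems that by (intro resid_cong) auto
  then have "ip I (resid I x ss (x s)) (resid I x ss (x s)) = ip I (resid I y ss (y s)) (resid I y ss (y s))"
    by (intro ip_cong) auto
  then show ?case using Cons by simp
qed simp

text \<open>Pairing the relation with the residual of the head on the tail kills the tail and
  isolates the coefficient of the head. This supplies the uniqueness of the minimiser that
  \<open>ols_coef\<close> asks for.\<close>

lemma indep_coeffs_zero: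
  assumes "finite I" "distinct ss" "indep I x ss"
    and "\<And>i. i \<in> I \<Longrightarrow> (\<Sum>s\<in>set ss. d s * x s i) = 0"
  shows "s \<in> set ss \<Longrightarrow> d s = 0"
  using assms(2-)
proof (induction ss arbitrary: s)
  case (Cons t ss)
  let ?w = "resid I x ss (x t)"
  have sum: "(\<Sum>s\<in>set (t # ss). d s * x s i) = d t * x t i + (\<Sum>s\<in>set ss. d s * x s i)" for i
    using Cons.prems(2) by simp
  have "lspan x (set ss) (\<lambda>i. \<Sum>s\<in>set ss. d s * x s i)" unfolding lspan_def by blast
  then have "ip I ?w (\<lambda>i. \<Sum>s\<in>set ss. d s * x s i) = 0"
    by (rule ip_resid_lspan[OF assms(1)])
  then have "ip I ?w (\<lambda>i. d t * x t i + (\<Sum>s\<in>set ss. d s * x s i)) = d t * ip I ?w ?w"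
    by (simp add: ip_linear ip_resid_right[OF assms(1)])
  moreover have "ip I ?w (\<lambda>i. d t * x t i + (\<Sum>s\<in>set ss. d s * x s i)) = 0"
    using Cons.prems(4) by (auto simp: ip_def sum[symmetric])
  ultimately have "d t = 0" using Cons.prems(3) by simp
  with Cons show ?case by (auto simp: sum)
qed simp

text \<open>The Frisch-Waugh-Lovell formula: the coefficient of \<open>A\<close> comes from
  regressing \<open>Y\<close> on the residual of \<open>A\<close> given the other regressors
  alone.\<close>

lemma ols_coef_eq:
  assumes ss: "distinct (A # ss)" and ind: "indep {..<n} (\<lambda>j k. X k j) (A # ss)"
  defines "r \<equiv> resid {..<n} (\<lambda>j k. X k j) ss (\<lambda>k. X k A)"
  shows "ols_coef n X A Y (insert A (set ss)) = ip {..<n} r (\<lambda>k. X k Y) / ip {..<n} r r"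
proof -
  define I where "I = {..<n}"
  define x where "x = (\<lambda>j k. X k j)"
  define R where "R = set (A # ss)"
  define y where "y = (\<lambda>k. X k Y)"
  define e where "e = resid I x (A # ss) y"
  have fin: "finite I" "finite R" by (auto simp: I_def R_def)
  obtain c where c: "\<And>i. y i - e i = (\<Sum>s\<in>R. c s * x s i)"
    using lspan_diff_resid[of x "A # ss" y I] by (auto simp: lspan_def e_def R_def)
  \<comment> \<open>Coefficients outside \<open>R\<close> are set to zero because
    \<open>ols_coef\<close> minimises over such functions only.\<close>
  define b where "b = (\<lambda>j. if j \<in> R then c j else 0)"
  have b: "y i = (\<Sum>s\<in>R. b s * x s i) + e i" for i
    using c[of i] by (simp add: b_def algebra_simps)
  \<comment> \<open>Pythagoras around the fitted values: the excess of \<open>b'\<close> over the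
    minimum is the squared norm of a combination with coefficients \<open>b - b'\<close>, which by
    independence vanishes only for \<open>b' = b\<close>.\<close>
  have rss: "rss n X Y R b' = ip I e e + (\<Sum>k\<in>I. (\<Sum>j\<in>R. (b j - b' j) * x j k)\<^sup>2)" for b'
  proof -
    define h where "h = (\<lambda>k. \<Sum>j\<in>R. (b j - b' j) * x j k)"
    have h: "lspan x (set (A # ss)) h"
      unfolding lspan_def h_def R_def by (rule exI[of _ "\<lambda>j. b j - b' j"]) blast
    have "rss n X Y R b' = ip I (\<lambda>k. e k + h k) (\<lambda>k. e k + h k)"
      unfolding rss_def ip_def I_def
    proof (rule sum.cong[OF refl])
      fix k
      have "X k Y - (\<Sum>j\<in>R. b' j * X k j) = e k + h k"
        using b[of k] by (simp add: h_def left_diff_distrib sum_subtractf y_def x_def)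
      then show "(X k Y - (\<Sum>j\<in>R. b' j * X k j))\<^sup>2 = (e k + h k) * (e k + h k)"
        by (simp add: power2_eq_square)
    qed
    also have "\<dots> = ip I e e + ip I h h"
      using ip_resid_lspan[OF fin(1) h, of y] ip_commute[of I h e] by (simp add: ip_linear e_def)
    finally show ?thesis by (simp add: h_def ip_def power2_eq_square)
  qed
  define P where "P = (\<lambda>b. (\<forall>j. j \<notin> R \<longrightarrow> b j = 0) \<and>
                   (\<forall>b'. (\<forall>j. j \<notin> R \<longrightarrow> b' j = 0) \<longrightarrow> rss n X Y R b \<le> rss n X Y R b'))"
  have Pb: "P b" unfolding P_def rss by (auto simp: b_def intro!: sum_nonneg)
  have uniq: "b' = b" if "P b'" for b'
  proof -
    have "rss n X Y R b' \<le> rss n X Y R b" using that Pb unfolding P_def by blast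
    then have "(\<Sum>k\<in>I. (\<Sum>j\<in>R. (b j - b' j) * x j k)\<^sup>2) \<le> 0" unfolding rss by simp
    moreover have "(\<Sum>k\<in>I. (\<Sum>j\<in>R. (b j - b' j) * x j k)\<^sup>2) \<ge> 0" by (intro sum_nonneg) auto
    ultimately have "(\<Sum>k\<in>I. (\<Sum>j\<in>R. (b j - b' j) * x j k)\<^sup>2) = 0" by simp
    then have "\<And>k. k \<in> I \<Longrightarrow> (\<Sum>j\<in>R. (b j - b' j) * x j k) = 0"
      using fin by (simp add: sum_nonneg_eq_0_iff)
    then have "b j - b' j = 0" if "j \<in> R" for j
      using indep_coeffs_zero[OF fin(1) ss, of x "\<lambda>j. b j - b' j" j] ind that
      unfolding R_def x_def I_def by blast
    moreover have "b' j = 0 \<and> b j = 0" if "j \<notin> R" for j using that \<open>P b'\<close> Pb by (simp add: P_def)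
    ultimately show ?thesis by (metis eq_iff_diff_eq_0 ext)
  qed
  have "ols_coef n X A Y (insert A (set ss)) = (if (\<exists>!b. P b) then (THE b. P b) A else 0)"
    unfolding ols_coef_def Let_def P_def R_def by simp
  also have "\<dots> = b A" using Pb uniq by (metis the1_equality)
  finally have ols: "ols_coef n X A Y (insert A (set ss)) = b A" .
  have r: "r = resid I x ss (x A)" by (simp add: r_def x_def I_def)
  have rr: "ip I r r \<noteq> 0" using ind by (simp add: r_def I_def)
  have rspan: "lspan x (set (A # ss)) r"
  proof -
    have "lspan x (set (A # ss)) (\<lambda>i. x A i - (x A i - r i))"
      unfolding r by (intro lspan_diff lspan_base lspan_mono[OF _ _ lspan_diff_resid]) auto
    then show ?thesis by simp
  qed
  have sp: "lspan x (set ss) (\<lambda>k. \<Sum>j\<in>set ss. b j * x j k)" unfolding lspan_def by blast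
  have re: "ip I r e = 0"
    using ip_resid_lspan[OF fin(1) rspan, of y] unfolding e_def[symmetric] by (simp add: ip_commute)
  \<comment> \<open>Of the three parts of \<open>y\<close>, the combination of \<open>ss\<close> and
    the residual \<open>e\<close> are orthogonal to \<open>r\<close>; only the part along
    \<open>A\<close> survives.\<close>
  have "ip I r y = ip I r (\<lambda>k. b A * x A k + (\<Sum>j\<in>set ss. b j * x j k) + e k)"
    using ss by (intro ip_cong) (auto simp: b R_def)
  also have "\<dots> = b A * ip I r r"
    using ip_resid_lspan[OF fin(1) sp, of "x A"] re ip_resid_right[OF fin(1), of x ss "x A" "x A"]
    unfolding ip_add_right ip_scale_right r[symmetric] by simp
  finally show ?thesis using rr ols by (simp add: I_def y_def)
qed

text \<open>Taking residuals is an orthogonal projection that loses one dimension per independent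
  regressor; in suitable orthonormal coordinates it is truncation to the first
  \<open>n - length ss\<close> entries. The map \<open>T\<close> depends on the regressors only, so
  it applies to a random \<open>g\<close> once they are fixed.\<close>

lemma resid_gauss_rotation:
  assumes "indep {..<n} x ss"
  shows "length ss \<le> n \<and> (\<exists>T. gauss_preserving {..<n} T \<and>
    (\<forall>g h. ip {..<n} (resid {..<n} x ss g) (resid {..<n} x ss h) = ip {..<n - length ss} (T g) (T h)))"
  using assms
proof (induction ss)
  case Nil
  show ?case by (auto intro!: exI[of _ "\<lambda>x. x"] gauss_preserving_id)
next
  case (Cons s ss)
  define p where "p = n - length ss"
  from Cons obtain T where T: "gauss_preserving {..<n} T" and le: "length ss \<le> n"
    and Teq: "\<And>g h. ip {..<n} (resid {..<n} x ss g) (resid {..<n} x ss h) = ip {..<p} (T g) (T h)"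
    by (auto simp: p_def)
  define a where "a = T (x s)"
  have aa: "ip {..<p} a a \<noteq> 0" using Cons.prems by (simp add: Teq a_def)
  then have p: "p > 0" by (cases p) (auto simp: ip_def)
  \<comment> \<open>The residual of the new regressor is rotated onto the last axis still in use;
    that axis is then dropped.\<close>
  then obtain S where S: "gauss_preserving {..<n} S" "\<And>x y. ip {..<p} (S x) (S y) = ip {..<p} x y"
    "\<And>i. i \<in> {..<p} - {p - 1} \<Longrightarrow> S a i = 0"
    using gauss_rotation[of "{..<n}" "{..<p}" "p - 1" a] by (metis diff_less finite_lessThan
      lessThan_iff lessThan_subset_iff less_numeral_extra(1) p_def diff_le_self)
  have splitp: "{..<p} = insert (p - 1) {..<p - 1}" using p by auto
  have Sa: "ip {..<p} g a = S g (p - 1) * S a (p - 1)" for g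
  proof -
    have "ip {..<p} g a = ip {..<p} (S g) (S a)" by (simp add: S)
    also have "\<dots> = S g (p - 1) * S a (p - 1) + (\<Sum>i<p - 1. S g i * S a i)"
      unfolding ip_def by (subst splitp) simp
    also have "(\<Sum>i<p - 1. S g i * S a i) = 0"
      by (intro sum.neutral) (auto simp: S)
    finally show ?thesis by simp
  qed
  have nz: "S a (p - 1) \<noteq> 0" using aa Sa[of a] by auto
  have key: "ip {..<n} (resid {..<n} x (s # ss) g) (resid {..<n} x (s # ss) h)
      = ip {..<p - 1} (S (T g)) (S (T h))" for g h
  proof -
    let ?w = "resid {..<n} x ss (x s)" and ?g = "resid {..<n} x ss g" and ?h = "resid {..<n} x ss h"
    \<comment> \<open>The Gram-Schmidt step subtracts a rank-one term, which in the rotated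
      coordinates is the summand with index \<open>p - 1\<close>.\<close>
    have "ip {..<n} (resid {..<n} x (s # ss) g) (resid {..<n} x (s # ss) h)
      = ip {..<n} ?g ?h - ip {..<n} ?g ?w * ip {..<n} ?h ?w / ip {..<n} ?w ?w"
      using Cons.prems ip_commute[of _ ?w ?h]
      unfolding resid.simps ip_diff_left ip_diff_right ip_scale_left ip_scale_right
      by (simp add: field_simps)
    also have "\<dots> = ip {..<p} (T g) (T h) - ip {..<p} (T g) a * ip {..<p} (T h) a / ip {..<p} a a"
      by (simp add: Teq a_def)
    also have "\<dots> = ip {..<p} (S (T g)) (S (T h)) - S (T g) (p - 1) * S (T h) (p - 1)"
      unfolding Sa using nz by (simp add: S(2))
    also have "\<dots> = ip {..<p - 1} (S (T g)) (S (T h))"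
      unfolding ip_def by (subst splitp) simp
    finally show ?thesis .
  qed
  have "gauss_preserving {..<n} (\<lambda>x. S (T x))"
    by (rule gauss_preserving_comp[OF S(1) T])
  then show ?case using key p le by (auto simp: p_def intro!: exI[of _ "\<lambda>x. S (T x)"])
qed

section \<open>Gaussian samples\<close>

lemma measurable_resid:
  assumes "finite I"
    and g: "\<And>k. k \<in> I \<Longrightarrow> (\<lambda>\<omega>. g \<omega> k) \<in> borel_measurable M"
    and x: "\<And>s k. s \<in> set ss \<Longrightarrow> k \<in> I \<Longrightarrow> (\<lambda>\<omega>. x \<omega> s k) \<in> borel_measurable M"
    and k: "k \<in> I"
  shows "(\<lambda>\<omega>. resid I (x \<omega>) ss (g \<omega>) k) \<in> borel_measurable M"
  using g x k
proof (induction ss arbitrary: g k)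
  case (Cons s ss)
  have [measurable]: "(\<lambda>\<omega>. resid I (x \<omega>) ss (g \<omega>) k) \<in> borel_measurable M" if "k \<in> I" for k
    using Cons.prems that by (intro Cons.IH) auto
  have [measurable]: "(\<lambda>\<omega>. resid I (x \<omega>) ss (x \<omega> s) k) \<in> borel_measurable M" if "k \<in> I" for k
    using Cons.prems that by (intro Cons.IH) auto
  note [measurable] = Cons.prems(3)
  show ?case unfolding resid.simps ip_def by measurable
qed simp

lemma measurable_indep:
  assumes I: "finite I"
    and x: "\<And>s k. s \<in> set ss \<Longrightarrow> k \<in> I \<Longrightarrow> (\<lambda>\<omega>. x \<omega> s k) \<in> borel_measurable M"
  shows "Measurable.pred M (\<lambda>\<omega>. indep I (x \<omega>) ss)"
  using x
proof (induction ss)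
  case (Cons s ss)
  have [measurable]: "(\<lambda>\<omega>. resid I (x \<omega>) ss (x \<omega> s) k) \<in> borel_measurable M" if "k \<in> I" for k
    using Cons.prems that I by (intro measurable_resid) auto
  have [measurable]: "Measurable.pred M (\<lambda>\<omega>. indep I (x \<omega>) ss)"
    using Cons by auto
  show ?case unfolding indep.simps ip_def by measurable
qed simp

lemma distr_PiM_componentwise:
  assumes fin: "finite I"
    and M: "\<And>i. prob_space (M i)"
    and f: "\<And>i. f i \<in> M i \<rightarrow>\<^sub>M N i"
  shows "distr (PiM I M) (PiM I N) (\<lambda>x. \<lambda>i\<in>I. f i (x i)) = PiM I (\<lambda>i. distr (M i) (N i) (f i))"
proof -
  note [measurable] = f
  interpret M: product_prob_space M I
    by (intro product_prob_spaceI M)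
  interpret D: product_prob_space "\<lambda>i. distr (M i) (N i) (f i)" I
    by (intro product_prob_spaceI prob_space.prob_space_distr M f)
  have s: "sets (PiM I N) = sets (PiM I (\<lambda>i. distr (M i) (N i) (f i)))"
    by (intro sets_PiM_cong) auto
  show ?thesis
  proof (rule D.PiM_eqI[OF fin])
    fix A assume "\<And>i. i \<in> I \<Longrightarrow> A i \<in> sets (distr (M i) (N i) (f i))"
    then have A: "\<And>i. i \<in> I \<Longrightarrow> A i \<in> sets (N i)" by simp
    have "emeasure (distr (PiM I M) (PiM I N) (\<lambda>x. \<lambda>i\<in>I. f i (x i))) (Pi\<^sub>E I A)
        = emeasure (PiM I M) ((\<lambda>x. \<lambda>i\<in>I. f i (x i)) -` Pi\<^sub>E I A \<inter> space (PiM I M))"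
      using A fin by (intro emeasure_distr) (auto intro!: sets_PiM_I_finite)
    also have "(\<lambda>x. \<lambda>i\<in>I. f i (x i)) -` Pi\<^sub>E I A \<inter> space (PiM I M) = Pi\<^sub>E I (\<lambda>i. f i -` A i \<inter> space (M i))"
      by (auto simp: space_PiM PiE_iff)
    also have "emeasure (PiM I M) \<dots> = (\<Prod>i\<in>I. emeasure (M i) (f i -` A i \<inter> space (M i)))"
      using A f fin by (intro M.emeasure_PiM) (auto intro: measurable_sets)
    also have "\<dots> = (\<Prod>i\<in>I. emeasure (distr (M i) (N i) (f i)) (A i))"
      using A by (intro prod.cong refl emeasure_distr[symmetric] f)
    finally show "emeasure (distr (PiM I M) (PiM I N) (\<lambda>x. \<lambda>i\<in>I. f i (x i))) (Pi\<^sub>E I A) = \<dots>" .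
  qed (use s in simp)
qed

text \<open>Reflection is the device for removing odd terms under a nonnegative integral: the cross
  term of a shifted square, and later the mean of the estimation error.\<close>

lemma gauss_preserving_uminus:
  assumes "finite I"
  shows "gauss_preserving I (\<lambda>x. \<lambda>i\<in>I. - x i)"
proof -
  have D: "distr std_normal borel uminus = std_normal"
  proof -
    have "distributed std_normal lborel (\<lambda>x. x) (normal_density 0 1)"
      by (auto simp: distributed_def distr_id2)
    from std.normal_density_affine[OF this, of "-1" 0]
    have "distributed std_normal lborel uminus (normal_density 0 1)" by simp
    from distributed_distr_eq_density[OF this] show ?thesis
      by (metis (no_types, lifting) distr_cong sets_lborel)
  qed
  have m: "(\<lambda>x. \<lambda>i\<in>I. - x i) \<in> PiM I (\<lambda>_. borel) \<rightarrow>\<^sub>M PiM I (\<lambda>_. borel :: real measure)"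
    by measurable
  then have m': "(\<lambda>x. \<lambda>i\<in>I. - x i) \<in> gauss I \<rightarrow>\<^sub>M gauss I"
    by (simp cong: measurable_cong_sets add: sets_gauss)
  have "distr (gauss I) (gauss I) (\<lambda>x. \<lambda>i\<in>I. - x i)
      = distr (gauss I) (PiM I (\<lambda>_. borel)) (\<lambda>x. \<lambda>i\<in>I. - x i)"
    by (rule distr_cong) (auto simp: sets_gauss)
  also have "\<dots> = PiM I (\<lambda>_. distr std_normal borel uminus)"
    unfolding gauss_def using distr_PiM_componentwise[OF assms, of "\<lambda>_. std_normal" "\<lambda>_. uminus" "\<lambda>_. borel"]
    by (simp add: prob_space_std_normal)
  also have "\<dots> = gauss I" unfolding D gauss_def ..
  finally show ?thesis using m' unfolding gauss_preserving_def by simp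
qed

text \<open>Observations are indexed by a set, not by their number, so that a coordinate can be
  split off by induction over that set.\<close>

definition gauss_sample :: "nat set \<Rightarrow> 'v set \<Rightarrow> (nat \<Rightarrow> 'v \<Rightarrow> real) measure" where
  "gauss_sample K V = PiM K (\<lambda>_. gauss V)"

lemma prob_space_gauss_sample: "prob_space (gauss_sample K V)"
  unfolding gauss_sample_def by (intro prob_space_PiM prob_space_gauss)

lemma sets_gauss_sample [measurable_cong]:
  "sets (gauss_sample K V) = sets (PiM K (\<lambda>_. PiM V (\<lambda>_. borel)))"
  unfolding gauss_sample_def by (intro sets_PiM_cong sets_gauss refl)

lemma measurable_sample_component:
  assumes "k \<in> K" "i \<in> V"
  shows "(\<lambda>\<omega>. \<omega> k i) \<in> borel_measurable (gauss_sample K V)"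
proof -
  have "(\<lambda>\<omega>. \<omega> k i) \<in> borel_measurable (PiM K (\<lambda>_. PiM V (\<lambda>_. borel)))"
    using measurable_compose[OF measurable_component_singleton[OF assms(1), of "\<lambda>_. PiM V (\<lambda>_. borel)"]
        measurable_component_singleton[OF assms(2)]] by simp
  then show ?thesis by (simp cong: measurable_cong_sets add: sets_gauss_sample)
qed

lemma measurable_gauss_component:
  assumes "i \<in> I"
  shows "(\<lambda>z. z i) \<in> borel_measurable (gauss I)"
proof -
  have "(\<lambda>z. z i) \<in> borel_measurable (PiM I (\<lambda>_. borel))"
    using assms by measurable
  then show ?thesis by (simp cong: measurable_cong_sets add: sets_gauss)
qed

text \<open>A product over observations of products over variables is rearranged so that the
  coordinate \<open>i\<close> of all observations forms one Gaussian vector \<open>z\<close>. Each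
  new observation contributes one entry of \<open>z\<close>.\<close>

lemma nn_integral_gauss_sample_split:
  assumes V: "finite V" "i \<notin> V" and K: "finite K"
    and f: "f \<in> borel_measurable (gauss_sample K (insert i V))"
  shows "(\<integral>\<^sup>+\<omega>. f \<omega> \<partial>gauss_sample K (insert i V))
    = (\<integral>\<^sup>+w. \<integral>\<^sup>+z. f (\<lambda>k\<in>K. (w k)(i := z k)) \<partial>gauss K \<partial>gauss_sample K V)"
  using K f
proof (induction K arbitrary: f)
  case empty
  interpret A: product_prob_space "\<lambda>_::nat. gauss (insert i V)" "{}"
    by (intro product_prob_spaceI prob_space_gauss)
  interpret B: product_prob_space "\<lambda>_::nat. gauss V" "{}"
    by (intro product_prob_spaceI prob_space_gauss)
  show ?case
    unfolding gauss_sample_def gauss_def[of "{}"]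
    by (simp add: PiM_empty nn_integral_count_space_finite)
next
  case (insert k K)
  let ?G = "gauss (insert i V)"
  interpret GK: prob_space "gauss K" by (rule prob_space_gauss)
  interpret GV: prob_space "gauss V" by (rule prob_space_gauss)
  interpret G: prob_space "?G" by (rule prob_space_gauss)
  interpret SV: prob_space "gauss_sample K V" by (rule prob_space_gauss_sample)
  interpret SG: prob_space "gauss_sample K (insert i V)" by (rule prob_space_gauss_sample)
  interpret A: product_prob_space "\<lambda>_::nat. ?G" K
    by (intro product_prob_spaceI prob_space_gauss)
  interpret B: product_prob_space "\<lambda>_::nat. gauss V" K
    by (intro product_prob_spaceI prob_space_gauss)
  have fm[measurable]: "f \<in> borel_measurable (PiM (insert k K) (\<lambda>_. PiM (insert i V) (\<lambda>_. borel)))"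
    using insert.prems by (simp cong: measurable_cong_sets add: sets_gauss_sample)
  have kK: "k \<notin> K" and fK: "finite K" using insert by auto
  have upd: "(\<lambda>p. (\<lambda>l\<in>K. (fst (fst p) l)(i := snd (fst p) l))(k := (fst (snd p))(i := snd (snd p))))
     \<in> (PiM K (\<lambda>_. PiM V (\<lambda>_. borel)) \<Otimes>\<^sub>M PiM K (\<lambda>_. borel)) \<Otimes>\<^sub>M (PiM V (\<lambda>_. borel) \<Otimes>\<^sub>M borel)
       \<rightarrow>\<^sub>M PiM (insert k K) (\<lambda>_. PiM (insert i V) (\<lambda>_. borel :: real measure))"
    by (intro measurable_fun_upd[where J = K] measurable_restrict measurable_fun_upd[where J = V]) auto
  note m4 = measurable_compose[OF upd fm]
  have m4': "(\<lambda>((w, z), (v, y)). f ((\<lambda>l\<in>K. (w l)(i := z l))(k := v(i := y))))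
     \<in> borel_measurable ((gauss_sample K V \<Otimes>\<^sub>M gauss K) \<Otimes>\<^sub>M (gauss V \<Otimes>\<^sub>M std_normal))"
    using m4 by (simp cong: measurable_cong_sets sets_pair_measure_cong add: sets_gauss_sample sets_gauss split_beta')
  have "(\<integral>\<^sup>+\<omega>. f \<omega> \<partial>gauss_sample (insert k K) (insert i V))
      = (\<integral>\<^sup>+x. \<integral>\<^sup>+u. f (x(k := u)) \<partial>?G \<partial>gauss_sample K (insert i V))"
    unfolding gauss_sample_def
    by (intro A.product_nn_integral_insert) (use insert gauss_sample_def in auto)
  also have "\<dots> = (\<integral>\<^sup>+w. \<integral>\<^sup>+z. \<integral>\<^sup>+u. f ((\<lambda>l\<in>K. (w l)(i := z l))(k := u)) \<partial>?G \<partial>gauss K \<partial>gauss_sample K V)"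
  proof (rule insert.IH)
    have "(\<lambda>(x, u). f (x(k := u))) \<in> borel_measurable
       (PiM K (\<lambda>_. PiM (insert i V) (\<lambda>_. borel)) \<Otimes>\<^sub>M PiM (insert i V) (\<lambda>_. borel))"
      by measurable
    then have "(\<lambda>(x, u). f (x(k := u))) \<in> borel_measurable (gauss_sample K (insert i V) \<Otimes>\<^sub>M ?G)"
      by (simp cong: measurable_cong_sets sets_pair_measure_cong add: sets_gauss_sample sets_gauss)
    then show "(\<lambda>x. \<integral>\<^sup>+u. f (x(k := u)) \<partial>?G) \<in> borel_measurable (gauss_sample K (insert i V))"
      by (rule G.borel_measurable_nn_integral)
  qed
  also have "\<dots> = (\<integral>\<^sup>+w. \<integral>\<^sup>+z. \<integral>\<^sup>+v. \<integral>\<^sup>+y. f ((\<lambda>l\<in>K. (w l)(i := z l))(k := v(i := y)))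
      \<partial>std_normal \<partial>gauss V \<partial>gauss K \<partial>gauss_sample K V)"
  proof (intro nn_integral_cong nn_integral_gauss_insert V)
    fix w z assume w: "w \<in> space (gauss_sample K V)" and z: "z \<in> space (gauss K)"
    have "(\<lambda>l\<in>K. (w l)(i := z l)) \<in> space (PiM K (\<lambda>_. PiM (insert i V) (\<lambda>_. borel)))"
      using w by (auto simp: gauss_sample_def space_PiM space_gauss PiE_iff extensional_def)
    then have "(\<lambda>u. f ((\<lambda>l\<in>K. (w l)(i := z l))(k := u))) \<in> borel_measurable (PiM (insert i V) (\<lambda>_. borel))"
      by measurable
    then show "(\<lambda>u. f ((\<lambda>l\<in>K. (w l)(i := z l))(k := u))) \<in> borel_measurable ?G"
      by (simp cong: measurable_cong_sets add: sets_gauss)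
  qed
  \<comment> \<open>Tonelli brings the entry \<open>y\<close> of the new observation next to
    \<open>z\<close>, so that both merge into a vector indexed by \<open>insert k K\<close>.\<close>
  also have "\<dots> = (\<integral>\<^sup>+w. \<integral>\<^sup>+v. \<integral>\<^sup>+z. \<integral>\<^sup>+y. f ((\<lambda>l\<in>K. (w l)(i := z l))(k := v(i := y)))
      \<partial>std_normal \<partial>gauss K \<partial>gauss V \<partial>gauss_sample K V)"
  proof (rule nn_integral_cong)
    fix w assume w: "w \<in> space (gauss_sample K V)"
    interpret pair_sigma_finite "gauss V" "gauss K" ..
    have "(\<lambda>((v, z), y). f ((\<lambda>l\<in>K. (w l)(i := z l))(k := v(i := y))))
       \<in> borel_measurable ((gauss V \<Otimes>\<^sub>M gauss K) \<Otimes>\<^sub>M std_normal)"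
      using measurable_compose[OF _ m4', of "\<lambda>((v, z), y). ((w, z), (v, y))" "(gauss V \<Otimes>\<^sub>M gauss K) \<Otimes>\<^sub>M std_normal"] w
      by (simp add: split_beta')
    then have "(\<lambda>(v, z). \<integral>\<^sup>+y. f ((\<lambda>l\<in>K. (w l)(i := z l))(k := v(i := y))) \<partial>std_normal)
       \<in> borel_measurable (gauss V \<Otimes>\<^sub>M gauss K)"
      using std.borel_measurable_nn_integral[of "\<lambda>(v, z) y. f ((\<lambda>l\<in>K. (w l)(i := z l))(k := v(i := y)))"]
      by (simp add: split_beta')
    then show "(\<integral>\<^sup>+z. \<integral>\<^sup>+v. \<integral>\<^sup>+y. f ((\<lambda>l\<in>K. (w l)(i := z l))(k := v(i := y))) \<partial>std_normal \<partial>gauss V \<partial>gauss K)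
       = (\<integral>\<^sup>+v. \<integral>\<^sup>+z. \<integral>\<^sup>+y. f ((\<lambda>l\<in>K. (w l)(i := z l))(k := v(i := y))) \<partial>std_normal \<partial>gauss K \<partial>gauss V)"
      by (rule Fubini')
  qed
  also have "\<dots> = (\<integral>\<^sup>+w. \<integral>\<^sup>+v. \<integral>\<^sup>+z. \<integral>\<^sup>+y. f (\<lambda>l\<in>insert k K. ((w(k := v)) l)(i := (z(k := y)) l))
      \<partial>std_normal \<partial>gauss K \<partial>gauss V \<partial>gauss_sample K V)"
    by (intro nn_integral_cong arg_cong[where f = f]) (use kK in \<open>auto simp: fun_eq_iff\<close>)
  also have "\<dots> = (\<integral>\<^sup>+w. \<integral>\<^sup>+v. \<integral>\<^sup>+z. f (\<lambda>l\<in>insert k K. ((w(k := v)) l)(i := z l))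
      \<partial>gauss (insert k K) \<partial>gauss V \<partial>gauss_sample K V)"
  proof (intro nn_integral_cong nn_integral_gauss_insert[symmetric] fK kK)
    fix w v assume w: "w \<in> space (gauss_sample K V)" and v: "v \<in> space (gauss V)"
    have "(\<lambda>z. \<lambda>l\<in>insert k K. ((w(k := v)) l)(i := z l)) \<in> PiM (insert k K) (\<lambda>_. borel)
        \<rightarrow>\<^sub>M PiM (insert k K) (\<lambda>_. PiM (insert i V) (\<lambda>_. borel :: real measure))"
      by (intro measurable_restrict measurable_fun_upd[where J = V])
         (use w v in \<open>auto simp: gauss_sample_def space_PiM space_gauss PiE_iff\<close>)
    from measurable_compose[OF this fm]
    show "(\<lambda>z. f (\<lambda>l\<in>insert k K. ((w(k := v)) l)(i := z l))) \<in> borel_measurable (gauss (insert k K))"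
      by (simp cong: measurable_cong_sets add: sets_gauss)
  qed
  also have "\<dots> = (\<integral>\<^sup>+w. \<integral>\<^sup>+z. f (\<lambda>l\<in>insert k K. (w l)(i := z l)) \<partial>gauss (insert k K) \<partial>gauss_sample (insert k K) V)"
    unfolding gauss_sample_def
  proof (rule B.product_nn_integral_insert[symmetric, OF fK kK])
    interpret GkK: prob_space "gauss (insert k K)" by (rule prob_space_gauss)
    have "(\<lambda>p. \<lambda>l\<in>insert k K. (fst p l)(i := snd p l)) \<in>
        PiM (insert k K) (\<lambda>_. PiM V (\<lambda>_. borel)) \<Otimes>\<^sub>M PiM (insert k K) (\<lambda>_. borel)
        \<rightarrow>\<^sub>M PiM (insert k K) (\<lambda>_. PiM (insert i V) (\<lambda>_. borel :: real measure))"
      by (intro measurable_restrict measurable_fun_upd[where J = V]) auto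
    from measurable_compose[OF this fm]
    have "(\<lambda>(w, z). f (\<lambda>l\<in>insert k K. (w l)(i := z l))) \<in>
        borel_measurable (gauss_sample (insert k K) V \<Otimes>\<^sub>M gauss (insert k K))"
      by (simp cong: measurable_cong_sets sets_pair_measure_cong add: sets_gauss sets_gauss_sample split_beta')
    from GkK.borel_measurable_nn_integral[OF this]
    show "(\<lambda>w. \<integral>\<^sup>+z. f (\<lambda>l\<in>insert k K. (w l)(i := z l)) \<partial>gauss (insert k K))
        \<in> borel_measurable (PiM (insert k K) (\<lambda>_. gauss V))"
      by (simp add: gauss_sample_def)
  qed
  finally show ?case .
qed

lemma nn_integral_gauss_sample_preserving:
  assumes K: "finite K" and T: "gauss_preserving V T"
    and f: "f \<in> borel_measurable (gauss_sample K V)"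
  shows "(\<integral>\<^sup>+\<omega>. f (\<lambda>k\<in>K. T (\<omega> k)) \<partial>gauss_sample K V) = (\<integral>\<^sup>+\<omega>. f \<omega> \<partial>gauss_sample K V)"
proof -
  note [measurable] = gauss_preservingD(1)[OF T]
  have m: "(\<lambda>\<omega>. \<lambda>k\<in>K. T (\<omega> k)) \<in> gauss_sample K V \<rightarrow>\<^sub>M gauss_sample K V"
    unfolding gauss_sample_def by measurable
  have "distr (gauss_sample K V) (gauss_sample K V) (\<lambda>\<omega>. \<lambda>k\<in>K. T (\<omega> k)) = gauss_sample K V"
    unfolding gauss_sample_def
    using distr_PiM_componentwise[OF K, of "\<lambda>_. gauss V" "\<lambda>_. T" "\<lambda>_. gauss V"] T
    by (simp add: prob_space_gauss gauss_preservingD)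
  then show ?thesis using nn_integral_distr[OF m, of f] f by simp
qed

text \<open>Measurable functions of the sample vectors \<open>g\<close> of one variable and \<open>x s\<close> of the variables \<open>s \<in> S\<close>;
  entries with index at least \<open>n\<close> are junk, so the value must not depend on them.\<close>

definition sample_functional :: "nat \<Rightarrow> 's set \<Rightarrow> ((nat \<Rightarrow> real) \<Rightarrow> ('s \<Rightarrow> nat \<Rightarrow> real) \<Rightarrow> ennreal) \<Rightarrow> bool" where
  "sample_functional n S F \<longleftrightarrow>
     (\<forall>g g' x x'. (\<forall>k<n. g k = g' k) \<longrightarrow> (\<forall>s\<in>S. \<forall>k<n. x s k = x' s k) \<longrightarrow> F g x = F g' x') \<and>
     (\<lambda>p. F (fst p) (\<lambda>s k. snd p (s, k)))
       \<in> borel_measurable (PiM {..<n} (\<lambda>_. borel) \<Otimes>\<^sub>M PiM (S \<times> {..<n}) (\<lambda>_. borel))"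

text \<open>Measurability is asked for along arbitrary random vectors on \<open>M\<close>, the form
  in which closure rules such as \<open>measurable_resid\<close> are stated; the coordinate
  projections are the instance that is used. The type of \<open>M\<close> is fixed since a
  hypothesis cannot be polymorphic.\<close>

lemma sample_functionalI:
  assumes "\<And>g g' x x'. (\<And>k. k < n \<Longrightarrow> g k = g' k) \<Longrightarrow> (\<And>s k. s \<in> S \<Longrightarrow> k < n \<Longrightarrow> x s k = x' s k)
      \<Longrightarrow> F g x = F g' x'"
    and meas: "\<And>(M :: ((nat \<Rightarrow> real) \<times> ('s \<times> nat \<Rightarrow> real)) measure) (g :: _ \<Rightarrow> nat \<Rightarrow> real) (x :: _ \<Rightarrow> 's \<Rightarrow> nat \<Rightarrow> real).
      (\<And>k. k < n \<Longrightarrow> (\<lambda>\<omega>. g \<omega> k) \<in> borel_measurable M) \<Longrightarrow>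
      (\<And>s k. s \<in> S \<Longrightarrow> k < n \<Longrightarrow> (\<lambda>\<omega>. x \<omega> s k) \<in> borel_measurable M) \<Longrightarrow>
      (\<lambda>\<omega>. F (g \<omega>) (x \<omega>)) \<in> borel_measurable M"
  shows "sample_functional n (S :: 's set) F"
  unfolding sample_functional_def
proof (intro conjI allI impI)
  show "(\<lambda>p. F (fst p) (\<lambda>s k. snd p (s, k)))
       \<in> borel_measurable (PiM {..<n} (\<lambda>_. borel) \<Otimes>\<^sub>M PiM (S \<times> {..<n}) (\<lambda>_. borel))"
    by (rule meas) measurable
qed (use assms(1) in blast)

lemma sample_functional_cong:
  assumes "sample_functional n S F"
    and "\<And>k. k < n \<Longrightarrow> g k = g' k" "\<And>s k. s \<in> S \<Longrightarrow> k < n \<Longrightarrow> x s k = x' s k"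
  shows "F g x = F g' x'"
  using assms unfolding sample_functional_def by blast

lemma sample_functional_measurable:
  assumes F: "sample_functional n S F"
    and g: "\<And>k. k < n \<Longrightarrow> (\<lambda>\<omega>. g \<omega> k) \<in> borel_measurable M"
    and x: "\<And>s k. s \<in> S \<Longrightarrow> k < n \<Longrightarrow> (\<lambda>\<omega>. x \<omega> s k) \<in> borel_measurable M"
  shows "(\<lambda>\<omega>. F (g \<omega>) (x \<omega>)) \<in> borel_measurable M"
proof -
  have "(\<lambda>\<omega>. (\<lambda>k\<in>{..<n}. g \<omega> k, \<lambda>p\<in>S \<times> {..<n}. x \<omega> (fst p) (snd p)))
     \<in> M \<rightarrow>\<^sub>M PiM {..<n} (\<lambda>_. borel) \<Otimes>\<^sub>M PiM (S \<times> {..<n}) (\<lambda>_. borel)"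
    using g x by (intro measurable_Pair measurable_restrict) auto
  from measurable_compose[OF this, of "\<lambda>p. F (fst p) (\<lambda>s k. snd p (s, k))"] F
  have "(\<lambda>\<omega>. F (\<lambda>k\<in>{..<n}. g \<omega> k) (\<lambda>s k. (\<lambda>p\<in>S \<times> {..<n}. x \<omega> (fst p) (snd p)) (s, k))) \<in> borel_measurable M"
    unfolding sample_functional_def by simp
  also have "(\<lambda>\<omega>. F (\<lambda>k\<in>{..<n}. g \<omega> k) (\<lambda>s k. (\<lambda>p\<in>S \<times> {..<n}. x \<omega> (fst p) (snd p)) (s, k)))
     = (\<lambda>\<omega>. F (g \<omega>) (x \<omega>))"
    by (intro ext sample_functional_cong[OF F]) auto
  finally show ?thesis .
qed

lemma measurable_ip:
  assumes "\<And>i. i \<in> V \<Longrightarrow> (\<lambda>\<omega>. f \<omega> i) \<in> borel_measurable M" "\<And>i. i \<in> V \<Longrightarrow> (\<lambda>\<omega>. g \<omega> i) \<in> borel_measurable M"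
  shows "(\<lambda>\<omega>. ip V (f \<omega>) (g \<omega>)) \<in> borel_measurable M"
  unfolding ip_def using assms by (intro borel_measurable_sum borel_measurable_times)

text \<open>Uncorrelated Gaussians are independent: rotate \<open>a\<close> onto a coordinate axis, then split off that
  coordinate from all observations.\<close>

proposition decouple:
  fixes a :: "'v \<Rightarrow> real" and B :: "'s \<Rightarrow> 'v \<Rightarrow> real"
  assumes V: "finite V" and orth: "\<And>s. s \<in> S \<Longrightarrow> ip V a (B s) = 0"
  obtains \<alpha> where "\<alpha>\<^sup>2 = ip V a a"
    "\<And>F. sample_functional n S F \<Longrightarrow>
      (\<integral>\<^sup>+\<omega>. F (\<lambda>k. ip V a (\<omega> k)) (\<lambda>s k. ip V (B s) (\<omega> k)) \<partial>gauss_sample {..<n} V)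
      = (\<integral>\<^sup>+\<omega>. \<integral>\<^sup>+z. F (\<lambda>k. \<alpha> * z k) (\<lambda>s k. ip V (B s) (\<omega> k)) \<partial>gauss {..<n} \<partial>gauss_sample {..<n} V)"
\<comment> \<open>The degenerate combination gets \<open>\<alpha> = 0\<close>; it includes the case
  of empty \<open>V\<close>, where there is no axis to rotate onto.\<close>
proof (cases "ip V a a = 0")
  case True
  then have "\<forall>i\<in>V. a i = 0" using V by (simp add: ip_self_eq_0_iff)
  then have a0: "ip V a y = 0" for y by (simp add: ip_def)
  interpret prob_space "gauss {..<n}" by (rule prob_space_gauss)
  show ?thesis by (rule that[of 0]) (simp_all add: True a0 emeasure_space_1)
next
  case False
  then obtain i0 where i0: "i0 \<in> V" by (metis ip_def sum.neutral)
  obtain T where T: "gauss_preserving V T" "\<And>x y. ip V (T x) (T y) = ip V x y"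
    "\<And>i. i \<in> V - {i0} \<Longrightarrow> T a i = 0"
    using gauss_rotation[OF V order_refl i0, of a] by blast
  define W where "W = V - {i0}"
  have VW: "V = insert i0 W" "finite W" "i0 \<notin> W" using V i0 by (auto simp: W_def)
  define \<alpha> where "\<alpha> = T a i0"
  have ipTa: "ip V (T a) y = \<alpha> * y i0" for y
  proof -
    have "(\<Sum>i\<in>W. T a i * y i) = 0" using T(3) by (intro sum.neutral) (auto simp: W_def)
    then show ?thesis using VW(2,3) by (simp add: ip_def VW(1) \<alpha>_def)
  qed
  have \<alpha>: "\<alpha>\<^sup>2 = ip V a a"
    using ipTa[of "T a"] by (simp add: T(2) \<alpha>_def power2_eq_square)
  \<comment> \<open>As \<open>\<alpha>\<close> is nonzero, orthogonality to \<open>a\<close> says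
    that the rotated \<open>B s\<close> has no component along the axis \<open>i0\<close>, so it
    does not see the coordinate split off.\<close>
  have B0: "T (B s) i0 = 0" if "s \<in> S" for s
    using ipTa[of "T (B s)"] orth[OF that] False \<alpha> by (auto simp: T(2))
  have ipB: "ip V (T (B s)) y = ip W (T (B s)) y" if "s \<in> S" for s y
    using VW(2,3) B0[OF that] by (simp add: ip_def VW(1))
  have step: "(\<integral>\<^sup>+\<omega>. F (\<lambda>k. ip V a (\<omega> k)) (\<lambda>s k. ip V (B s) (\<omega> k)) \<partial>gauss_sample {..<n} V)
      = (\<integral>\<^sup>+w. \<integral>\<^sup>+z. F (\<lambda>k. \<alpha> * z k) (\<lambda>s k. ip W (T (B s)) (w k)) \<partial>gauss {..<n} \<partial>gauss_sample {..<n} W)"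
    if F: "sample_functional n S F" for F
  proof -
    define G where "G = (\<lambda>\<omega>. F (\<lambda>k. ip V (T a) (\<omega> k)) (\<lambda>s k. ip V (T (B s)) (\<omega> k)))"
    have G: "G \<in> borel_measurable (gauss_sample {..<n} V)"
      unfolding G_def
      by (intro sample_functional_measurable[OF F] measurable_ip measurable_sample_component) auto
    have "(\<integral>\<^sup>+\<omega>. F (\<lambda>k. ip V a (\<omega> k)) (\<lambda>s k. ip V (B s) (\<omega> k)) \<partial>gauss_sample {..<n} V)
      = (\<integral>\<^sup>+\<omega>. G (\<lambda>k\<in>{..<n}. T (\<omega> k)) \<partial>gauss_sample {..<n} V)"
      unfolding G_def by (intro nn_integral_cong sample_functional_cong[OF F]) (auto simp: T(2))
    also have "\<dots> = (\<integral>\<^sup>+\<omega>. G \<omega> \<partial>gauss_sample {..<n} V)"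
      by (rule nn_integral_gauss_sample_preserving[OF _ T(1) G]) simp
    also have "\<dots> = (\<integral>\<^sup>+w. \<integral>\<^sup>+z. G (\<lambda>k\<in>{..<n}. (w k)(i0 := z k)) \<partial>gauss {..<n} \<partial>gauss_sample {..<n} W)"
      using G unfolding VW(1) by (intro nn_integral_gauss_sample_split VW) auto
    also have "\<dots> = (\<integral>\<^sup>+w. \<integral>\<^sup>+z. F (\<lambda>k. \<alpha> * z k) (\<lambda>s k. ip W (T (B s)) (w k)) \<partial>gauss {..<n} \<partial>gauss_sample {..<n} W)"
    proof (intro nn_integral_cong)
      fix w :: "nat \<Rightarrow> 'v \<Rightarrow> real" and z :: "nat \<Rightarrow> real"
      show "G (\<lambda>k\<in>{..<n}. (w k)(i0 := z k)) = F (\<lambda>k. \<alpha> * z k) (\<lambda>s k. ip W (T (B s)) (w k))"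
        unfolding G_def
      proof (rule sample_functional_cong[OF F])
        fix s k assume "s \<in> S" "k < n"
        then show "ip V (T (B s)) ((\<lambda>k\<in>{..<n}. (w k)(i0 := z k)) k) = ip W (T (B s)) (w k)"
          unfolding ipB[OF \<open>s \<in> S\<close>] by (intro ip_cong) (use VW in auto)
      qed (simp add: ipTa)
    qed
    finally show ?thesis .
  qed
  have "(\<integral>\<^sup>+\<omega>. F (\<lambda>k. ip V a (\<omega> k)) (\<lambda>s k. ip V (B s) (\<omega> k)) \<partial>gauss_sample {..<n} V)
      = (\<integral>\<^sup>+\<omega>. \<integral>\<^sup>+z. F (\<lambda>k. \<alpha> * z k) (\<lambda>s k. ip V (B s) (\<omega> k)) \<partial>gauss {..<n} \<partial>gauss_sample {..<n} V)"
    if F: "sample_functional n S F" for F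
  proof -
    interpret N: prob_space "gauss {..<n}" by (rule prob_space_gauss)
    \<comment> \<open>The right-hand side of \<open>step\<close> still lives on the smaller space
      with rotated vectors. A second application of \<open>step\<close>, to a functional ignoring
      its first argument, turns it back into an integral over the original sample.\<close>
    define F2 :: "(nat \<Rightarrow> real) \<Rightarrow> ('s \<Rightarrow> nat \<Rightarrow> real) \<Rightarrow> ennreal"
      where "F2 = (\<lambda>_ x. \<integral>\<^sup>+z. F (\<lambda>k. \<alpha> * z k) x \<partial>gauss {..<n})"
    have "sample_functional n S F2"
    proof (rule sample_functionalI)
      fix g g' :: "nat \<Rightarrow> real" and x x' :: "'s \<Rightarrow> nat \<Rightarrow> real"
      assume "\<And>s k. s \<in> S \<Longrightarrow> k < n \<Longrightarrow> x s k = x' s k"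
      then show "F2 g x = F2 g' x'"
        unfolding F2_def by (intro nn_integral_cong sample_functional_cong[OF F]) auto
    next
      fix M :: "((nat \<Rightarrow> real) \<times> ('s \<times> nat \<Rightarrow> real)) measure"
        and g :: "_ \<Rightarrow> nat \<Rightarrow> real" and x :: "_ \<Rightarrow> 's \<Rightarrow> nat \<Rightarrow> real"
      assume x: "\<And>s k. s \<in> S \<Longrightarrow> k < n \<Longrightarrow> (\<lambda>\<omega>. x \<omega> s k) \<in> borel_measurable M"
      have "(\<lambda>p. F (\<lambda>k. \<alpha> * snd p k) (x (fst p))) \<in> borel_measurable (M \<Otimes>\<^sub>M gauss {..<n})"
      proof (rule sample_functional_measurable[OF F])
        fix k assume "k < n"
        then show "(\<lambda>p. \<alpha> * snd p k) \<in> borel_measurable (M \<Otimes>\<^sub>M gauss {..<n})"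
          using measurable_compose[OF measurable_snd measurable_gauss_component[of k "{..<n}"]]
          by (intro borel_measurable_times) auto
      next
        fix s k assume "s \<in> S" "k < n"
        then show "(\<lambda>p. x (fst p) s k) \<in> borel_measurable (M \<Otimes>\<^sub>M gauss {..<n})"
          by (rule measurable_compose[OF measurable_fst x])
      qed
      then show "(\<lambda>\<omega>. F2 (g \<omega>) (x \<omega>)) \<in> borel_measurable M"
        unfolding F2_def by (intro N.borel_measurable_nn_integral) (simp add: split_beta')
    qed
    from step[OF this] show ?thesis
      unfolding step[OF F] F2_def by (simp add: N.emeasure_space_1)
  qed
  with \<alpha> that show ?thesis by blast
qed

section \<open>The law of the sample residual sum of squares\<close>

lemma resid_norm_sample_functional:
  assumes "f \<in> borel_measurable borel"
  shows "sample_functional n (set ss) (\<lambda>g x. f (ip {..<n} (resid {..<n} x ss g) (resid {..<n} x ss g)))"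
proof (rule sample_functionalI)
  fix g g' :: "nat \<Rightarrow> real" and x x' :: "'a \<Rightarrow> nat \<Rightarrow> real"
  assume "\<And>k. k < n \<Longrightarrow> g k = g' k" "\<And>s k. s \<in> set ss \<Longrightarrow> k < n \<Longrightarrow> x s k = x' s k"
  then have "ip {..<n} (resid {..<n} x ss g) (resid {..<n} x ss g)
      = ip {..<n} (resid {..<n} x' ss g') (resid {..<n} x' ss g')"
    by (intro ip_cong resid_cong) auto
  then show "f (ip {..<n} (resid {..<n} x ss g) (resid {..<n} x ss g))
      = f (ip {..<n} (resid {..<n} x' ss g') (resid {..<n} x' ss g'))" by simp
next
  fix M :: "((nat \<Rightarrow> real) \<times> ('a \<times> nat \<Rightarrow> real)) measure"
    and g :: "_ \<Rightarrow> nat \<Rightarrow> real" and x :: "_ \<Rightarrow> 'a \<Rightarrow> nat \<Rightarrow> real"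
  assume g: "\<And>k. k < n \<Longrightarrow> (\<lambda>\<omega>. g \<omega> k) \<in> borel_measurable M"
    and x: "\<And>s k. s \<in> set ss \<Longrightarrow> k < n \<Longrightarrow> (\<lambda>\<omega>. x \<omega> s k) \<in> borel_measurable M"
  have "(\<lambda>\<omega>. ip {..<n} (resid {..<n} (x \<omega>) ss (g \<omega>)) (resid {..<n} (x \<omega>) ss (g \<omega>))) \<in> borel_measurable M"
    by (intro measurable_ip measurable_resid finite_lessThan g x) simp_all
  from measurable_compose[OF this assms]
  show "(\<lambda>\<omega>. f (ip {..<n} (resid {..<n} (x \<omega>) ss (g \<omega>)) (resid {..<n} (x \<omega>) ss (g \<omega>)))) \<in> borel_measurable M" .
qed

text \<open>\<open>decouple\<close> freezes the regressors and leaves for \<open>a\<close> a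
  multiple of a standard Gaussian vector \<open>z\<close>; a rotation of \<open>z\<close> makes the
  residual sum of squares a truncated sum whose law no longer involves the regressors. A general
  \<open>f\<close> covers both the reciprocal and the indicator of zero.\<close>

lemma nn_integral_resid_norm:
  fixes B :: "'s \<Rightarrow> 'v \<Rightarrow> real"
  assumes V: "finite V" and orth: "\<And>s. s \<in> set ss \<Longrightarrow> ip V a (B s) = 0"
    and f: "f \<in> borel_measurable borel"
    and indep: "AE \<omega> in gauss_sample {..<n} V. indep {..<n} (\<lambda>s k. ip V (B s) (\<omega> k)) ss"
  shows "(\<integral>\<^sup>+\<omega>. f (ip {..<n} (resid {..<n} (\<lambda>s k. ip V (B s) (\<omega> k)) ss (\<lambda>k. ip V a (\<omega> k)))
                           (resid {..<n} (\<lambda>s k. ip V (B s) (\<omega> k)) ss (\<lambda>k. ip V a (\<omega> k)))) \<partial>gauss_sample {..<n} V)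
       = (\<integral>\<^sup>+z. f (ip V a a * ip {..<n - length ss} z z) \<partial>gauss {..<n})"
proof -
  interpret P: prob_space "gauss_sample {..<n} V" by (rule prob_space_gauss_sample)
  define x where "x = (\<lambda>\<omega> s (k :: nat). ip V (B s) (\<omega> k))"
  define F where "F = (\<lambda>g x. f (ip {..<n} (resid {..<n} x ss g) (resid {..<n} x ss g)))"
  have F: "sample_functional n (set ss) F"
    unfolding F_def by (rule resid_norm_sample_functional[OF f])
  obtain \<alpha> where \<alpha>: "\<alpha>\<^sup>2 = ip V a a"
    and dec': "\<And>F. sample_functional n (set ss) F \<Longrightarrow>
      (\<integral>\<^sup>+\<omega>. F (\<lambda>k. ip V a (\<omega> k)) (\<lambda>s k. ip V (B s) (\<omega> k)) \<partial>gauss_sample {..<n} V)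
      = (\<integral>\<^sup>+\<omega>. \<integral>\<^sup>+z. F (\<lambda>k. \<alpha> * z k) (\<lambda>s k. ip V (B s) (\<omega> k)) \<partial>gauss {..<n} \<partial>gauss_sample {..<n} V)"
    using decouple[where S = "set ss" and a = a and B = B and n = n, OF V orth] by blast
  note dec = dec'[OF F, folded x_def]
  have "(\<integral>\<^sup>+\<omega>. \<integral>\<^sup>+z. F (\<lambda>k. \<alpha> * z k) (x \<omega>) \<partial>gauss {..<n} \<partial>gauss_sample {..<n} V)
     = (\<integral>\<^sup>+\<omega>. \<integral>\<^sup>+z. f (ip V a a * ip {..<n - length ss} z z) \<partial>gauss {..<n} \<partial>gauss_sample {..<n} V)"
  proof (rule nn_integral_cong_AE)
    show "AE \<omega> in gauss_sample {..<n} V. (\<integral>\<^sup>+z. F (\<lambda>k. \<alpha> * z k) (x \<omega>) \<partial>gauss {..<n})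
        = (\<integral>\<^sup>+z. f (ip V a a * ip {..<n - length ss} z z) \<partial>gauss {..<n})"
      using indep
    proof (eventually_elim)
      fix \<omega> assume "indep {..<n} (\<lambda>s k. ip V (B s) (\<omega> k)) ss"
      then have "indep {..<n} (x \<omega>) ss" by (simp add: x_def)
      from resid_gauss_rotation[OF this] obtain T where T: "gauss_preserving {..<n} T"
        "\<And>g h. ip {..<n} (resid {..<n} (x \<omega>) ss g) (resid {..<n} (x \<omega>) ss h) = ip {..<n - length ss} (T g) (T h)"
        by blast
      have "(\<integral>\<^sup>+z. F (\<lambda>k. \<alpha> * z k) (x \<omega>) \<partial>gauss {..<n})
         = (\<integral>\<^sup>+z. f (ip V a a * ip {..<n - length ss} (T z) (T z)) \<partial>gauss {..<n})"
        unfolding F_def resid_scale ip_linear T(2) \<alpha>[symmetric] by (simp add: power2_eq_square mult.assoc)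
      also have "\<dots> = (\<integral>\<^sup>+z. f (ip V a a * ip {..<n - length ss} z z) \<partial>gauss {..<n})"
      proof (rule nn_integral_gauss_preserving[OF T(1)])
        have m: "(\<lambda>z. ip {..<n - length ss} z z) \<in> borel_measurable (gauss {..<n})"
          by (intro measurable_ip measurable_gauss_component) auto
        show "(\<lambda>z. f (ip V a a * ip {..<n - length ss} z z)) \<in> borel_measurable (gauss {..<n})"
          by (rule measurable_compose[OF borel_measurable_times[OF borel_measurable_const m] f])
      qed
      finally show "(\<integral>\<^sup>+z. F (\<lambda>k. \<alpha> * z k) (x \<omega>) \<partial>gauss {..<n}) = \<dots>" .
    qed
  qed
  also have "\<dots> = (\<integral>\<^sup>+z. f (ip V a a * ip {..<n - length ss} z z) \<partial>gauss {..<n})"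
    by (simp add: P.emeasure_space_1)
  finally show ?thesis using dec unfolding F_def x_def by simp
qed

lemma AE_gauss_component_nonzero:
  assumes "finite I" "i \<in> I"
  shows "AE z in gauss I. z i \<noteq> 0"
proof -
  have "AE y in std_normal. y \<noteq> 0"
    by (subst AE_density) (auto intro: AE_mp[OF AE_lborel_singleton[of 0]])
  then have "AE z in PiM I (\<lambda>_. std_normal). z i \<noteq> 0"
    using assms by (intro AE_PiM_component prob_space_std_normal) auto
  then show ?thesis unfolding gauss_def .
qed

lemma lspan_sample:
  assumes "lspan B S h" "finite S"
  shows "lspan (\<lambda>s k. ip V (B s) (\<omega> k)) S (\<lambda>k. ip V h (\<omega> k))"
proof -
  obtain c where "\<And>i. h i = (\<Sum>s\<in>S. c s * B s i)" using assms by (auto simp: lspan_def)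
  then have "h = (\<lambda>i. \<Sum>s\<in>S. c s * B s i)" by blast
  then show ?thesis unfolding lspan_def by (intro exI[of _ c]) (simp add: ip_sum_left ip_scale_left)
qed

text \<open>The population regression removes a combination of the regressors, and the sample
  regression annihilates the sample of that combination. This secures the orthogonality required by
  \<open>nn_integral_resid_norm\<close>.\<close>

lemma resid_sample:
  fixes k n :: nat
  assumes "finite V" "k < n"
  shows "resid {..<n} (\<lambda>s k. ip V (B s) (\<omega> k)) ss (\<lambda>k. ip V b (\<omega> k)) k
       = resid {..<n} (\<lambda>s k. ip V (B s) (\<omega> k)) ss (\<lambda>k. ip V (resid V B ss b) (\<omega> k)) k"
proof (rule resid_add_lspan[OF finite_lessThan])
  show "lspan (\<lambda>s k. ip V (B s) (\<omega> k)) (set ss) (\<lambda>k. ip V (\<lambda>i. b i - resid V B ss b i) (\<omega> k))"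
    by (intro lspan_sample lspan_diff_resid) simp
qed (use assms in \<open>auto simp: ip_linear\<close>)

text \<open>Independence of the tail gives the law of the residual norm of the next regressor, a
  positive multiple of a nonempty sum of squares. Applied to the indicator of zero, this law shows
  that the norm vanishes with probability zero.\<close>

lemma AE_indep_sample:
  assumes V: "finite V" and ind: "indep V B ss" and n: "length ss \<le> n"
  shows "AE \<omega> in gauss_sample {..<n} V. indep {..<n} (\<lambda>s k. ip V (B s) (\<omega> k)) ss"
  using ind n
proof (induction ss)
  case (Cons s ss)
  define a where "a = resid V B ss (B s)"
  have a: "ip V a a \<noteq> 0" using Cons.prems by (simp add: a_def)
  define x where "x = (\<lambda>\<omega> s (k :: nat). ip V (B s) (\<omega> k))"
  define q where "q = (\<lambda>\<omega>. ip {..<n} (resid {..<n} (x \<omega>) ss (x \<omega> s)) (resid {..<n} (x \<omega>) ss (x \<omega> s)))"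
  have q: "q \<omega> = ip {..<n} (resid {..<n} (x \<omega>) ss (\<lambda>k. ip V a (\<omega> k))) (resid {..<n} (x \<omega>) ss (\<lambda>k. ip V a (\<omega> k)))" for \<omega>
    unfolding q_def x_def a_def using resid_sample[OF V] by (intro ip_cong) auto
  have IH: "AE \<omega> in gauss_sample {..<n} V. indep {..<n} (x \<omega>) ss"
    unfolding x_def using Cons by simp
  have xm: "(\<lambda>\<omega>. x \<omega> t k) \<in> borel_measurable (gauss_sample {..<n} V)" if "k < n" for t k
    unfolding x_def using that by (intro measurable_ip measurable_gauss_component measurable_sample_component) auto
  have qm[measurable]: "q \<in> borel_measurable (gauss_sample {..<n} V)"
    unfolding q_def by (intro measurable_ip measurable_resid finite_lessThan xm) simp_all
  have "(\<integral>\<^sup>+\<omega>. indicator {0} (q \<omega>) \<partial>gauss_sample {..<n} V)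
      = (\<integral>\<^sup>+z. indicator {0} (ip V a a * ip {..<n - length ss} z z) \<partial>gauss {..<n})"
    unfolding q x_def
    by (rule nn_integral_resid_norm[OF V, where f = "indicator {0}" and a = a])
       (use IH in \<open>auto simp: x_def a_def intro: ip_resid_regressor[OF V]\<close>)
  also have "\<dots> = (\<integral>\<^sup>+z. 0 \<partial>gauss {..<n})"
  proof (rule nn_integral_cong_AE)
    \<comment> \<open>The list \<open>s # ss\<close> has at most \<open>n\<close> entries, so the
      truncated sum contains at least the term with index 0.\<close>
    have "0 \<in> {..<n}" using Cons.prems by simp
    from AE_gauss_component_nonzero[OF _ this]
    show "AE z in gauss {..<n}. (indicator {0} (ip V a a * ip {..<n - length ss} z z) :: ennreal) = 0"
    proof (rule AE_mp[OF _ AE_I2[OF impI]])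
      fix z :: "nat \<Rightarrow> real" assume "z 0 \<noteq> 0"
      moreover have "0 \<in> {..<n - length ss}" using Cons.prems by simp
      ultimately have "ip {..<n - length ss} z z \<noteq> 0" by (metis finite_lessThan ip_self_eq_0_iff)
      then show "(indicator {0} (ip V a a * ip {..<n - length ss} z z) :: ennreal) = 0" using a by simp
    qed simp
  qed
  finally have "(\<integral>\<^sup>+\<omega>. indicator {0} (q \<omega>) \<partial>gauss_sample {..<n} V) = 0" by simp
  moreover have "(\<lambda>\<omega>. indicator {0} (q \<omega>) :: ennreal) \<in> borel_measurable (gauss_sample {..<n} V)"
    by (rule measurable_compose[OF qm]) simp
  ultimately have "AE \<omega> in gauss_sample {..<n} V. (indicator {0} (q \<omega>) :: ennreal) = 0"
    using nn_integral_0_iff_AE by blast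
  with IH show ?case
    unfolding x_def[symmetric]
  proof eventually_elim
    case (elim \<omega>)
    then have "q \<omega> \<noteq> 0" by (auto split: split_indicator_asm)
    with elim show ?case by (simp add: q_def x_def)
  qed
qed simp

lemma nn_integral_inverse_resid_norm:
  assumes V: "finite V" and ind: "indep V B (A # ss)" and n: "length ss < n"
  defines "a \<equiv> resid V B ss (B A)"
  shows "(\<integral>\<^sup>+\<omega>. ennreal (1 / ip {..<n} (resid {..<n} (\<lambda>s k. ip V (B s) (\<omega> k)) ss (\<lambda>k. ip V (B A) (\<omega> k)))
                           (resid {..<n} (\<lambda>s k. ip V (B s) (\<omega> k)) ss (\<lambda>k. ip V (B A) (\<omega> k)))) \<partial>gauss_sample {..<n} V)
       = (\<integral>\<^sup>+z. ennreal (1 / (ip V a a * ip {..<n - length ss} z z)) \<partial>gauss {..<n})"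
proof -
  have eq: "ip {..<n} (resid {..<n} (\<lambda>s k. ip V (B s) (\<omega> k)) ss (\<lambda>k. ip V (B A) (\<omega> k)))
                           (resid {..<n} (\<lambda>s k. ip V (B s) (\<omega> k)) ss (\<lambda>k. ip V (B A) (\<omega> k)))
     = ip {..<n} (resid {..<n} (\<lambda>s k. ip V (B s) (\<omega> k)) ss (\<lambda>k. ip V a (\<omega> k)))
                           (resid {..<n} (\<lambda>s k. ip V (B s) (\<omega> k)) ss (\<lambda>k. ip V a (\<omega> k)))" for \<omega>
    unfolding a_def using resid_sample[OF V] by (intro ip_cong) auto
  show ?thesis unfolding eq
    by (rule nn_integral_resid_norm[OF V, where f = "\<lambda>x. ennreal (1 / x)"])
       (use AE_indep_sample[OF V, of B ss n] ind n in \<open>auto simp: a_def intro: ip_resid_regressor[OF V]\<close>)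
qed

text \<open>Rotating \<open>r\<close> onto the axis 0 leaves its squared norm times the second
  moment of one coordinate. That moment stays as a symbolic factor, being the same for all
  adjustment sets compared.\<close>

lemma nn_integral_ip_square:
  fixes n :: nat
  assumes n: "0 < n"
  shows "(\<integral>\<^sup>+z. ennreal ((ip {..<n} r z)\<^sup>2) \<partial>gauss {..<n})
       = ennreal (ip {..<n} r r) * (\<integral>\<^sup>+z. ennreal ((z 0)\<^sup>2) \<partial>gauss {..<n})"
proof -
  obtain T where T: "gauss_preserving {..<n} T" "\<And>x y. ip {..<n} (T x) (T y) = ip {..<n} x y"
    "\<And>i. i \<in> {..<n} - {0} \<Longrightarrow> T r i = 0"
    using gauss_rotation[OF finite_lessThan order_refl, of 0 n r] n by blast
  have ipT: "ip {..<n} r y = T r 0 * T y 0" for y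
  proof -
    have "ip {..<n} r y = (\<Sum>i<n. T r i * T y i)" using T(2)[of r y] by (simp add: ip_def)
    also have "\<dots> = T r 0 * T y 0 + (\<Sum>i\<in>{..<n} - {0}. T r i * T y i)"
      using n by (subst sum.remove[of _ 0]) auto
    also have "(\<Sum>i\<in>{..<n} - {0}. T r i * T y i) = 0"
      using T(3) by (intro sum.neutral) auto
    finally show ?thesis by simp
  qed
  have m: "(\<lambda>z. z 0) \<in> borel_measurable (gauss {..<n})"
    using n by (intro measurable_gauss_component) auto
  have "(\<integral>\<^sup>+z. ennreal ((ip {..<n} r z)\<^sup>2) \<partial>gauss {..<n})
      = (\<integral>\<^sup>+z. ennreal ((T r 0 * T z 0)\<^sup>2) \<partial>gauss {..<n})"
    by (simp add: ipT)
  also have "\<dots> = (\<integral>\<^sup>+z. ennreal ((T r 0 * z 0)\<^sup>2) \<partial>gauss {..<n})"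
    by (rule nn_integral_gauss_preserving[OF T(1), where f = "\<lambda>z. ennreal ((T r 0 * z 0)\<^sup>2)"])
       (intro measurable_compose[OF _ measurable_ennreal] borel_measurable_power borel_measurable_times
        borel_measurable_add borel_measurable_const m)
  also have "\<dots> = (\<integral>\<^sup>+z. ennreal (ip {..<n} r r) * ennreal ((z 0)\<^sup>2) \<partial>gauss {..<n})"
    by (simp add: ipT power2_eq_square ennreal_mult[symmetric] mult_ac)
  also have "\<dots> = ennreal (ip {..<n} r r) * (\<integral>\<^sup>+z. ennreal ((z 0)\<^sup>2) \<partial>gauss {..<n})"
    by (rule nn_integral_cmult)
       (intro measurable_compose[OF _ measurable_ennreal] borel_measurable_power borel_measurable_times
        borel_measurable_add borel_measurable_const m)
  finally show ?thesis .
qed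

text \<open>Averaging the shifted square over \<open>z\<close> and its reflection cancels the cross
  term, also where the integrals might be infinite.\<close>

lemma nn_integral_shifted_square_ge:
  fixes n :: nat
  shows
  "(\<integral>\<^sup>+z. ennreal ((ip {..<n} r z)\<^sup>2) \<partial>gauss {..<n})
    \<le> (\<integral>\<^sup>+z. ennreal ((\<mu> + ip {..<n} r z)\<^sup>2) \<partial>gauss {..<n})" (is "?L \<le> ?R")
proof -
  have m: "(\<lambda>z. ip {..<n} r z) \<in> borel_measurable (gauss {..<n})"
    by (intro measurable_ip measurable_gauss_component) auto
  have "?R = (\<integral>\<^sup>+z. ennreal ((\<mu> + ip {..<n} r (\<lambda>i\<in>{..<n}. - z i))\<^sup>2) \<partial>gauss {..<n})"
    by (rule nn_integral_gauss_preserving[OF gauss_preserving_uminus[OF finite_lessThan],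
          where f = "\<lambda>z. ennreal ((\<mu> + ip {..<n} r z)\<^sup>2)", symmetric])
       (intro measurable_compose[OF _ measurable_ennreal] borel_measurable_power borel_measurable_times
        borel_measurable_add borel_measurable_const m)
  also have "\<dots> = (\<integral>\<^sup>+z. ennreal ((\<mu> - ip {..<n} r z)\<^sup>2) \<partial>gauss {..<n})"
    by (simp add: ip_def sum_negf)
  finally have R: "?R = (\<integral>\<^sup>+z. ennreal ((\<mu> - ip {..<n} r z)\<^sup>2) \<partial>gauss {..<n})" .
  have mm: "(\<lambda>z. ennreal ((\<mu> + ip {..<n} r z)\<^sup>2)) \<in> borel_measurable (gauss {..<n})"
    "(\<lambda>z. ennreal ((\<mu> - ip {..<n} r z)\<^sup>2)) \<in> borel_measurable (gauss {..<n})"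
    "(\<lambda>z. ennreal ((ip {..<n} r z)\<^sup>2)) \<in> borel_measurable (gauss {..<n})"
    by (intro measurable_compose[OF _ measurable_ennreal] borel_measurable_power
        borel_measurable_add borel_measurable_diff borel_measurable_const m)+
  have "?R + ?R = (\<integral>\<^sup>+z. ennreal ((\<mu> + ip {..<n} r z)\<^sup>2) + ennreal ((\<mu> - ip {..<n} r z)\<^sup>2) \<partial>gauss {..<n})"
    by (subst (2) R) (rule nn_integral_add[OF mm(1,2), symmetric])
  also have "\<dots> \<ge> (\<integral>\<^sup>+z. ennreal ((ip {..<n} r z)\<^sup>2) + ennreal ((ip {..<n} r z)\<^sup>2) \<partial>gauss {..<n})"
  proof (rule nn_integral_mono)
    fix z
    have "(\<mu> + u)\<^sup>2 + (\<mu> - u)\<^sup>2 = u\<^sup>2 + u\<^sup>2 + 2 * \<mu>\<^sup>2" for u by algebra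
    then have "u\<^sup>2 + u\<^sup>2 \<le> (\<mu> + u)\<^sup>2 + (\<mu> - u)\<^sup>2" for u by simp
    then show "ennreal ((ip {..<n} r z)\<^sup>2) + ennreal ((ip {..<n} r z)\<^sup>2)
        \<le> ennreal ((\<mu> + ip {..<n} r z)\<^sup>2) + ennreal ((\<mu> - ip {..<n} r z)\<^sup>2)"
      by (simp flip: ennreal_plus)
  qed
  finally have "?L + ?L \<le> ?R + ?R" by (simp add: nn_integral_add[OF mm(3,3)])
  then show ?thesis by (metis add_strict_mono not_le)
qed

text \<open>\<open>g\<close> is the part of the outcome to be decoupled from the regressors: the
  noise of \<open>Y\<close> for the mean squared error, the population residual of \<open>Y\<close>
  (with \<open>U\<close> empty) for the unbiasedness argument.\<close>

lemma ratio_sample_functional: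
  fixes f :: "real \<Rightarrow> ennreal"
  assumes f: "f \<in> borel_measurable borel" and S: "A \<in> S" "U \<subseteq> S" "set ks \<subseteq> S"
  shows "sample_functional n S (\<lambda>g x. f (ip {..<n} (resid {..<n} x ks (x A)) (\<lambda>k. (\<Sum>u\<in>U. c u * x u k) + g k)
    / ip {..<n} (resid {..<n} x ks (x A)) (resid {..<n} x ks (x A))))"
proof (rule sample_functionalI)
  fix g g' :: "nat \<Rightarrow> real" and x x' :: "'a \<Rightarrow> nat \<Rightarrow> real"
  assume g: "\<And>k. k < n \<Longrightarrow> g k = g' k" and x: "\<And>s k. s \<in> S \<Longrightarrow> k < n \<Longrightarrow> x s k = x' s k"
  have r: "resid {..<n} x ks (x A) k = resid {..<n} x' ks (x' A) k" if "k < n" for k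
    using that S by (intro resid_cong x) auto
  have s: "(\<Sum>u\<in>U. c u * x u k) + g k = (\<Sum>u\<in>U. c u * x' u k) + g' k" if "k < n" for k
    using that S g x by (intro arg_cong2[where f = "(+)"] sum.cong) auto
  have "ip {..<n} (resid {..<n} x ks (x A)) (\<lambda>k. (\<Sum>u\<in>U. c u * x u k) + g k)
      = ip {..<n} (resid {..<n} x' ks (x' A)) (\<lambda>k. (\<Sum>u\<in>U. c u * x' u k) + g' k)"
    "ip {..<n} (resid {..<n} x ks (x A)) (resid {..<n} x ks (x A))
      = ip {..<n} (resid {..<n} x' ks (x' A)) (resid {..<n} x' ks (x' A))"
    using r s by (auto intro!: ip_cong)
  then show "f (ip {..<n} (resid {..<n} x ks (x A)) (\<lambda>k. (\<Sum>u\<in>U. c u * x u k) + g k)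
      / ip {..<n} (resid {..<n} x ks (x A)) (resid {..<n} x ks (x A)))
    = f (ip {..<n} (resid {..<n} x' ks (x' A)) (\<lambda>k. (\<Sum>u\<in>U. c u * x' u k) + g' k)
      / ip {..<n} (resid {..<n} x' ks (x' A)) (resid {..<n} x' ks (x' A)))" by simp
next
  fix M :: "((nat \<Rightarrow> real) \<times> ('a \<times> nat \<Rightarrow> real)) measure"
    and g :: "_ \<Rightarrow> nat \<Rightarrow> real" and x :: "_ \<Rightarrow> 'a \<Rightarrow> nat \<Rightarrow> real"
  assume g: "\<And>k. k < n \<Longrightarrow> (\<lambda>\<omega>. g \<omega> k) \<in> borel_measurable M"
    and x: "\<And>s k. s \<in> S \<Longrightarrow> k < n \<Longrightarrow> (\<lambda>\<omega>. x \<omega> s k) \<in> borel_measurable M"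
  have r: "(\<lambda>\<omega>. resid {..<n} (x \<omega>) ks (x \<omega> A) k) \<in> borel_measurable M" if "k \<in> {..<n}" for k
    using that S by (intro measurable_resid finite_lessThan x) auto
  have s: "(\<lambda>\<omega>. (\<Sum>u\<in>U. c u * x \<omega> u k) + g \<omega> k) \<in> borel_measurable M" if "k \<in> {..<n}" for k
    using that S by (intro borel_measurable_add borel_measurable_sum borel_measurable_times
        borel_measurable_const x g) auto
  show "(\<lambda>\<omega>. f (ip {..<n} (resid {..<n} (x \<omega>) ks (x \<omega> A)) (\<lambda>k. (\<Sum>u\<in>U. c u * x \<omega> u k) + g \<omega> k)
      / ip {..<n} (resid {..<n} (x \<omega>) ks (x \<omega> A)) (resid {..<n} (x \<omega>) ks (x \<omega> A)))) \<in> borel_measurable M"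
    by (intro measurable_compose[OF _ f] borel_measurable_divide measurable_ip r s)
qed

text \<open>\<open>r\<close> and \<open>m\<close> are values frozen by conditioning: the ratio is a
  constant bias plus a Gaussian linear form in \<open>z\<close>. If \<open>r\<close> has norm zero,
  all quotients are zero and both claims persist, so exceptional samples cause no case distinction
  later.\<close>

lemma nn_integral_ratio_square:
  fixes r m :: "nat \<Rightarrow> real" and n :: nat and \<alpha> :: real
  assumes n: "0 < n"
  defines "R \<equiv> ennreal (\<alpha>\<^sup>2) * ennreal (1 / ip {..<n} r r) * (\<integral>\<^sup>+z. ennreal ((z 0)\<^sup>2) \<partial>gauss {..<n})"
  shows "R \<le> (\<integral>\<^sup>+z. ennreal ((ip {..<n} r (\<lambda>k. m k + \<alpha> * z k) / ip {..<n} r r)\<^sup>2) \<partial>gauss {..<n})"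
    and "ip {..<n} r m = 0 \<Longrightarrow>
      (\<integral>\<^sup>+z. ennreal ((ip {..<n} r (\<lambda>k. m k + \<alpha> * z k) / ip {..<n} r r)\<^sup>2) \<partial>gauss {..<n}) = R"
proof -
  define u where "u = (\<lambda>k. \<alpha> / ip {..<n} r r * r k)"
  have eq: "ip {..<n} r (\<lambda>k. m k + \<alpha> * z k) / ip {..<n} r r = ip {..<n} r m / ip {..<n} r r + ip {..<n} u z" for z
    unfolding u_def ip_add_right ip_scale_right ip_scale_left by (simp add: add_divide_distrib)
  have uu: "ip {..<n} u u = \<alpha>\<^sup>2 * (1 / ip {..<n} r r)"
    unfolding u_def ip_scale_right ip_scale_left by (simp add: power2_eq_square)
  have R: "R = (\<integral>\<^sup>+z. ennreal ((ip {..<n} u z)\<^sup>2) \<partial>gauss {..<n})"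
    unfolding nn_integral_ip_square[OF n] uu R_def
    by (subst ennreal_mult) (auto simp: ip_self_nonneg)
  show "R \<le> (\<integral>\<^sup>+z. ennreal ((ip {..<n} r (\<lambda>k. m k + \<alpha> * z k) / ip {..<n} r r)\<^sup>2) \<partial>gauss {..<n})"
    unfolding R eq by (rule nn_integral_shifted_square_ge)
  show "(\<integral>\<^sup>+z. ennreal ((ip {..<n} r (\<lambda>k. m k + \<alpha> * z k) / ip {..<n} r r)\<^sup>2) \<partial>gauss {..<n}) = R"
    if "ip {..<n} r m = 0"
    unfolding R eq by (simp add: that)
qed

text \<open>A coupling: both reciprocals use the same \<open>z\<close>, so the larger factor and the
  longer sum decide pointwise. Almost surely \<open>z 0\<close> is nonzero and keeps the shorter sum
  positive; the convention \<open>1 / 0 = 0\<close> could otherwise break the inequality.\<close>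

lemma nn_integral_inverse_sum_squares_mono:
  fixes p q n :: nat
  assumes a: "0 < a" "a \<le> b" and pq: "0 < p" "p \<le> q" "q \<le> n"
  shows "(\<integral>\<^sup>+z. ennreal (1 / (b * ip {..<q} z z)) \<partial>gauss {..<n})
       \<le> (\<integral>\<^sup>+z. ennreal (1 / (a * ip {..<p} z z)) \<partial>gauss {..<n})"
proof (rule nn_integral_mono_AE)
  have "AE z in gauss {..<n}. z 0 \<noteq> 0"
    using pq by (intro AE_gauss_component_nonzero) auto
  then show "AE z in gauss {..<n}. ennreal (1 / (b * ip {..<q} z z)) \<le> ennreal (1 / (a * ip {..<p} z z))"
  proof eventually_elim
    fix z :: "nat \<Rightarrow> real" assume "z 0 \<noteq> 0"
    moreover have "0 \<in> {..<p}" using pq by simp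
    ultimately have "ip {..<p} z z \<noteq> 0" by (metis finite_lessThan ip_self_eq_0_iff)
    then have p: "ip {..<p} z z > 0" using ip_self_nonneg[of "{..<p}" z] by simp
    have "ip {..<p} z z \<le> ip {..<q} z z"
      unfolding ip_def using pq by (intro sum_mono2) auto
    then have "a * ip {..<p} z z \<le> b * ip {..<q} z z"
      using a p by (intro mult_mono) auto
    then show "ennreal (1 / (b * ip {..<q} z z)) \<le> ennreal (1 / (a * ip {..<p} z z))"
      using a p by (intro ennreal_leI frac_le) auto
  qed
qed

section \<open>Linear structural equation models\<close>

text \<open>The matrix of total effects, the inverse of identity minus coefficient matrix, computed
  by recursion along the edges. Rows outside \<open>V\<close> are zero to match the convention of
  \<open>sem_sol\<close>.\<close>

definition sem_matrix :: "'v set \<Rightarrow> ('v \<times> 'v) set \<Rightarrow> ('v \<Rightarrow> 'v \<Rightarrow> real) \<Rightarrow> 'v \<Rightarrow> 'v \<Rightarrow> real" where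
  "sem_matrix V E \<beta> = wfrec E (\<lambda>f v i. if v \<in> V then (\<Sum>j\<in>parents E v. \<beta> v j * f j i) + (if v = i then 1 else 0) else 0)"

text \<open>The coefficients of a variable in terms of the standardized errors; the covariance of two variables
  is the inner product of their rows.\<close>

definition sem_row :: "'v set \<Rightarrow> ('v \<times> 'v) set \<Rightarrow> ('v \<Rightarrow> 'v \<Rightarrow> real) \<Rightarrow> ('v \<Rightarrow> real) \<Rightarrow> 'v \<Rightarrow> 'v \<Rightarrow> real" where
  "sem_row V E \<beta> \<sigma> v i = sem_matrix V E \<beta> v i * \<sigma> i"

text \<open>\<open>W\<close> is the set of nodes whose structural equation is in force: all of
  \<open>V\<close> for \<open>sem_sol\<close>, and \<open>V - {A}\<close> under the
  intervention.\<close>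

lemma sem_equations_unique:
  assumes "wf E" "\<forall>i\<in>W. x i = (\<Sum>j\<in>parents E i. \<beta> i j * x j) + e i"
    "\<forall>i\<in>W. y i = (\<Sum>j\<in>parents E i. \<beta> i j * y j) + e i" "\<forall>i. i \<notin> W \<longrightarrow> x i = y i"
  shows "x = y"
proof
  fix v
  show "x v = y v"
    using assms(1)
  proof (induction v rule: wf_induct_rule)
    case (less v)
    then have "(\<Sum>j\<in>parents E v. \<beta> v j * x j) = (\<Sum>j\<in>parents E v. \<beta> v j * y j)"
      by (intro sum.cong) (auto simp: parents_def)
    then show ?case using assms by (cases "v \<in> W") auto
  qed
qed

lemma integrable_noise_component:
  assumes "finite V" "\<forall>i\<in>V. 0 < \<sigma> i" "i \<in> V"
  shows "integrable (noise V \<sigma>) (\<lambda>\<epsilon>. \<epsilon> i)"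
proof -
  define M where "M = (\<lambda>i. density lborel (normal_density 0 (if i \<in> V then \<sigma> i else 1)))"
  interpret product_prob_space M V
    by (intro product_prob_spaceI) (use assms in \<open>auto simp: M_def intro!: prob_space_normal_density\<close>)
  have N: "noise V \<sigma> = PiM V M" unfolding noise_def by (intro PiM_cong) (auto simp: M_def)
  have "integrable lborel (\<lambda>x. normal_density 0 (\<sigma> i) x * x)"
    using integrable_normal_moment_nz_1[of "\<sigma> i" 0] assms by auto
  then have "integrable (M i) (\<lambda>x. x)"
    using assms by (simp add: M_def integrable_density)
  then have "integrable (distr (PiM V M) (M i) (\<lambda>\<epsilon>. \<epsilon> i)) (\<lambda>x. x)"
    using PiM_component[OF assms(3)] by simp
  then show ?thesis unfolding N
    by (rule integrable_distr[rotated]) (rule measurable_component_singleton[OF assms(3)])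
qed

lemma prob_space_noise: "\<forall>i\<in>V. 0 < \<sigma> i \<Longrightarrow> prob_space (noise V \<sigma>)"
  unfolding noise_def by (intro prob_space_PiM prob_space_normal_density) auto

lemma distr_std_normal_scale:
  assumes "0 < s"
  shows "distr std_normal lborel (\<lambda>x. s * x) = density lborel (normal_density 0 s)"
proof -
  have "distributed std_normal lborel (\<lambda>x. x) (normal_density 0 1)"
    by (auto simp: distributed_def distr_id2)
  from std.normal_density_affine[OF this, of s 0] assms
  have "distributed std_normal lborel (\<lambda>x. s * x) (normal_density 0 s)" by simp
  from distributed_distr_eq_density[OF this] show ?thesis .
qed

text \<open>Rescaling each error moves all sample integrals to independent standard Gaussians, for
  which rotation invariance is available.\<close>

lemma sample_measure_eq_distr:
  assumes V: "finite V" "\<forall>i\<in>V. 0 < \<sigma> i"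
  shows "(\<lambda>\<omega>. \<lambda>k\<in>{..<n}. \<lambda>i\<in>V. \<sigma> i * \<omega> k i) \<in> gauss_sample {..<n} V \<rightarrow>\<^sub>M sample_measure n V \<sigma>"
    and "sample_measure n V \<sigma> = distr (gauss_sample {..<n} V) (sample_measure n V \<sigma>)
       (\<lambda>\<omega>. \<lambda>k\<in>{..<n}. \<lambda>i\<in>V. \<sigma> i * \<omega> k i)"
proof -
  have sets: "sets (noise V \<sigma>) = sets (PiM V (\<lambda>_. lborel))"
    unfolding noise_def by (intro sets_PiM_cong) auto
  have N: "distr (gauss V) (PiM V (\<lambda>_. lborel)) (\<lambda>x. \<lambda>i\<in>V. \<sigma> i * x i) = noise V \<sigma>"
    unfolding gauss_def noise_def
    by (subst distr_PiM_componentwise[where M = "\<lambda>_. std_normal" and N = "\<lambda>_. lborel" and f = "\<lambda>i x. \<sigma> i * x"])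
       (use V in \<open>auto intro!: PiM_cong distr_std_normal_scale prob_space_std_normal\<close>)
  then have N': "distr (gauss V) (noise V \<sigma>) (\<lambda>x. \<lambda>i\<in>V. \<sigma> i * x i) = noise V \<sigma>"
    using distr_cong[OF refl sets, of "gauss V"] by simp
  have "(\<lambda>x. \<lambda>i\<in>V. \<sigma> i * x i) \<in> PiM V (\<lambda>_. borel) \<rightarrow>\<^sub>M PiM V (\<lambda>_. borel :: real measure)"
    by measurable
  then have m: "(\<lambda>x. \<lambda>i\<in>V. \<sigma> i * x i) \<in> gauss V \<rightarrow>\<^sub>M noise V \<sigma>"
    by (simp cong: measurable_cong_sets sets_PiM_cong add: sets_gauss sets)
  show "(\<lambda>\<omega>. \<lambda>k\<in>{..<n}. \<lambda>i\<in>V. \<sigma> i * \<omega> k i) \<in> gauss_sample {..<n} V \<rightarrow>\<^sub>M sample_measure n V \<sigma>"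
    unfolding gauss_sample_def sample_measure_def
    by (intro measurable_restrict measurable_compose[OF _ m] measurable_component_singleton)
  show "sample_measure n V \<sigma> = distr (gauss_sample {..<n} V) (sample_measure n V \<sigma>)
       (\<lambda>\<omega>. \<lambda>k\<in>{..<n}. \<lambda>i\<in>V. \<sigma> i * \<omega> k i)"
    unfolding gauss_sample_def sample_measure_def
    using distr_PiM_componentwise[of "{..<n}" "\<lambda>_. gauss V" "\<lambda>_ x. \<lambda>i\<in>V. \<sigma> i * x i" "\<lambda>_. noise V \<sigma>"] m
    by (simp add: N' prob_space_gauss)
qed

section \<open>Structure and solutions of models in which only the outcome descends from the
  treatment\<close>

locale pretreatment_graph =
  fixes V :: "'v set" and E :: "('v \<times> 'v) set" and A Y :: 'v
  assumes dag: "dag V E" and AV: "A \<in> V" and YV: "Y \<in> V" and AY: "A \<noteq> Y" and edge: "(A, Y) \<in> E"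
    and pretreatment: "\<forall>v\<in>V - {A, Y}. \<not> descendant E A v"
begin

lemma finV: "finite V" and EV: "E \<subseteq> V \<times> V" and acyclic: "acyclic E"
  using dag by (auto simp: dag_def)

lemma wfE: "wf E"
  using finite_subset[OF EV] finV acyclic by (intro finite_acyclic_wf) auto

text \<open>A child of \<open>Y\<close> would descend from \<open>A\<close> through the edge from
  \<open>A\<close> to \<open>Y\<close>, while acyclicity keeps it distinct from both.\<close>

lemma Y_sink: "(Y, v) \<notin> E"
proof
  assume Yv: "(Y, v) \<in> E"
  then have Av: "(A, v) \<in> E\<^sup>+" using edge by (meson r_into_trancl' trancl_into_trancl)
  then have "v \<noteq> A" using acyclic by (auto simp: acyclic_def)
  moreover have "v \<noteq> Y" using Yv acyclic by (auto simp: acyclic_def)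
  ultimately show False using pretreatment Av Yv EV by (auto simp: descendant_def)
qed

lemma A_parent_only_Y: "(A, v) \<in> E \<Longrightarrow> v = Y"
  using pretreatment EV acyclic by (auto simp: descendant_def acyclic_def)

lemma mediators_eq: "mediators V E A Y = {Y}"
proof -
  have "m = Y" if "m \<in> V" "(A, m) \<in> E\<^sup>+" for m
    using that pretreatment acyclic by (auto simp: descendant_def acyclic_def)
  then show ?thesis using YV edge by (auto simp: mediators_def)
qed

lemma optimal_set_eq: "optimal_set V E A Y = parents E Y - {A}"
  unfolding optimal_set_def mediators_eq using Y_sink by (auto simp: parents_def)

lemma optimal_set_subset: "optimal_set V E A Y \<subseteq> V - {A, Y}"
  unfolding optimal_set_eq using EV Y_sink by (auto simp: parents_def)

lemma finite_optimal_set: "finite (optimal_set V E A Y)"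
  using finite_subset[OF optimal_set_subset] finV by auto

lemma parents_Y: "parents E Y = insert A (optimal_set V E A Y)" "A \<notin> optimal_set V E A Y"
  unfolding optimal_set_eq using edge by (auto simp: parents_def)

lemma sem_matrix_rec:
  "sem_matrix V E \<beta> v i = (if v \<in> V then (\<Sum>j\<in>parents E v. \<beta> v j * sem_matrix V E \<beta> j i) + (if v = i then 1 else 0) else 0)"
proof -
  have "adm_wf E (\<lambda>f v i. if v \<in> V then (\<Sum>j\<in>parents E v. \<beta> v j * f j i) + (if v = i then 1 else 0) else (0::real))"
    unfolding adm_wf_def by (auto simp: fun_eq_iff parents_def intro!: sum.cong)
  from wfrec_fixpoint[OF wfE this, THEN fun_cong, of v, THEN fun_cong, of i]
  show ?thesis unfolding sem_matrix_def .
qed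

lemma sem_sol_eqI:
  assumes "\<forall>i\<in>V. x i = (\<Sum>j\<in>parents E i. \<beta> i j * x j) + \<epsilon> i" "\<forall>i. i \<notin> V \<longrightarrow> x i = 0"
  shows "sem_sol V E \<beta> \<epsilon> = x"
  unfolding sem_sol_def using assms by (intro the_equality conjI sem_equations_unique[OF wfE, of V]) auto

lemma sem_matrix_solves:
  "\<forall>v\<in>V. ip V (sem_matrix V E \<beta> v) \<epsilon> = (\<Sum>j\<in>parents E v. \<beta> v j * ip V (sem_matrix V E \<beta> j) \<epsilon>) + \<epsilon> v"
  "\<forall>v. v \<notin> V \<longrightarrow> ip V (sem_matrix V E \<beta> v) \<epsilon> = 0"
proof -
  show "\<forall>v\<in>V. ip V (sem_matrix V E \<beta> v) \<epsilon> = (\<Sum>j\<in>parents E v. \<beta> v j * ip V (sem_matrix V E \<beta> j) \<epsilon>) + \<epsilon> v"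
  proof
    fix v assume v: "v \<in> V"
    have "ip V (sem_matrix V E \<beta> v) \<epsilon>
        = ip V (\<lambda>i. (\<Sum>j\<in>parents E v. \<beta> v j * sem_matrix V E \<beta> j i) + (if v = i then 1 else 0)) \<epsilon>"
      by (rule ip_cong) (use v sem_matrix_rec[of \<beta> v] in auto)
    also have "\<dots> = (\<Sum>j\<in>parents E v. \<beta> v j * ip V (sem_matrix V E \<beta> j) \<epsilon>) + ip V (\<lambda>i. if v = i then 1 else 0) \<epsilon>"
      by (simp add: ip_add_left ip_sum_left ip_scale_left)
    also have "ip V (\<lambda>i. if v = i then 1 else 0) \<epsilon> = \<epsilon> v"
      using v finV by (simp add: ip_def if_distrib[of "\<lambda>c. c * _"] cong: if_cong)
    finally show "ip V (sem_matrix V E \<beta> v) \<epsilon> = (\<Sum>j\<in>parents E v. \<beta> v j * ip V (sem_matrix V E \<beta> j) \<epsilon>) + \<epsilon> v" .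
  qed
  have "sem_matrix V E \<beta> v i = 0" if "v \<notin> V" for v i
    using that by (subst sem_matrix_rec) simp
  then show "\<forall>v. v \<notin> V \<longrightarrow> ip V (sem_matrix V E \<beta> v) \<epsilon> = 0"
    by (simp add: ip_def)
qed

lemma sem_sol_eq: "sem_sol V E \<beta> \<epsilon> v = ip V (sem_matrix V E \<beta> v) \<epsilon>"
  using sem_sol_eqI[OF sem_matrix_solves[of \<beta> \<epsilon>]] by simp

text \<open>As \<open>Y\<close> is a sink, its error enters no other variable. This is the
  independence of the noise of \<open>Y\<close> from all regressors.\<close>

lemma sem_matrix_Y:
  assumes "v \<noteq> Y"
  shows "sem_matrix V E \<beta> v Y = 0"
  using wfE assms
proof (induction v rule: wf_induct_rule)
  case (less v)
  have "(\<Sum>j\<in>parents E v. \<beta> v j * sem_matrix V E \<beta> j Y) = 0"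
    using less Y_sink by (intro sum.neutral) (auto simp: parents_def)
  then show ?case using less by (subst sem_matrix_rec) simp
qed

text \<open>Changing the equation of the sink leaves all other variables alone; hence a test model
  for \<open>Y\<close> shares the joint law of the regressors with the given model.\<close>

lemma sem_matrix_cong:
  assumes "\<And>i j. i \<noteq> Y \<Longrightarrow> \<beta> i j = \<beta>' i j" "v \<noteq> Y"
  shows "sem_matrix V E \<beta> v i = sem_matrix V E \<beta>' v i"
  using wfE assms(2)
proof (induction v rule: wf_induct_rule)
  case (less v)
  have "(\<Sum>j\<in>parents E v. \<beta> v j * sem_matrix V E \<beta> j i) = (\<Sum>j\<in>parents E v. \<beta>' v j * sem_matrix V E \<beta>' j i)"
  proof (rule sum.cong[OF refl])
    fix j assume "j \<in> parents E v"
    then have "(j, v) \<in> E" "j \<noteq> Y" using Y_sink by (auto simp: parents_def)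
    then show "\<beta> v j * sem_matrix V E \<beta> j i = \<beta>' v j * sem_matrix V E \<beta>' j i"
      using less assms(1)[of v j] by simp
  qed
  then show ?case by (subst (1 2) sem_matrix_rec) simp
qed

text \<open>\<open>Y\<close> is the only child of \<open>A\<close>, so the intervention alters
  \<open>A\<close> and \<open>Y\<close> alone and every other variable keeps its observational
  value. The result is affine in \<open>a\<close> with slope \<open>\<beta> Y A\<close>.\<close>

lemma sem_do_Y:
  "sem_do V E \<beta> A a \<epsilon> Y = \<beta> Y A * a + ((\<Sum>j\<in>optimal_set V E A Y. \<beta> Y j * sem_sol V E \<beta> \<epsilon> j) + \<epsilon> Y)"
proof -
  define x where "x = (\<lambda>v. if v = A then a else if v = Y then
    \<beta> Y A * a + ((\<Sum>j\<in>optimal_set V E A Y. \<beta> Y j * sem_sol V E \<beta> \<epsilon> j) + \<epsilon> Y) else sem_sol V E \<beta> \<epsilon> v)"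
  note sol = sem_matrix_solves[of \<beta> \<epsilon>, folded sem_sol_eq]
  have "sem_do V E \<beta> A a \<epsilon> = x"
    unfolding sem_do_def
  proof (rule the_equality)
    show *: "x A = a \<and> (\<forall>i\<in>V - {A}. x i = (\<Sum>j\<in>parents E i. \<beta> i j * x j) + \<epsilon> i) \<and> (\<forall>i. i \<notin> V \<longrightarrow> x i = 0)"
    proof (intro conjI ballI allI impI)
      fix i assume i: "i \<in> V - {A}"
      show "x i = (\<Sum>j\<in>parents E i. \<beta> i j * x j) + \<epsilon> i"
      proof (cases "i = Y")
        case True
        have "(\<Sum>j\<in>optimal_set V E A Y. \<beta> Y j * x j) = (\<Sum>j\<in>optimal_set V E A Y. \<beta> Y j * sem_sol V E \<beta> \<epsilon> j)"
          using optimal_set_subset by (intro sum.cong) (auto simp: x_def)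
        then show ?thesis using True AY parents_Y finite_optimal_set by (simp add: x_def)
      next
        case False
        have "(\<Sum>j\<in>parents E i. \<beta> i j * x j) = (\<Sum>j\<in>parents E i. \<beta> i j * sem_sol V E \<beta> \<epsilon> j)"
          using False A_parent_only_Y Y_sink by (intro sum.cong) (auto simp: x_def parents_def)
        then show ?thesis using False i sol by (simp add: x_def)
      qed
    qed (use AV YV sol in \<open>auto simp: x_def\<close>)
    fix y assume "y A = a \<and> (\<forall>i\<in>V - {A}. y i = (\<Sum>j\<in>parents E i. \<beta> i j * y j) + \<epsilon> i) \<and> (\<forall>i. i \<notin> V \<longrightarrow> y i = 0)"
    with * show "y = x"
      by (intro sem_equations_unique[OF wfE, of "V - {A}"]) auto
  qed
  then show ?thesis using AY by (simp add: x_def)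
qed

lemma causal_effect_eq:
  assumes "lin_sem V E \<beta> \<sigma>"
  shows "causal_effect V E \<beta> \<sigma> A Y = \<beta> Y A"
proof -
  have \<sigma>: "\<forall>i\<in>V. 0 < \<sigma> i" using assms by (simp add: lin_sem_def)
  interpret prob_space "noise V \<sigma>" by (rule prob_space_noise[OF \<sigma>])
  define c where "c = (\<lambda>\<epsilon>. (\<Sum>j\<in>optimal_set V E A Y. \<beta> Y j * sem_sol V E \<beta> \<epsilon> j) + \<epsilon> Y)"
  have c: "integrable (noise V \<sigma>) c"
    unfolding c_def sem_sol_eq ip_def
    by (intro Bochner_Integration.integrable_add Bochner_Integration.integrable_sum integrable_mult_right
        integrable_noise_component[OF finV \<sigma>] YV)
  have "(\<integral>\<epsilon>. sem_do V E \<beta> A a \<epsilon> Y \<partial>noise V \<sigma>) = \<beta> Y A * a + (\<integral>\<epsilon>. c \<epsilon> \<partial>noise V \<sigma>)" for a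
  proof -
    have "sem_do V E \<beta> A a \<epsilon> Y = \<beta> Y A * a + c \<epsilon>" for \<epsilon> by (simp add: sem_do_Y c_def)
    then show ?thesis using c by (simp add: prob_space)
  qed
  then have "((\<lambda>a. \<integral>\<epsilon>. sem_do V E \<beta> A a \<epsilon> Y \<partial>noise V \<sigma>) has_real_derivative \<beta> Y A) (at a)" for a
    by (auto intro!: derivative_eq_intros)
  then show ?thesis
    unfolding causal_effect_def by (intro the_equality) (blast dest: DERIV_unique)+
qed

section \<open>Mean squared errors\<close>

lemma sem_row_sample:
  "k < n \<Longrightarrow> ip V (sem_matrix V E \<beta> v) ((\<lambda>k\<in>{..<n}. \<lambda>i\<in>V. \<sigma> i * \<omega> k i) k) = ip V (sem_row V E \<beta> \<sigma> v) (\<omega> k)"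
  by (simp add: ip_def sem_row_def mult.assoc)

lemma sem_row_Y:
  "i \<in> V \<Longrightarrow> sem_row V E \<beta> \<sigma> Y i
     = (\<Sum>j\<in>parents E Y. \<beta> Y j * sem_row V E \<beta> \<sigma> j i) + (if i = Y then \<sigma> Y else 0)"
  unfolding sem_row_def using YV
  by (subst sem_matrix_rec) (auto simp: distrib_right sum_distrib_right mult.assoc)

lemma sem_row_at_Y: "v \<noteq> Y \<Longrightarrow> sem_row V E \<beta> \<sigma> v Y = 0"
  by (simp add: sem_row_def sem_matrix_Y)

text \<open>Errors and variables determine each other: the errors whose solution is the indicator of
  \<open>s\<close> give a vector pairing to one with the row of \<open>s\<close> and to zero with
  every other row.\<close>

lemma indep_sem_row:
  assumes sem: "lin_sem V E \<beta> \<sigma>" and ss: "distinct ss" "set ss \<subseteq> V"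
  shows "indep V (sem_row V E \<beta> \<sigma>) ss"
  using ss
proof (induction ss)
  case (Cons s ss)
  let ?b = "sem_row V E \<beta> \<sigma>"
  define x where "x = (\<lambda>v. if v = s then 1 else 0 :: real)"
  \<comment> \<open>The errors found by inserting \<open>x\<close> into the structural equations;
    dividing by \<open>\<sigma>\<close> below passes to the scale of the standardized rows.\<close>
  define e where "e = (\<lambda>i. x i - (\<Sum>j\<in>parents E i. \<beta> i j * x j))"
  have be: "ip V (?b v) (\<lambda>i. e i / \<sigma> i) = x v" for v
  proof -
    have "ip V (?b v) (\<lambda>i. e i / \<sigma> i) = ip V (sem_matrix V E \<beta> v) e"
      unfolding ip_def sem_row_def using sem by (intro sum.cong) (force simp: lin_sem_def)+
    also have "\<dots> = sem_sol V E \<beta> e v" by (rule sem_sol_eq[symmetric])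
    also have "sem_sol V E \<beta> e = x"
      by (rule sem_sol_eqI) (use Cons.prems in \<open>auto simp: e_def x_def\<close>)
    finally show ?thesis .
  qed
  have "ip V (resid V ?b ss (?b s)) (resid V ?b ss (?b s)) \<noteq> 0"
  proof
    assume "ip V (resid V ?b ss (?b s)) (resid V ?b ss (?b s)) = 0"
    then have z: "\<forall>i\<in>V. resid V ?b ss (?b s) i = 0" using finV by (simp add: ip_self_eq_0_iff)
    define h where "h = (\<lambda>i. ?b s i - resid V ?b ss (?b s) i)"
    have "lspan ?b (set ss) h" unfolding h_def by (rule lspan_diff_resid)
    then have "ip V (\<lambda>i. e i / \<sigma> i) h = 0"
    proof (rule ip_lspan_eq_0)
      fix t assume "t \<in> set ss"
      then show "ip V (\<lambda>i. e i / \<sigma> i) (?b t) = 0"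
        using be[of t] Cons.prems by (auto simp: ip_commute x_def)
    qed
    moreover have "ip V (\<lambda>i. e i / \<sigma> i) h = ip V (\<lambda>i. e i / \<sigma> i) (?b s)"
      using z by (intro ip_cong) (auto simp: h_def)
    ultimately show False using be[of s] by (simp add: ip_commute x_def)
  qed
  then show ?case using Cons by simp
qed simp

lemma measurable_sample_sem:
  assumes "k < n"
  shows "(\<lambda>\<omega>. ip V (sem_matrix V E \<beta> v) (\<omega> k)) \<in> borel_measurable (sample_measure n V \<sigma>)"
proof (rule measurable_ip)
  have s: "sets (sample_measure n V \<sigma>) = sets (PiM {..<n} (\<lambda>_. PiM V (\<lambda>_. borel)))"
    unfolding sample_measure_def noise_def by (intro sets_PiM_cong refl) auto
  fix i assume i: "i \<in> V"
  have "(\<lambda>\<omega>. \<omega> k i) \<in> borel_measurable (PiM {..<n} (\<lambda>_. PiM V (\<lambda>_. borel)))"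
    using measurable_compose[OF measurable_component_singleton[of k "{..<n}" "\<lambda>_. PiM V (\<lambda>_. borel)"]
        measurable_component_singleton[OF i]] assms by simp
  then show "(\<lambda>\<omega>. \<omega> k i) \<in> borel_measurable (sample_measure n V \<sigma>)"
    by (simp cong: measurable_cong_sets add: s)
qed auto

text \<open>\<open>ols_coef\<close> is given by a choice of minimiser, with no measurability at
  hand. It is therefore first replaced almost everywhere by the closed form, which is measurable,
  and only then are the errors standardized.\<close>

lemma nn_integral_tau_hat:
  fixes f :: "real \<Rightarrow> ennreal"
  assumes sem: "lin_sem V E \<beta> \<sigma>" and ks: "distinct ks" "set ks \<subseteq> V - {A, Y}" "length ks < n"
    and f: "f \<in> borel_measurable borel"
  shows "(\<integral>\<^sup>+\<omega>. f (tau_hat n V E \<beta> A Y (set ks) \<omega>) \<partial>sample_measure n V \<sigma>)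
    = (\<integral>\<^sup>+\<omega>. f (ip {..<n} (resid {..<n} (\<lambda>s k. ip V (sem_row V E \<beta> \<sigma> s) (\<omega> k)) ks (\<lambda>k. ip V (sem_row V E \<beta> \<sigma> A) (\<omega> k)))
                            (\<lambda>k. ip V (sem_row V E \<beta> \<sigma> Y) (\<omega> k))
           / ip {..<n} (resid {..<n} (\<lambda>s k. ip V (sem_row V E \<beta> \<sigma> s) (\<omega> k)) ks (\<lambda>k. ip V (sem_row V E \<beta> \<sigma> A) (\<omega> k)))
                       (resid {..<n} (\<lambda>s k. ip V (sem_row V E \<beta> \<sigma> s) (\<omega> k)) ks (\<lambda>k. ip V (sem_row V E \<beta> \<sigma> A) (\<omega> k))))
        \<partial>gauss_sample {..<n} V)"
proof -
  define \<Phi> where "\<Phi> = (\<lambda>\<omega> :: nat \<Rightarrow> 'v \<Rightarrow> real. \<lambda>k\<in>{..<n}. \<lambda>i\<in>V. \<sigma> i * \<omega> k i)"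
  have \<sigma>: "\<forall>i\<in>V. 0 < \<sigma> i" using sem by (simp add: lin_sem_def)
  have \<Phi>: "\<Phi> \<in> gauss_sample {..<n} V \<rightarrow>\<^sub>M sample_measure n V \<sigma>"
    "sample_measure n V \<sigma> = distr (gauss_sample {..<n} V) (sample_measure n V \<sigma>) \<Phi>"
    unfolding \<Phi>_def by (rule sample_measure_eq_distr[OF finV \<sigma>])+
  define x where "x = (\<lambda>\<omega> :: nat \<Rightarrow> 'v \<Rightarrow> real. \<lambda>s k. ip V (sem_matrix V E \<beta> s) (\<omega> k))"
  define q where "q = (\<lambda>x :: 'v \<Rightarrow> nat \<Rightarrow> real. ip {..<n} (resid {..<n} x ks (x A)) (x Y)
    / ip {..<n} (resid {..<n} x ks (x A)) (resid {..<n} x ks (x A)))"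
  define x' where "x' = (\<lambda>\<omega> :: nat \<Rightarrow> 'v \<Rightarrow> real. \<lambda>s k. ip V (sem_row V E \<beta> \<sigma> s) (\<omega> k))"
  have xm: "(\<lambda>\<omega>. x \<omega> s k) \<in> borel_measurable (sample_measure n V \<sigma>)" if "k < n" for s k
    unfolding x_def by (rule measurable_sample_sem[OF that])
  have x\<Phi>: "x (\<Phi> \<omega>) s k = x' \<omega> s k" if "k < n" for \<omega> s k
    using sem_row_sample[OF that, of \<beta> s \<sigma> \<omega>] unfolding x_def x'_def \<Phi>_def .
  have A_ks: "distinct (A # ks)" "set (A # ks) \<subseteq> V" using ks AV by auto
  have "AE \<omega> in gauss_sample {..<n} V. indep {..<n} (x' \<omega>) (A # ks)"
    unfolding x'_def using ks by (intro AE_indep_sample[OF finV indep_sem_row[OF sem A_ks]]) simp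
  then have "AE \<omega> in gauss_sample {..<n} V. indep {..<n} (x (\<Phi> \<omega>)) (A # ks)"
    by (rule AE_mp) (use x\<Phi> indep_cong[of "A # ks" "{..<n}"] in \<open>intro AE_I2 impI, blast\<close>)
  then have "AE \<omega> in distr (gauss_sample {..<n} V) (sample_measure n V \<sigma>) \<Phi>. indep {..<n} (x \<omega>) (A # ks)"
    by (subst AE_distr_iff[OF \<Phi>(1)])
       (auto intro!: predE measurable_indep xm simp del: indep.simps)
  then have "AE \<omega> in sample_measure n V \<sigma>. indep {..<n} (x \<omega>) (A # ks)"
    unfolding \<Phi>(2)[symmetric] .
  then have "AE \<omega> in sample_measure n V \<sigma>. tau_hat n V E \<beta> A Y (set ks) \<omega> = q (x \<omega>)"
  proof eventually_elim
    fix \<omega> assume "indep {..<n} (x \<omega>) (A # ks)"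
    from ols_coef_eq[OF A_ks(1), of n "\<lambda>k. sem_sol V E \<beta> (\<omega> k)"] this
    show "tau_hat n V E \<beta> A Y (set ks) \<omega> = q (x \<omega>)"
      unfolding tau_hat_def q_def x_def sem_sol_eq by blast
  qed
  then have "(\<integral>\<^sup>+\<omega>. f (tau_hat n V E \<beta> A Y (set ks) \<omega>) \<partial>sample_measure n V \<sigma>)
     = (\<integral>\<^sup>+\<omega>. f (q (x \<omega>)) \<partial>sample_measure n V \<sigma>)"
    by (intro nn_integral_cong_AE) (auto elim: AE_mp)
  also have "\<dots> = (\<integral>\<^sup>+\<omega>. f (q (x \<omega>)) \<partial>distr (gauss_sample {..<n} V) (sample_measure n V \<sigma>) \<Phi>)"
    unfolding \<Phi>(2)[symmetric] ..
  also have "\<dots> = (\<integral>\<^sup>+\<omega>. f (q (x (\<Phi> \<omega>))) \<partial>gauss_sample {..<n} V)"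
  proof (rule nn_integral_distr[OF \<Phi>(1)])
    have r: "(\<lambda>\<omega>. resid {..<n} (x \<omega>) ks (x \<omega> A) k) \<in> borel_measurable (sample_measure n V \<sigma>)" if "k \<in> {..<n}" for k
      using that by (intro measurable_resid finite_lessThan xm) auto
    show "(\<lambda>\<omega>. f (q (x \<omega>))) \<in> borel_measurable (distr (gauss_sample {..<n} V) (sample_measure n V \<sigma>) \<Phi>)"
      unfolding \<Phi>(2)[symmetric] q_def
      by (intro measurable_compose[OF _ f] borel_measurable_divide measurable_ip r xm) auto
  qed
  also have "\<dots> = (\<integral>\<^sup>+\<omega>. f (q (x' \<omega>)) \<partial>gauss_sample {..<n} V)"
  proof (rule nn_integral_cong)
    fix \<omega> :: "nat \<Rightarrow> 'v \<Rightarrow> real"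
    have "resid {..<n} (x (\<Phi> \<omega>)) ks (x (\<Phi> \<omega>) A) k = resid {..<n} (x' \<omega>) ks (x' \<omega> A) k" if "k \<in> {..<n}" for k
      using that by (intro resid_cong) (auto simp: x\<Phi>)
    then have "q (x (\<Phi> \<omega>)) = q (x' \<omega>)"
      unfolding q_def by (intro arg_cong2[where f = "(/)"] ip_cong) (auto simp: x\<Phi>)
    then show "f (q (x (\<Phi> \<omega>))) = f (q (x' \<omega>))" by simp
  qed
  finally show ?thesis unfolding q_def x'_def .
qed

text \<open>\<open>R\<close> is the contribution of the noise of \<open>Y\<close> alone. The part of
  \<open>Y\<close> explained by \<open>O\<close> can only add a squared bias, and it adds none if it
  lies in the span of the regressors.\<close>

lemma mse_bounds:
  assumes sem: "lin_sem V E \<beta> \<sigma>" and ks: "distinct ks" "set ks \<subseteq> V - {A, Y}" "length ks < n"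
  defines "a \<equiv> resid V (sem_row V E \<beta> \<sigma>) ks (sem_row V E \<beta> \<sigma> A)"
  defines "R \<equiv> ennreal ((\<sigma> Y)\<^sup>2) * (\<integral>\<^sup>+z. ennreal (1 / (ip V a a * ip {..<n - length ks} z z)) \<partial>gauss {..<n})
      * (\<integral>\<^sup>+z. ennreal ((z 0)\<^sup>2) \<partial>gauss {..<n})"
  shows "R \<le> mse n V E \<beta> \<sigma> A Y (set ks)"
    and "set ks = optimal_set V E A Y \<Longrightarrow> mse n V E \<beta> \<sigma> A Y (set ks) = R"
proof -
  let ?b = "sem_row V E \<beta> \<sigma>" and ?U = "optimal_set V E A Y"
  let ?C = "\<integral>\<^sup>+z. ennreal ((z 0)\<^sup>2) \<partial>gauss {..<n}"
  have n: "0 < n" using ks by simp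
  define x where "x = (\<lambda>\<omega> :: nat \<Rightarrow> 'v \<Rightarrow> real. \<lambda>s (k :: nat). ip V (?b s) (\<omega> k))"
  define r where "r = (\<lambda>x :: 'v \<Rightarrow> nat \<Rightarrow> real. resid {..<n} x ks (x A))"
  \<comment> \<open>The contribution of the parents of \<open>Y\<close> other than \<open>A\<close>;
    its pairing with the residual of \<open>A\<close> is the bias before normalisation.\<close>
  define m where "m = (\<lambda>x :: 'v \<Rightarrow> nat \<Rightarrow> real. \<lambda>k. \<Sum>u\<in>?U. \<beta> Y u * x u k)"
  define e where "e = (\<lambda>i. if i = Y then \<sigma> Y else 0)"
  define F where "F = (\<lambda>g x. ennreal ((ip {..<n} (r x) (\<lambda>k. m x k + g k) / ip {..<n} (r x) (r x))\<^sup>2))"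
  \<comment> \<open>Everything held fixed while the noise of \<open>Y\<close> is split off: the
    treatment, the regressors and the parents entering \<open>m\<close>.\<close>
  define S where "S = insert A (?U \<union> set ks)"
  have F: "sample_functional n S F"
    unfolding F_def r_def m_def S_def
    by (rule ratio_sample_functional[where f = "\<lambda>t. ennreal (t\<^sup>2)"]) auto
  have ipe: "ip V e y = \<sigma> Y * y Y" for y
    using YV finV by (simp add: ip_def e_def if_distrib[of "\<lambda>c. c * _"] cong: if_cong)
  have orth: "ip V e (?b s) = 0" if "s \<in> S" for s
  proof -
    have "s \<noteq> Y" using that optimal_set_subset ks AY by (auto simp: S_def)
    then show ?thesis by (simp add: ipe sem_row_at_Y)
  qed
  obtain \<alpha> where \<alpha>: "\<alpha>\<^sup>2 = ip V e e"
    and dec': "\<And>F. sample_functional n S F \<Longrightarrow>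
      (\<integral>\<^sup>+\<omega>. F (\<lambda>k. ip V e (\<omega> k)) (\<lambda>s k. ip V (?b s) (\<omega> k)) \<partial>gauss_sample {..<n} V)
      = (\<integral>\<^sup>+\<omega>. \<integral>\<^sup>+z. F (\<lambda>k. \<alpha> * z k) (\<lambda>s k. ip V (?b s) (\<omega> k)) \<partial>gauss {..<n} \<partial>gauss_sample {..<n} V)"
    using decouple[where S = S and a = e and B = ?b and n = n, OF finV orth] by blast
  have \<alpha>: "\<alpha>\<^sup>2 = (\<sigma> Y)\<^sup>2" unfolding \<alpha> ipe by (simp add: e_def power2_eq_square)
  have A_ks: "distinct (A # ks)" "set (A # ks) \<subseteq> V" using ks AV by auto
  note ind = indep_sem_row[OF sem A_ks]
  have "mse n V E \<beta> \<sigma> A Y (set ks)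
     = (\<integral>\<^sup>+\<omega>. ennreal ((ip {..<n} (r (x \<omega>)) (x \<omega> Y) / ip {..<n} (r (x \<omega>)) (r (x \<omega>)) - \<beta> Y A)\<^sup>2) \<partial>gauss_sample {..<n} V)"
    unfolding mse_def causal_effect_eq[OF sem] r_def x_def
    by (rule nn_integral_tau_hat[OF sem ks, where f = "\<lambda>t. ennreal ((t - \<beta> Y A)\<^sup>2)"]) simp
  also have "\<dots> = (\<integral>\<^sup>+\<omega>. F (\<lambda>k. ip V e (\<omega> k)) (x \<omega>) \<partial>gauss_sample {..<n} V)"
  proof (rule nn_integral_cong_AE)
    have "AE \<omega> in gauss_sample {..<n} V. indep {..<n} (x \<omega>) (A # ks)"
      unfolding x_def using ks by (intro AE_indep_sample[OF finV ind]) simp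
    then show "AE \<omega> in gauss_sample {..<n} V.
      ennreal ((ip {..<n} (r (x \<omega>)) (x \<omega> Y) / ip {..<n} (r (x \<omega>)) (r (x \<omega>)) - \<beta> Y A)\<^sup>2)
        = F (\<lambda>k. ip V e (\<omega> k)) (x \<omega>)"
    proof eventually_elim
      fix \<omega> assume "indep {..<n} (x \<omega>) (A # ks)"
      then have rr: "ip {..<n} (r (x \<omega>)) (r (x \<omega>)) \<noteq> 0" by (simp add: r_def)
      have rA: "ip {..<n} (r (x \<omega>)) (x \<omega> A) = ip {..<n} (r (x \<omega>)) (r (x \<omega>))"
        unfolding r_def by (simp add: ip_resid_right)
      have xY: "x \<omega> Y = (\<lambda>k. \<beta> Y A * x \<omega> A k + (m (x \<omega>) k + ip V e (\<omega> k)))"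
      proof
        fix k
        have "x \<omega> Y k = ip V (\<lambda>i. (\<Sum>j\<in>parents E Y. \<beta> Y j * ?b j i) + e i) (\<omega> k)"
          unfolding x_def by (rule ip_cong) (auto simp: sem_row_Y e_def)
        also have "\<dots> = \<beta> Y A * x \<omega> A k + (m (x \<omega>) k + ip V e (\<omega> k))"
          unfolding parents_Y(1) ip_add_left ip_sum_left ip_scale_left m_def x_def
          using parents_Y(2) finite_optimal_set by simp
        finally show "x \<omega> Y k = \<dots>" .
      qed
      have "ip {..<n} (r (x \<omega>)) (x \<omega> Y) = \<beta> Y A * ip {..<n} (r (x \<omega>)) (r (x \<omega>))
          + ip {..<n} (r (x \<omega>)) (\<lambda>k. m (x \<omega>) k + ip V e (\<omega> k))"
        unfolding xY by (subst ip_add_right, subst ip_scale_right, subst rA) simp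
      then show "ennreal ((ip {..<n} (r (x \<omega>)) (x \<omega> Y) / ip {..<n} (r (x \<omega>)) (r (x \<omega>)) - \<beta> Y A)\<^sup>2)
          = F (\<lambda>k. ip V e (\<omega> k)) (x \<omega>)"
        using rr unfolding F_def by (simp add: add_divide_distrib)
    qed
  qed
  also have "\<dots> = (\<integral>\<^sup>+\<omega>. \<integral>\<^sup>+z. F (\<lambda>k. \<alpha> * z k) (x \<omega>) \<partial>gauss {..<n} \<partial>gauss_sample {..<n} V)"
    using dec'[OF F] unfolding x_def .
  finally have mse: "mse n V E \<beta> \<sigma> A Y (set ks)
      = (\<integral>\<^sup>+\<omega>. \<integral>\<^sup>+z. F (\<lambda>k. \<alpha> * z k) (x \<omega>) \<partial>gauss {..<n} \<partial>gauss_sample {..<n} V)" .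
  have xm: "(\<lambda>\<omega>. x \<omega> s k) \<in> borel_measurable (gauss_sample {..<n} V)" if "k < n" for s k
    unfolding x_def using that by (intro measurable_ip measurable_sample_component) auto
  have rm: "(\<lambda>\<omega>. r (x \<omega>) k) \<in> borel_measurable (gauss_sample {..<n} V)" if "k \<in> {..<n}" for k
    unfolding r_def using that by (intro measurable_resid finite_lessThan xm) auto
  have rrm: "(\<lambda>\<omega>. ennreal (1 / ip {..<n} (r (x \<omega>)) (r (x \<omega>)))) \<in> borel_measurable (gauss_sample {..<n} V)"
    by (intro measurable_compose[OF _ measurable_ennreal] borel_measurable_divide borel_measurable_const
        measurable_ip rm)
  have R: "R = (\<integral>\<^sup>+\<omega>. ennreal (\<alpha>\<^sup>2) * ennreal (1 / ip {..<n} (r (x \<omega>)) (r (x \<omega>))) * ?C \<partial>gauss_sample {..<n} V)"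
  proof -
    have "(\<integral>\<^sup>+\<omega>. ennreal (1 / ip {..<n} (r (x \<omega>)) (r (x \<omega>))) \<partial>gauss_sample {..<n} V)
      = (\<integral>\<^sup>+z. ennreal (1 / (ip V a a * ip {..<n - length ks} z z)) \<partial>gauss {..<n})"
      unfolding a_def r_def x_def by (rule nn_integral_inverse_resid_norm[OF finV ind ks(3)])
    then show ?thesis
      unfolding R_def \<alpha>
      by (simp add: nn_integral_multc[OF borel_measurable_times_ennreal[OF borel_measurable_const rrm]]
          nn_integral_cmult[OF rrm])
  qed
  show "R \<le> mse n V E \<beta> \<sigma> A Y (set ks)"
    unfolding mse R F_def by (intro nn_integral_mono nn_integral_ratio_square(1)[OF n])
  show "mse n V E \<beta> \<sigma> A Y (set ks) = R" if "set ks = ?U"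
    unfolding mse R F_def
  proof (intro nn_integral_cong nn_integral_ratio_square(2)[OF n])
    fix \<omega>
    have "lspan (x \<omega>) (set ks) (m (x \<omega>))"
      unfolding lspan_def m_def that by (rule exI[of _ "\<beta> Y"]) simp
    then show "ip {..<n} (r (x \<omega>)) (m (x \<omega>)) = 0"
      unfolding r_def by (rule ip_resid_lspan[OF finite_lessThan])
  qed
qed

text \<open>In the test model the estimator is its population coefficient \<open>\<delta>\<close>
  plus an error symmetric about zero, so unbiasedness for a zero effect forces
  \<open>\<delta> = 0\<close>. The numerator of \<open>\<delta>\<close> pairs the residual of
  \<open>A\<close> with the row of \<open>Y\<close>, and there only the row of \<open>u\<close>
  counts.\<close>

lemma valid_adjustment_orthogonal:
  assumes sem: "lin_sem V E \<beta> \<sigma>" and valid: "valid_adjustment V E A Y (set ls)"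
    and ls: "distinct ls" "length ls + 3 < n" and u: "u \<in> optimal_set V E A Y"
  shows "ip V (resid V (sem_row V E \<beta> \<sigma>) ls (sem_row V E \<beta> \<sigma> A)) (sem_row V E \<beta> \<sigma> u) = 0"
proof -
  \<comment> \<open>Only the equation of \<open>Y\<close> changes, so the rows of \<open>A\<close>,
    \<open>ls\<close> and \<open>u\<close> keep their values. The model is admissible because
    \<open>u\<close> is a parent of \<open>Y\<close>.\<close>
  define \<beta>' where "\<beta>' = (\<lambda>i j. if i = Y then if j = u then 1 else 0 else \<beta> i j)"
  define b where "b = sem_row V E \<beta>' \<sigma>"
  have ls': "set ls \<subseteq> V - {A, Y}" using valid by (simp add: valid_adjustment_def)
  have uA: "u \<noteq> A" "u \<noteq> Y" "u \<in> parents E Y"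
    using u optimal_set_subset parents_Y by auto
  have b_eq: "b v = sem_row V E \<beta> \<sigma> v" if "v \<noteq> Y" for v
    using sem_matrix_cong[OF _ that, of \<beta>' \<beta>] by (auto simp: b_def sem_row_def \<beta>'_def fun_eq_iff)
  have sem': "lin_sem V E \<beta>' \<sigma>"
    using sem uA by (auto simp: lin_sem_def \<beta>'_def parents_def)
  have A_ls: "distinct (A # ls)" "set (A # ls) \<subseteq> V" using ls ls' AV by auto
  have ind: "indep V b (A # ls)" unfolding b_def by (rule indep_sem_row[OF sem' A_ls])

  define w where "w = resid V b ls (b A)"
  \<comment> \<open>The population coefficient of \<open>A\<close> when \<open>Y\<close> is
    regressed on \<open>A\<close> and \<open>ls\<close>; \<open>\<eta>\<close> is the population
    residual, orthogonal to all these regressors.\<close>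
  define \<delta> where "\<delta> = ip V (resid V b ls (b Y)) w / ip V w w"
  define \<eta> where "\<eta> = resid V b (A # ls) (b Y)"
  have ww: "ip V w w \<noteq> 0" using ind by (simp add: w_def)
  have \<eta>: "\<eta> i = resid V b ls (b Y) i - \<delta> * w i" for i by (simp add: \<eta>_def \<delta>_def w_def)

  define x where "x = (\<lambda>\<omega> :: nat \<Rightarrow> 'v \<Rightarrow> real. \<lambda>s (k :: nat). ip V (b s) (\<omega> k))"
  define r where "r = (\<lambda>x :: 'v \<Rightarrow> nat \<Rightarrow> real. resid {..<n} x ls (x A))"
  define h where "h = (\<lambda>\<omega>. ip {..<n} (r (x \<omega>)) (\<lambda>k. ip V \<eta> (\<omega> k)) / ip {..<n} (r (x \<omega>)) (r (x \<omega>)))"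
  define G where "G = gauss_sample {..<n} V"
  interpret G: prob_space G unfolding G_def by (rule prob_space_gauss_sample)
  have xm: "(\<lambda>\<omega>. x \<omega> s k) \<in> borel_measurable G" if "k < n" for s k
    unfolding x_def G_def using that by (intro measurable_ip measurable_sample_component) auto
  have rm: "(\<lambda>\<omega>. r (x \<omega>) k) \<in> borel_measurable G" if "k \<in> {..<n}" for k
    unfolding r_def using that by (intro measurable_resid finite_lessThan xm) auto
  have \<eta>m: "(\<lambda>\<omega>. ip V \<eta> (\<omega> k)) \<in> borel_measurable G" if "k \<in> {..<n}" for k
    unfolding G_def using that by (intro measurable_ip measurable_sample_component) auto
  have hm: "h \<in> borel_measurable G"
    unfolding h_def by (intro borel_measurable_divide measurable_ip rm \<eta>m)

  have "AE \<omega> in G. indep {..<n} (x \<omega>) (A # ls)"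
    unfolding x_def G_def using ls by (intro AE_indep_sample[OF finV ind]) simp
  \<comment> \<open>The sample residual of \<open>A\<close> annihilates combinations of
    \<open>ls\<close> and pairs with \<open>w\<close> to its own squared norm, so the sample
    coefficient is \<open>\<delta>\<close> plus the coefficient obtained from
    \<open>\<eta>\<close>.\<close>
  then have AE_q: "AE \<omega> in G. ip {..<n} (r (x \<omega>)) (x \<omega> Y) / ip {..<n} (r (x \<omega>)) (r (x \<omega>)) = \<delta> + h \<omega>"
  proof eventually_elim
    fix \<omega> assume "indep {..<n} (x \<omega>) (A # ls)"
    then have rr: "ip {..<n} (r (x \<omega>)) (r (x \<omega>)) \<noteq> 0" by (simp add: r_def)
    have ortho: "ip {..<n} (r (x \<omega>)) (\<lambda>k. ip V (\<lambda>i. g i - resid V b ls g i) (\<omega> k)) = 0" for g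
      unfolding r_def x_def
      by (intro ip_resid_lspan finite_lessThan lspan_sample lspan_diff_resid) simp
    have "ip {..<n} (r (x \<omega>)) (\<lambda>k. ip V w (\<omega> k)) = ip {..<n} (r (x \<omega>)) (x \<omega> A)"
      using ortho[of "b A"] unfolding ip_diff_left ip_diff_right w_def[symmetric] by (simp add: x_def)
    also have "\<dots> = ip {..<n} (r (x \<omega>)) (r (x \<omega>))"
      unfolding r_def by (simp add: ip_resid_right)
    finally have rw: "ip {..<n} (r (x \<omega>)) (\<lambda>k. ip V w (\<omega> k)) = ip {..<n} (r (x \<omega>)) (r (x \<omega>))" .
    have "\<eta> = (\<lambda>i. resid V b ls (b Y) i - \<delta> * w i)" by (simp add: \<eta> fun_eq_iff)
    then have \<eta>_sample: "ip V \<eta> y = ip V (resid V b ls (b Y)) y - \<delta> * ip V w y" for y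
      by (simp add: ip_diff_left ip_scale_left)
    have "ip {..<n} (r (x \<omega>)) (\<lambda>k. ip V \<eta> (\<omega> k))
        = ip {..<n} (r (x \<omega>)) (x \<omega> Y) - \<delta> * ip {..<n} (r (x \<omega>)) (r (x \<omega>))"
      using ortho[of "b Y"]
      unfolding \<eta>_sample ip_diff_left ip_diff_right ip_scale_right rw by (simp add: x_def)
    then show "ip {..<n} (r (x \<omega>)) (x \<omega> Y) / ip {..<n} (r (x \<omega>)) (r (x \<omega>)) = \<delta> + h \<omega>"
      using rr by (simp add: h_def diff_divide_distrib)
  qed
  have law: "(\<integral>\<^sup>+\<omega>. f (tau_hat n V E \<beta>' A Y (set ls) \<omega>) \<partial>sample_measure n V \<sigma>) = (\<integral>\<^sup>+\<omega>. f (\<delta> + h \<omega>) \<partial>G)"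
    if f: "f \<in> borel_measurable borel" for f :: "real \<Rightarrow> ennreal"
  proof -
    have "(\<integral>\<^sup>+\<omega>. f (tau_hat n V E \<beta>' A Y (set ls) \<omega>) \<partial>sample_measure n V \<sigma>)
      = (\<integral>\<^sup>+\<omega>. f (ip {..<n} (r (x \<omega>)) (x \<omega> Y) / ip {..<n} (r (x \<omega>)) (r (x \<omega>))) \<partial>G)"
      unfolding r_def x_def b_def G_def using ls by (intro nn_integral_tau_hat sem' ls' f) auto
    also have "\<dots> = (\<integral>\<^sup>+\<omega>. f (\<delta> + h \<omega>) \<partial>G)"
      by (rule nn_integral_cong_AE) (use AE_q in eventually_elim, simp)
    finally show ?thesis .
  qed
  \<comment> \<open>\<open>\<eta>\<close> is uncorrelated with the regressors, so its sample
    decouples from them and may be reflected: \<open>h\<close> and \<open>- h\<close> have the same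
    law.\<close>
  have sym: "(\<integral>\<^sup>+\<omega>. f (h \<omega>) \<partial>G) = (\<integral>\<^sup>+\<omega>. f (- h \<omega>) \<partial>G)"
    if f: "f \<in> borel_measurable borel" for f :: "real \<Rightarrow> ennreal"
  proof -
    define F where "F = (\<lambda>f :: real \<Rightarrow> ennreal. \<lambda>g x. f (ip {..<n} (r x) g / ip {..<n} (r x) (r x)))"
    have F: "sample_functional n (set (A # ls)) (F f)" if "f \<in> borel_measurable borel" for f
      using ratio_sample_functional[OF that, of A "set (A # ls)" "{}" ls n]
      unfolding F_def r_def by (simp add: subset_insertI)
    have f': "(\<lambda>t. f (- t)) \<in> borel_measurable borel"
      by (rule measurable_compose[OF _ f]) simp
    have orth: "ip V \<eta> (b s) = 0" if "s \<in> set (A # ls)" for s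
      unfolding \<eta>_def by (rule ip_resid_regressor[OF finV that])
    \<comment> \<open>The same \<open>\<alpha>\<close> serves every functional, in particular
      \<open>f\<close> and its reflection.\<close>
    obtain \<alpha> where dec: "\<And>F. sample_functional n (set (A # ls)) F \<Longrightarrow>
        (\<integral>\<^sup>+\<omega>. F (\<lambda>k. ip V \<eta> (\<omega> k)) (\<lambda>s k. ip V (b s) (\<omega> k)) \<partial>gauss_sample {..<n} V)
        = (\<integral>\<^sup>+\<omega>. \<integral>\<^sup>+z. F (\<lambda>k. \<alpha> * z k) (\<lambda>s k. ip V (b s) (\<omega> k)) \<partial>gauss {..<n} \<partial>gauss_sample {..<n} V)"
      using decouple[where S = "set (A # ls)" and a = \<eta> and B = b and n = n, OF finV orth] by blast
    have "(\<integral>\<^sup>+\<omega>. f (h \<omega>) \<partial>G) = (\<integral>\<^sup>+\<omega>. \<integral>\<^sup>+z. F f (\<lambda>k. \<alpha> * z k) (x \<omega>) \<partial>gauss {..<n} \<partial>G)"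
      using dec[OF F[OF f]] unfolding F_def h_def x_def G_def .
    also have "\<dots> = (\<integral>\<^sup>+\<omega>. \<integral>\<^sup>+z. F (\<lambda>t. f (- t)) (\<lambda>k. \<alpha> * z k) (x \<omega>) \<partial>gauss {..<n} \<partial>G)"
    proof (rule nn_integral_cong)
      fix \<omega>
      have m: "(\<lambda>z. F f (\<lambda>k. \<alpha> * z k) (x \<omega>)) \<in> borel_measurable (gauss {..<n})"
        unfolding F_def
        by (intro measurable_compose[OF _ f] borel_measurable_divide measurable_ip borel_measurable_times
            borel_measurable_const measurable_gauss_component)
      have "F f (\<lambda>k. \<alpha> * (\<lambda>i\<in>{..<n}. - z i) k) (x \<omega>) = F (\<lambda>t. f (- t)) (\<lambda>k. \<alpha> * z k) (x \<omega>)" for z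
        unfolding F_def by (simp add: ip_def sum_negf)
      then show "(\<integral>\<^sup>+z. F f (\<lambda>k. \<alpha> * z k) (x \<omega>) \<partial>gauss {..<n})
          = (\<integral>\<^sup>+z. F (\<lambda>t. f (- t)) (\<lambda>k. \<alpha> * z k) (x \<omega>) \<partial>gauss {..<n})"
        using nn_integral_gauss_preserving[OF gauss_preserving_uminus[OF finite_lessThan] m] by simp
    qed
    also have "\<dots> = (\<integral>\<^sup>+\<omega>. f (- h \<omega>) \<partial>G)"
      using dec[OF F[OF f']] unfolding F_def h_def x_def G_def by simp
    finally show ?thesis .
  qed

  let ?t = "tau_hat n V E \<beta>' A Y (set ls)" and ?M = "sample_measure n V \<sigma>"
  \<comment> \<open>Integrability of the estimator is part of validity; \<open>law\<close> transfers
    it to \<open>\<delta> + h\<close> and thus to \<open>h\<close>, whose mean is then zero by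
    symmetry.\<close>
  have "integrable ?M ?t" and t0: "integral\<^sup>L ?M ?t = 0"
    using valid sem' ls uA causal_effect_eq[OF sem']
    by (auto simp: valid_adjustment_def distinct_card \<beta>'_def AY)
  then have "(\<integral>\<^sup>+\<omega>. ennreal (norm (?t \<omega>)) \<partial>?M) < \<infinity>" by (simp add: integrable_iff_bounded)
  then have "(\<integral>\<^sup>+\<omega>. ennreal (norm (\<delta> + h \<omega>)) \<partial>G) < \<infinity>"
    using law[of "\<lambda>t. ennreal (norm t)"] by simp
  then have Q: "integrable G (\<lambda>\<omega>. \<delta> + h \<omega>)"
    using hm by (simp add: integrable_iff_bounded)
  from Bochner_Integration.integrable_diff[OF this G.integrable_const[of \<delta>]]
  have hint: "integrable G h" by simp
  have "integral\<^sup>L G h = 0"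
    using sym[of ennreal] real_lebesgue_integral_def[OF hint] by simp
  \<comment> \<open>\<open>law\<close> speaks of nonnegative integrals, so positive and negative
    parts are transferred separately.\<close>
  moreover have "integral\<^sup>L G (\<lambda>\<omega>. \<delta> + h \<omega>) = integral\<^sup>L ?M ?t"
    using real_lebesgue_integral_def[OF Q] real_lebesgue_integral_def[OF \<open>integrable ?M ?t\<close>]
      law[of ennreal] law[of "\<lambda>t. ennreal (- t)"] by simp
  ultimately have "\<delta> = 0" using t0 hint by (simp add: G.prob_space)

  then have "ip V w (b Y) = 0"
    using ww ip_resid_right[OF finV, of b ls "b A" "b Y"]
    unfolding \<delta>_def w_def[symmetric] by (simp add: ip_commute)
  moreover have "ip V w (b Y) = ip V w (b u)"
  proof -
    define e where "e = (\<lambda>i. if i = Y then \<sigma> Y else 0)"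
    have ipe: "ip V e y = \<sigma> Y * y Y" for y
      using YV finV by (simp add: ip_def e_def if_distrib[of "\<lambda>c. c * _"] cong: if_cong)
    have orth: "ip V e (b s) = 0" if "s \<noteq> Y" for s
      using that by (simp add: ipe b_def sem_row_at_Y)
    have "ip V e (\<lambda>i. b A i - w i) = 0"
      unfolding w_def by (rule ip_lspan_eq_0[OF lspan_diff_resid orth]) (use ls' in auto)
    \<comment> \<open>The error of \<open>Y\<close> is orthogonal to \<open>A\<close> and
      \<open>ls\<close>, hence to \<open>w\<close>; in the row of \<open>Y\<close> only the term of
      \<open>u\<close> can pair with \<open>w\<close>.\<close>
    then have ew: "ip V w e = 0"
      using orth[OF AY] by (simp add: ip_diff_right ip_commute)
    have "ip V w (b Y) = ip V w (\<lambda>i. (\<Sum>j\<in>parents E Y. \<beta>' Y j * b j i) + e i)"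
      unfolding b_def by (rule ip_cong) (auto simp: sem_row_Y e_def)
    also have "\<dots> = (\<Sum>j\<in>parents E Y. \<beta>' Y j * ip V w (b j))"
      by (simp add: ip_add_right ip_sum_right ip_scale_right ew)
    also have "\<dots> = (\<Sum>j\<in>parents E Y. if j = u then ip V w (b j) else 0)"
      by (intro sum.cong) (auto simp: \<beta>'_def)
    also have "\<dots> = ip V w (b u)"
      using uA finite_optimal_set parents_Y(1) by (simp add: sum.delta)
    finally show ?thesis .
  qed
  moreover have "ip V w (b u) = ip V (resid V (sem_row V E \<beta> \<sigma>) ls (sem_row V E \<beta> \<sigma> A)) (sem_row V E \<beta> \<sigma> u)"
  proof -
    have "b s i = sem_row V E \<beta> \<sigma> s i" if "s \<in> insert u (set (A # ls))" for s i
      using that ls' uA AY by (subst b_eq) auto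
    then show ?thesis unfolding w_def by (intro ip_cong resid_cong) auto
  qed
  ultimately show ?thesis by simp
qed

lemma mse_optimal_set_le:
  assumes sem: "lin_sem V E \<beta> \<sigma>" and n: "card (V - {A, Y}) + 3 < n"
    and valid: "valid_adjustment V E A Y L" and card: "card (optimal_set V E A Y) \<le> card L"
  shows "mse n V E \<beta> \<sigma> A Y (optimal_set V E A Y) \<le> mse n V E \<beta> \<sigma> A Y L"
proof -
  have L: "L \<subseteq> V - {A, Y}" using valid by (simp add: valid_adjustment_def)
  have finVAY: "finite (V - {A, Y})" using finV by simp
  obtain ls where ls: "set ls = L" "distinct ls" using finite_distinct_list finite_subset[OF L finVAY] by blast
  obtain us where us: "set us = optimal_set V E A Y" "distinct us"
    using finite_distinct_list finite_optimal_set by blast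
  have lenl: "length ls = card L" "length ls \<le> card (V - {A, Y})"
    using ls distinct_card card_mono[OF finVAY L] by metis+
  have lenu: "length us = card (optimal_set V E A Y)" using us distinct_card by metis
  let ?b = "sem_row V E \<beta> \<sigma>"
  let ?al = "resid V ?b ls (?b A)" and ?au = "resid V ?b us (?b A)"
  have "indep V ?b (A # ls)" using ls L AV by (intro indep_sem_row[OF sem]) auto
  then have pos: "0 < ip V ?al ?al" using ip_self_nonneg[of V ?al] by simp
  \<comment> \<open>Validity is invoked at the given sample size \<open>n\<close>, which exceeds
    \<open>length ls + 3\<close> because \<open>L\<close> lies in \<open>V - {A, Y}\<close>.\<close>
  have le: "ip V ?al ?al \<le> ip V ?au ?au"
    using valid ls us lenl n by (intro resid_norm_le_of_orthogonal[OF finV] valid_adjustment_orthogonal[OF sem, where n = n]) auto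
  have "mse n V E \<beta> \<sigma> A Y (set us) = ennreal ((\<sigma> Y)\<^sup>2) *
      (\<integral>\<^sup>+z. ennreal (1 / (ip V ?au ?au * ip {..<n - length us} z z)) \<partial>gauss {..<n})
      * (\<integral>\<^sup>+z. ennreal ((z 0)\<^sup>2) \<partial>gauss {..<n})"
    using us optimal_set_subset lenu lenl card n by (intro mse_bounds(2)[OF sem]) auto
  also have "\<dots> \<le> ennreal ((\<sigma> Y)\<^sup>2) *
      (\<integral>\<^sup>+z. ennreal (1 / (ip V ?al ?al * ip {..<n - length ls} z z)) \<partial>gauss {..<n})
      * (\<integral>\<^sup>+z. ennreal ((z 0)\<^sup>2) \<partial>gauss {..<n})"
    using pos le lenl lenu card n
    by (intro mult_right_mono mult_left_mono nn_integral_inverse_sum_squares_mono) auto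
  also have "\<dots> \<le> mse n V E \<beta> \<sigma> A Y (set ls)"
    using ls L lenl n by (intro mse_bounds(1)[OF sem]) auto
  finally show ?thesis using ls us by simp
qed

end

theorem theorem4:
  fixes V :: "'v set" and E :: "('v \<times> 'v) set" and A Y :: 'v
    and \<beta> :: "'v \<Rightarrow> 'v \<Rightarrow> real" and \<sigma> :: "'v \<Rightarrow> real" and n :: nat and L :: "'v set"
  assumes "dag V E"
    and "A \<in> V" and "Y \<in> V" and "A \<noteq> Y" and "(A, Y) \<in> E"
    and "\<forall>v\<in>V - {A, Y}. \<not> descendant E A v"
    and "lin_sem V E \<beta> \<sigma>"
    and "markov_faithful V E \<beta> \<sigma>"
    and "card (V - {A, Y}) + 3 < n"
    and "valid_adjustment V E A Y L"
    and "L \<noteq> optimal_set V E A Y"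
    and "card L \<ge> card (optimal_set V E A Y)"
  shows "mse n V E \<beta> \<sigma> A Y L \<ge> mse n V E \<beta> \<sigma> A Y (optimal_set V E A Y)
    \<and> (L \<in> mse_optimal_sets n V E \<beta> \<sigma> A Y \<longrightarrow>
         optimal_set V E A Y \<in> mse_optimal_sets n V E \<beta> \<sigma> A Y)"
proof -
  interpret pretreatment_graph V E A Y
    using assms by unfold_locales
  have le: "mse n V E \<beta> \<sigma> A Y (optimal_set V E A Y) \<le> mse n V E \<beta> \<sigma> A Y L"
    using assms by (intro mse_optimal_set_le)
  then show ?thesis
    using optimal_set_subset by (auto simp: mse_optimal_sets_def intro: order_trans)
qed

end
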